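(* Let $r\in\mathbb{Z}_{>0}$, $p,q\in\mathbb{C}^*$ with $|p|,|q|<1$, $\epsilon\in\{0,1\}$, and let $t_1,\ldots,t_8\in\mathbb{C}^*$, $n_1,\ldots,n_8\in\mathbb{Z}$ satisfy $$\prod_{a=1}^8t_a=(pq)^2,\qquad \sum_{a=1}^8n_a+4\epsilon=0 .$$ Let $\delta\in\{0,1\}$ be determined by the condition that $\sum_{b=1}^4n_b+\epsilon+\delta$ is even. Let $f$ be a square root $f=\sqrt{\frac{pq}{t_1t_2t_3t_4}}=\sqrt{\frac{t_5t_6t_7t_8}{pq}}$ and set $$s_a=ft_a\ (a=1,2,3,4),\qquad s_a=f^{-1}t_a\ (a=5,6,7,8),$$ $$k_a=n_a-\tfrac12\Big(\sum_{b=1}^4n_b+\epsilon+\delta\Big)\ (a=1,2,3,4),\qquad k_a=n_a-\tfrac12\Big(\sum_{b=5}^8n_b+\epsilon+\delta\Big)\ (a=5,6,7,8).$$ Assume $|t_a|,|s_a|<1$ for all $a$. Then $$V_\epsilon^{(r)}(t_a,n_a;p,q)=V_\delta^{(r)}(s_a,k_a;p,q)\prod_{1\le b<c\le4}\Gamma^{(r)}(t_bt_c,n_b+n_c+\epsilon)\,\Gamma^{(r)}(t_{b+4}t_{c+4},n_{b+4}+n_{c+4}+\epsilon).$$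
   Context: Notation: $(z;p)_\infty=\prod_{j\ge0}(1-zp^j)$ for $|p|<1$. The elliptic gamma function is $\Gamma(z;p,q)=\prod_{j,k=0}^\infty\frac{1-z^{-1}p^{j+1}q^{k+1}}{1-zp^jq^k}$ for $|p|,|q|<1$, $z\in\mathbb{C}^*$. For $r\in\mathbb{Z}_{>0}$, $m\in\mathbb{Z}$, nonzero $p,q$ with $|p|,|q|<1$, the rarefied elliptic gamma function is the meromorphic function of $z\in\mathbb{C}^*$ $$\Gamma^{(r)}(z,m)=\Gamma^{(r)}(z,m;p,q)=(-z)^{\frac{m(m-1)}{2}}p^{\frac{m(m-1)(m-2)}{6}}q^{-\frac{m(m^2-1)}{6}}\;\Gamma(zp^m;p^r,pq)\,\Gamma(zq^{r-m};q^r,pq)$$ (all exponents are integers). Products and quotients of these functions are understood as meromorphic functions. For $\epsilon\in\{0,1\}$, $t_a\in\mathbb{C}^*$ with $|t_a|<1$, $n_a\in\mathbb{Z}$ ($a=1,\ldots,8$) satisfying $\prod_{a=1}^8t_a=(pq)^2$ and $\sum_{a=1}^8n_a+4\epsilon=0$, the rarefied elliptic hypergeometric function is $$V_\epsilon^{(r)}(t_a,n_a;p,q)=\frac{(p^r;p^r)_\infty(q^r;q^r)_\infty}{4\pi\mathrm{i}}\sum_{m=0}^{r-1}\int_{\mathbb{T}}\frac{\prod_{a=1}^8\Gamma^{(r)}(t_az,n_a+\epsilon+m)\,\Gamma^{(r)}(t_az^{-1},n_a-m)}{\Gamma^{(r)}(z^2,2m+\epsilon)\,\Gamma^{(r)}(z^{-2},-2m-\epsilon)}\frac{dz}{z},$$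 with $\mathbb{T}$ the positively oriented unit circle. *)

theory Defs
  imports "HOL-Complex_Analysis.Complex_Analysis"
begin

definition qpoch_inf :: "complex \<Rightarrow> complex \<Rightarrow> complex" where
  "qpoch_inf z p = (\<Prod>j. 1 - z * p ^ j)"

text \<open>
  The double product is an iterated one; for \<open>|p|, |q| < 1\<close> it converges absolutely.
  Since \<open>x / 0 = 0\<close>, the value at a pole is 0.
\<close>
definition elliptic_gamma :: "complex \<Rightarrow> complex \<Rightarrow> complex \<Rightarrow> complex" where
  "elliptic_gamma z p q =
     (\<Prod>j. \<Prod>k. (1 - inverse z * p ^ (j + 1) * q ^ (k + 1)) / (1 - z * p ^ j * q ^ k))"

text \<open>
  The two elliptic gamma factors may have a zero and a pole at the same point, so their product
  has to be taken as a meromorphic function of the first argument, not pointwise: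
  \<^const>\<open>remove_sings\<close> fills in the removable singularities, and gives the value 0 at poles.
  All three integer divisions are exact.
\<close>
definition rarefied_gamma :: "nat \<Rightarrow> complex \<Rightarrow> int \<Rightarrow> complex \<Rightarrow> complex \<Rightarrow> complex" where
  "rarefied_gamma r z m p q =
     remove_sings (\<lambda>w.
       (- w) powi (m * (m - 1) div 2)
       * p powi (m * (m - 1) * (m - 2) div 6)
       * q powi (- (m * (m ^ 2 - 1) div 6))
       * elliptic_gamma (w * p powi m) (p ^ r) (p * q)
       * elliptic_gamma (w * q powi (int r - m)) (q ^ r) (p * q)) z"

text \<open>
  On the unit circle, for \<open>0 < |t\<^sub>a| < 1\<close>, the numerator factors have no poles and the
  denominator factors have no zeros. The latter have poles only where \<open>z\<^sup>2 = 1\<close>; there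
  the convention \<open>x / 0 = 0\<close> agrees with the value of the meromorphic quotient.
\<close>
definition rarefied_V ::
    "nat \<Rightarrow> int \<Rightarrow> (nat \<Rightarrow> complex) \<Rightarrow> (nat \<Rightarrow> int) \<Rightarrow> complex \<Rightarrow> complex \<Rightarrow> complex" where
  "rarefied_V r \<epsilon> t n p q =
     qpoch_inf (p ^ r) (p ^ r) * qpoch_inf (q ^ r) (q ^ r) / (4 * of_real pi * \<i>)
     * (\<Sum>m = 0..int r - 1.
          contour_integral (circlepath 0 1) (\<lambda>z.
            (\<Prod>a = 1..8. rarefied_gamma r (t a * z) (n a + \<epsilon> + m) p q
                         * rarefied_gamma r (t a * inverse z) (n a - m) p q)
            / (rarefied_gamma r (z ^ 2) (2 * m + \<epsilon>) p q
               * rarefied_gamma r (inverse (z ^ 2)) (- 2 * m - \<epsilon>) p q)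
            / z))"

end

theory Submission
  imports Defs
begin

text \<open>
  As for the elliptic hypergeometric function ($r = 1$), the transformation is a consequence of the
  evaluation of a beta integral with six parameters, $\prod t_a = pq$ and $\sum n_a + 3\epsilon = 0$:
  that evaluation, applied to either of the two inner integrals of a suitable double integral, produces
  either side of the formula. This needs some parameters to be small. The general case follows
  by analytic continuation along $t_a e^{c_a w}$: the admissible $w$ form a convex set.

  The beta integral is evaluated in three steps. (1) A theta function identity shows that a
  combination of two $q$-shifted integrands is a symmetrized telescoper, whose mean vanishes because it is
  antisymmetric about the circle $|z| = |q|^{-1/2}$. Hence the ratio of the integral to the conjectured product is
  invariant under $(t_1, n_1) \mapsto (q t_1, n_1 + 1)$ with compensation in another parameter. (2) As a function of
  $t_1$ and $n_1$ the ratio is also $r$-periodic in $n_1$, so that the maximum principle makes it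
  constant: only the products $t_b t_c$ matter. (3) Two such moves bring two parameters to $\pm i\rho$. As
  $\rho \to 1$ the integrand concentrates at $z = \pm i$ like a Poisson kernel, which gives the constant.
\<close>

section \<open>Products and theta functions\<close>

text \<open>Zeros of one elliptic gamma factor of the rarefied gamma function meet poles of the
  other one, so the explicit formula takes wrong values at isolated points. Functional equations are
  therefore proved for the formula off the zeros of its denominators and reach the function itself
  as limits. This works in the punctured closed unit disc, where only a simple pole at 1 has to be
  watched; hence all parameters keep modulus below 1, and the denominator of the integrand is
  reflected into the numerator.

  The evaluation of the beta integral relies on q-shifts: they move t and n together, and
  periodicity in n turns the annulus |t1 t2| < |t| < 1 with its labels n into a compact object, on
  which a holomorphic function is constant. The annulus has to contain a full period of t -> q t,
  which is the condition |t1 t2| < |q| and the source of the smallness assumptions.\<close>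

definition qprod :: "(complex \<Rightarrow> complex) \<Rightarrow> complex \<Rightarrow> complex \<Rightarrow> complex" where
  "qprod f p z = (\<Prod>j. f (z * p ^ j))"

lemma holomorphic_on_compose_UNIV:
  "f holomorphic_on UNIV \<Longrightarrow> g holomorphic_on A \<Longrightarrow> (\<lambda>z. f (g z)) holomorphic_on A"
  using holomorphic_on_compose_gen[of g A f UNIV] by (simp add: o_def)

text \<open>The quotient (f w - 1) / w extends holomorphically to 0 and is bounded on discs. Since
  the bound is linear in w, f (z p^j) - 1 is dominated by a geometric series.\<close>

lemma holomorphic_minus_one_bound:
  fixes f :: "complex \<Rightarrow> complex"
  assumes f: "f holomorphic_on UNIV" "f 0 = 1"
  obtains C where "C \<ge> 0" "\<And>w. norm w \<le> R \<Longrightarrow> norm (f w - 1) \<le> C * norm w"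
proof -
  define g where "g = (\<lambda>z. if z = 0 then deriv f 0 else (f z - f 0) / (z - 0))"
  have "g holomorphic_on UNIV"
    unfolding g_def by (rule pole_lemma_open) (use f in auto)
  hence "continuous_on (cball 0 R) g"
    by (intro holomorphic_on_imp_continuous_on) (auto intro: holomorphic_on_subset)
  hence "bounded (g ` cball 0 R)"
    by (intro compact_imp_bounded compact_continuous_image) auto
  then obtain B where "\<forall>x\<in>g ` cball 0 R. norm x \<le> B"
    unfolding bounded_iff by blast
  hence B: "\<And>w. w \<in> cball 0 R \<Longrightarrow> norm (g w) \<le> B" by blast
  show ?thesis
  proof (rule that[of "max B 0"])
    fix w :: complex assume w: "norm w \<le> R"
    have "f w - 1 = g w * w" using f by (auto simp: g_def)
    hence "norm (f w - 1) = norm (g w) * norm w" by (simp add: norm_mult)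
    also have "\<dots> \<le> max B 0 * norm w"
      using B[of w] w by (intro mult_right_mono) auto
    finally show "norm (f w - 1) \<le> max B 0 * norm w" .
  qed auto
qed

context
  fixes f :: "complex \<Rightarrow> complex" and p :: complex
  assumes f: "f holomorphic_on UNIV" "f 0 = 1" and p: "norm p < 1"
begin

lemma convergent_qprod: "convergent_prod (\<lambda>j. f (z * p ^ j))"
proof -
  obtain C where C: "C \<ge> 0" "\<And>w. norm w \<le> norm z \<Longrightarrow> norm (f w - 1) \<le> C * norm w"
    using holomorphic_minus_one_bound[OF f] by blast
  have "summable (\<lambda>j. norm (f (z * p ^ j) - 1))"
  proof (rule summable_comparison_test')
    show "summable (\<lambda>j. C * norm z * norm p ^ j)"
      using p by (intro summable_mult summable_geometric) auto
    fix j :: nat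
    have "norm (z * p ^ j) \<le> norm z"
      using p by (simp add: norm_mult norm_power mult_left_le power_le_one)
    from C(2)[OF this] show "norm (norm (f (z * p ^ j) - 1)) \<le> C * norm z * norm p ^ j"
      by (simp add: norm_mult norm_power mult_ac)
  qed
  thus ?thesis
    by (intro abs_convergent_prod_imp_convergent_prod summable_imp_abs_convergent_prod)
qed

lemma has_prod_qprod: "(\<lambda>j. f (z * p ^ j)) has_prod qprod f p z"
  unfolding qprod_def using convergent_qprod by (rule convergent_prod_has_prod)

lemma qprod_rec: "qprod f p z = f z * qprod f p (p * z)"
proof -
  have *: "(\<lambda>j. f (z * p ^ Suc j)) = (\<lambda>j. f ((p * z) * p ^ j))"
    by (auto simp: mult_ac)
  have h: "(\<lambda>j. f (z * p ^ Suc j)) has_prod qprod f p (p * z)"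
    unfolding * by (rule has_prod_qprod)
  show ?thesis
  \<comment> \<open>A vanishing first factor is treated apart: \<open>has_prod_Suc_iff\<close> needs
    it to be nonzero.\<close>
  proof (cases "f z = 0")
    case True
    hence "qprod f p z = 0"
      using has_prod_eq_0_iff[OF has_prod_qprod[of z]] True by (auto simp: image_iff intro: exI[of _ 0])
    thus ?thesis using True by simp
  next
    case False
    from h have "(\<lambda>j. f (z * p ^ j)) has_prod (qprod f p (p * z) * f z)"
      using has_prod_Suc_iff[of "\<lambda>j. f (z * p ^ j)"] False by simp
    thus ?thesis using has_prod_unique2[OF has_prod_qprod[of z]] by (simp add: mult_ac)
  qed
qed

lemma qprod_eq_0_iff: "qprod f p z = 0 \<longleftrightarrow> (\<exists>j. f (z * p ^ j) = 0)"
  using has_prod_eq_0_iff[OF has_prod_qprod[of z]] by auto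

lemma holomorphic_qprod: "qprod f p holomorphic_on UNIV"
proof (rule holomorphic_uniform_sequence)
  fix n :: nat
  have "(\<lambda>z. f (z * p ^ j)) holomorphic_on UNIV" for j
    by (intro holomorphic_on_compose_UNIV[OF f(1)] holomorphic_intros)
  thus "(\<lambda>z. \<Prod>j<n. f (z * p ^ j)) holomorphic_on UNIV"
    by (intro holomorphic_intros)
next
  fix x :: complex
  define R where "R = norm x + 1"
  obtain C where C: "C \<ge> 0" "\<And>w. norm w \<le> R \<Longrightarrow> norm (f w - 1) \<le> C * norm w"
    using holomorphic_minus_one_bound[OF f] by blast
  have "uniformly_convergent_on (cball x 1) (\<lambda>N z. \<Prod>n<N. f (z * p ^ n))"
  proof (rule uniformly_convergent_on_prod')
    fix n
    show "continuous_on (cball x 1) (\<lambda>z. f (z * p ^ n))"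
      by (intro holomorphic_on_imp_continuous_on holomorphic_on_compose_UNIV[OF f(1)] holomorphic_intros)
  next
    show "uniformly_convergent_on (cball x 1) (\<lambda>N z. \<Sum>n<N. norm (f (z * p ^ n) - 1))"
    proof (rule Weierstrass_m_test')
      show "summable (\<lambda>j. C * R * norm p ^ j)"
        using p by (intro summable_mult summable_geometric) auto
      fix n z assume "z \<in> cball x 1"
      hence z: "norm z \<le> R"
        unfolding R_def using norm_triangle_ineq4[of x "x - z"] by (auto simp: dist_norm)
      have "norm (z * p ^ n) \<le> norm z"
        using p by (simp add: norm_mult norm_power mult_left_le power_le_one)
      hence "norm (f (z * p ^ n) - 1) \<le> C * norm (z * p ^ n)" using z by (intro C) auto
      also have "\<dots> \<le> C * R * norm p ^ n"
        using z C by (auto simp: norm_mult norm_power mult.assoc intro!: mult_left_mono mult_right_mono)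
      finally show "norm (norm (f (z * p ^ n) - 1)) \<le> C * R * norm p ^ n" by simp
    qed
  qed auto
  then obtain g where g: "uniform_limit (cball x 1) (\<lambda>N z. \<Prod>n<N. f (z * p ^ n)) g sequentially"
    by (auto simp: uniformly_convergent_on_def)
  also have "?this \<longleftrightarrow> uniform_limit (cball x 1) (\<lambda>N z. \<Prod>n<N. f (z * p ^ n)) (qprod f p) sequentially"
  proof (intro uniform_limit_cong)
    fix z :: complex assume "z \<in> cball x 1"
    from tendsto_uniform_limitI[OF g this]
    have "(\<lambda>N. \<Prod>n<Suc N. f (z * p ^ n)) \<longlonglongrightarrow> g z"
      by (rule LIMSEQ_Suc)
    moreover have "(\<lambda>N. \<Prod>n<Suc N. f (z * p ^ n)) \<longlonglongrightarrow> qprod f p z"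
      using convergent_prod_LIMSEQ[OF convergent_qprod[of z]]
      by (simp only: lessThan_Suc_atMost qprod_def)
    ultimately show "g z = qprod f p z"
      using LIMSEQ_unique by blast
  qed auto
  finally show "\<exists>d>0. cball x d \<subseteq> UNIV \<and> uniform_limit (cball x d) (\<lambda>N z. \<Prod>n<N. f (z * p ^ n)) (qprod f p) sequentially"
    by (intro exI[of _ 1]) auto
qed auto

end

lemma qpoch_inf_altdef: "qpoch_inf z q = qprod (\<lambda>w. 1 - w) q z"
  by (simp add: qpoch_inf_def qprod_def)

context
  fixes q :: complex
  assumes q: "norm q < 1"
begin

lemma has_prod_qpoch_inf: "(\<lambda>k. 1 - z * q ^ k) has_prod qpoch_inf z q"
  unfolding qpoch_inf_altdef
  by (rule has_prod_qprod[where f = "\<lambda>w. 1 - w"]) (use q in \<open>auto intro!: holomorphic_intros\<close>)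

lemma qpoch_inf_rec: "qpoch_inf z q = (1 - z) * qpoch_inf (q * z) q"
  unfolding qpoch_inf_altdef by (rule qprod_rec) (use q in \<open>auto intro!: holomorphic_intros\<close>)

lemma qpoch_inf_eq_0_iff: "qpoch_inf z q = 0 \<longleftrightarrow> (\<exists>k. z * q ^ k = 1)"
proof -
  have "qpoch_inf z q = 0 \<longleftrightarrow> (\<exists>k. 1 - z * q ^ k = 0)"
    unfolding qpoch_inf_altdef by (rule qprod_eq_0_iff) (use q in \<open>auto intro!: holomorphic_intros\<close>)
  thus ?thesis by auto
qed

lemma qpoch_inf_0: "qpoch_inf 0 q = 1"
  by (simp add: qpoch_inf_def)

lemma holomorphic_qpoch_inf: "(\<lambda>z. qpoch_inf z q) holomorphic_on UNIV"
  unfolding qpoch_inf_altdef by (rule holomorphic_qprod) (use q in \<open>auto intro!: holomorphic_intros\<close>)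

end

text \<open>Iterating \<open>qprod\<close> yields the double product of 1 - z p^j q^k: the inner
  Pochhammer symbol is entire with value 1 at 0, so the results on \<open>qprod\<close> apply to it
  as well.\<close>

definition qpoch2 :: "complex \<Rightarrow> complex \<Rightarrow> complex \<Rightarrow> complex" where
  "qpoch2 z p q = qprod (\<lambda>w. qpoch_inf w q) p z"

definition qtheta :: "complex \<Rightarrow> complex \<Rightarrow> complex" where
  "qtheta z p = qpoch_inf z p * qpoch_inf (p / z) p"

context
  fixes p q :: complex
  assumes p: "norm p < 1" and q: "norm q < 1"
begin

lemmas qpoch2_aux = holomorphic_qpoch_inf[OF q] qpoch_inf_0[OF q] p

lemma qpoch2_rec1: "qpoch2 z p q = qpoch_inf z q * qpoch2 (p * z) p q"
  unfolding qpoch2_def by (rule qprod_rec[OF qpoch2_aux])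

text \<open>The iterated definition treats p and q differently. Splitting off the factor k = 0 from
  every inner product gives the recursion in q without interchanging the two products.\<close>

lemma qpoch2_rec2: "qpoch2 z p q = qpoch_inf z p * qpoch2 (q * z) p q"
proof -
  note has_prod_qpoch_inf[OF p, of z]
  moreover have "(\<lambda>j. qpoch_inf (q * z * p ^ j) q) has_prod qpoch2 (q * z) p q"
    using has_prod_qprod[OF qpoch2_aux] by (simp add: qpoch2_def)
  ultimately have *: "(\<lambda>j. (1 - z * p ^ j) * qpoch_inf (q * z * p ^ j) q) has_prod
      (qpoch_inf z p * qpoch2 (q * z) p q)"
    by (rule has_prod_mult)
  have eq: "(\<lambda>j. (1 - z * p ^ j) * qpoch_inf (q * z * p ^ j) q) = (\<lambda>j. qpoch_inf (z * p ^ j) q)"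
  proof
    fix j
    show "(1 - z * p ^ j) * qpoch_inf (q * z * p ^ j) q = qpoch_inf (z * p ^ j) q"
      using qpoch_inf_rec[OF q, of "z * p ^ j"] by (simp only: mult.assoc)
  qed
  from *[unfolded eq] show ?thesis
    using has_prod_qprod[OF qpoch2_aux, of z] unfolding qpoch2_def by (rule has_prod_unique2[rotated])
qed

lemma qpoch2_eq_0_iff: "qpoch2 z p q = 0 \<longleftrightarrow> (\<exists>j k. z * p ^ j * q ^ k = 1)"
  unfolding qpoch2_def by (subst qprod_eq_0_iff[OF qpoch2_aux]) (simp add: qpoch_inf_eq_0_iff[OF q])

lemma holomorphic_qpoch2: "(\<lambda>z. qpoch2 z p q) holomorphic_on UNIV"
  using holomorphic_qprod[OF qpoch2_aux] by (simp add: qpoch2_def[abs_def])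

text \<open>True for every z: in both expressions the inverse of 0 is 0 at z = 0, and a vanishing
  denominator makes the value 0.\<close>

lemma elliptic_gamma_altdef: "elliptic_gamma z p q = qpoch2 (p * q / z) p q / qpoch2 z p q"
proof -
  note hp = has_prod_qpoch_inf[OF q]
  have inner: "(\<lambda>k. (1 - inverse z * p ^ (j + 1) * q ^ (k + 1)) / (1 - z * p ^ j * q ^ k)) has_prod
      (qpoch_inf (p * q / z * p ^ j) q / qpoch_inf (z * p ^ j) q)" for j
    using has_prod_divide[OF hp[of "p * q / z * p ^ j"] hp[of "z * p ^ j"]]
    by (simp add: field_simps)
  have "(\<lambda>j. qpoch_inf (p * q / z * p ^ j) q / qpoch_inf (z * p ^ j) q) has_prod
      (qpoch2 (p * q / z) p q / qpoch2 z p q)"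
    unfolding qpoch2_def by (intro has_prod_divide has_prod_qprod[OF qpoch2_aux])
  hence "(\<Prod>j. qpoch_inf (p * q / z * p ^ j) q / qpoch_inf (z * p ^ j) q) =
      qpoch2 (p * q / z) p q / qpoch2 z p q"
    by (rule has_prod_unique[symmetric])
  moreover have "(\<Prod>k. (1 - inverse z * p ^ (j + 1) * q ^ (k + 1)) / (1 - z * p ^ j * q ^ k)) =
      qpoch_inf (p * q / z * p ^ j) q / qpoch_inf (z * p ^ j) q" for j
    using inner[of j] by (rule has_prod_unique[symmetric])
  ultimately show ?thesis
    by (simp add: elliptic_gamma_def)
qed

end

context
  fixes p :: complex
  assumes p: "norm p < 1" "p \<noteq> 0"
begin

lemma qtheta_eq_0_iff:
  assumes "z \<noteq> 0"
  shows "qtheta z p = 0 \<longleftrightarrow> (\<exists>k::int. z = p powi k)"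
proof
  assume "qtheta z p = 0"
  then obtain k where "z * p ^ k = 1 \<or> p / z * p ^ k = 1"
    unfolding qtheta_def using qpoch_inf_eq_0_iff[OF p(1)] by auto
  thus "\<exists>k::int. z = p powi k"
  proof
    assume "z * p ^ k = 1"
    hence "z = p powi (- int k)" using p by (simp add: power_int_minus field_simps)
    thus ?thesis ..
  next
    assume "p / z * p ^ k = 1"
    hence "z = p powi (int (Suc k))" using assms unfolding power_int_of_nat by (simp add: field_simps)
    thus ?thesis ..
  qed
next
  assume "\<exists>k::int. z = p powi k"
  then obtain k :: int where k: "z = p powi k" by blast
  show "qtheta z p = 0"
  proof (cases "k \<le> 0")
    case True
    then obtain n where "k = - int n" by (metis nonpos_int_cases)
    hence "z * p ^ n = 1" using k p by (simp add: power_int_minus)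
    thus ?thesis unfolding qtheta_def using qpoch_inf_eq_0_iff[OF p(1)] by auto
  next
    case False
    then obtain n where "k = int (Suc n)" by (metis not_le zero_less_imp_eq_int Suc_pred' of_nat_0_less_iff)
    hence "z = p ^ Suc n" using k by (simp only: power_int_of_nat)
    hence "p / z * p ^ n = 1" using p by simp
    thus ?thesis unfolding qtheta_def using qpoch_inf_eq_0_iff[OF p(1)] by auto
  qed
qed

lemma qtheta_mult_p:
  assumes "z \<noteq> 0"
  shows "qtheta (p * z) p = - qtheta z p / z"
proof -
  have "qtheta (p * z) p * z = qpoch_inf (p * z) p * (z * qpoch_inf (1 / z) p)"
    using p by (simp add: qtheta_def)
  also have "z * qpoch_inf (1 / z) p = (z - 1) * qpoch_inf (p / z) p"
    using assms by (subst qpoch_inf_rec[OF p(1)]) (simp add: field_simps)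
  also have "qpoch_inf (p * z) p * \<dots> = - (qtheta z p)"
    unfolding qtheta_def by (subst (3) qpoch_inf_rec[OF p(1)]) (simp add: algebra_simps)
  finally show ?thesis using assms by (simp add: field_simps)
qed

lemma qtheta_inverse:
  assumes "z \<noteq> 0"
  shows "qtheta (inverse z) p = - qtheta z p / z"
proof -
  have "qtheta (inverse z) p = qtheta (p * z) p"
    using p assms by (simp add: qtheta_def field_simps)
  thus ?thesis using qtheta_mult_p[OF assms] by simp
qed

lemma holomorphic_qtheta: "(\<lambda>z. qtheta z p) holomorphic_on - {0}"
proof -
  have "(\<lambda>z. qpoch_inf (p / z) p) holomorphic_on - {0}"
    by (intro holomorphic_on_compose_UNIV[OF holomorphic_qpoch_inf[OF p(1)]] holomorphic_intros) auto
  moreover have "(\<lambda>z. qpoch_inf z p) holomorphic_on - {0}"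
    using holomorphic_qpoch_inf[OF p(1)] by (rule holomorphic_on_subset) auto
  ultimately show ?thesis unfolding qtheta_def by (intro holomorphic_intros)
qed

text \<open>At 1 the factor 1 - z splits off, leaving the derivative -(p;p)^2; the functional
  equation under z -> p z carries this to every zero p^k. Simple zeros allow division by products of
  theta functions.\<close>

lemma deriv_qtheta_nonzero:
  assumes "z \<noteq> 0" "qtheta z p = 0"
  shows "deriv (\<lambda>z. qtheta z p) z \<noteq> 0"
proof -
  let ?D = "deriv (\<lambda>z. qtheta z p)"
  have der: "((\<lambda>z. qtheta z p) has_field_derivative ?D z) (at z)" if "z \<noteq> 0" for z
    using holomorphic_derivI[OF holomorphic_qtheta, of z] that by auto
  have step: "?D (p * z) = 0 \<longleftrightarrow> ?D z = 0" if "z \<noteq> 0" "qtheta z p = 0" for z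
  proof -
    have "((\<lambda>z. p * z) has_field_derivative p) (at z)"
      by (auto intro!: derivative_eq_intros)
    hence "((\<lambda>z. qtheta (p * z) p) has_field_derivative ?D (p * z) * p) (at z)"
      using that p by (intro DERIV_chain2[where f = "\<lambda>z. qtheta z p" and g = "\<lambda>z. p * z", OF der]) simp_all
    moreover have ev: "\<forall>\<^sub>F w in nhds z. qtheta (p * w) p = - qtheta w p / w"
      using qtheta_mult_p by (intro eventually_mono[OF t1_space_nhds[OF that(1)]]) auto
    have d2: "((\<lambda>z. - qtheta z p / z) has_field_derivative
        ((- ?D z) * z - (- qtheta z p) * 1) / (z * z)) (at z)"
      using that by (intro DERIV_divide der DERIV_minus DERIV_ident) auto
    ultimately have "?D (p * z) * p = ((- ?D z) * z - (- qtheta z p) * 1) / (z * z)"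
      using DERIV_unique iffD2[OF DERIV_cong_ev[OF refl ev refl] d2] by metis
    thus ?thesis using that p by auto
  qed
  have one: "?D 1 \<noteq> 0"
  proof -
    have "(\<lambda>z. qpoch_inf (p * z) p * qpoch_inf (p / z) p) holomorphic_on -{0}"
      by (intro holomorphic_intros holomorphic_on_compose_UNIV[OF holomorphic_qpoch_inf[OF p(1)]]) auto
    then obtain d where d: "((\<lambda>z. qpoch_inf (p * z) p * qpoch_inf (p / z) p) has_field_derivative d) (at 1)"
      using holomorphic_derivI[of _ "-{0}" 1] by fastforce
    have "((\<lambda>z. (1 - z) * (qpoch_inf (p * z) p * qpoch_inf (p / z) p)) has_field_derivative
        (0 - 1) * (qpoch_inf (p * 1) p * qpoch_inf (p / 1) p) + d * (1 - 1)) (at 1)"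
      by (intro DERIV_mult DERIV_diff DERIV_const DERIV_ident d)
    also have "(\<lambda>z. (1 - z) * (qpoch_inf (p * z) p * qpoch_inf (p / z) p)) = (\<lambda>z. qtheta z p)"
      unfolding qtheta_def by (subst (3) qpoch_inf_rec[OF p(1)]) (simp add: algebra_simps)
    finally have "?D 1 = - (qpoch_inf p p * qpoch_inf p p)"
      using DERIV_imp_deriv by fastforce
    moreover have "qpoch_inf p p \<noteq> 0"
    proof
      assume "qpoch_inf p p = 0"
      then obtain k where "p ^ Suc k = 1" using qpoch_inf_eq_0_iff[OF p(1)] by auto
      hence "norm p ^ Suc k = 1" by (metis norm_one norm_power)
      moreover have "norm p ^ Suc k < 1" using p by (intro power_Suc_less_one) auto
      ultimately show False by simp
    qed
    ultimately show ?thesis by simp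
  qed
  have z0: "qtheta (p powi k) p = 0" for k :: int
    using qtheta_eq_0_iff[of "p powi k"] p by auto
  have "?D (p powi k) \<noteq> 0" for k :: int
  proof (induction k rule: int_induct[of _ 0])
    case (step1 i)
    thus ?case using step[of "p powi i"] p z0 by (auto simp: power_int_add mult_ac)
  next
    case (step2 i)
    moreover have "p * p powi (i - 1) = p powi i" using p by (simp add: power_int_diff)
    ultimately show ?case using step[of "p powi (i - 1)"] p z0 by auto
  qed (use one in auto)
  thus ?thesis using assms qtheta_eq_0_iff by blast
qed

end

section \<open>Elliptic functions and quotients with removable singularities\<close>

lemma elliptic_constant:
  assumes hol: "Q holomorphic_on - {0}" and p: "norm p < 1" "p \<noteq> 0"
    and per: "\<And>z. z \<noteq> 0 \<Longrightarrow> Q (p * z) = Q z"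
    and "x \<noteq> 0" "y \<noteq> 0"
  shows "Q x = (Q y :: complex)"
proof -
  define A where "A = cball 0 1 - ball (0::complex) (norm p)"
  have A: "compact A" "A \<subseteq> - {0}" unfolding A_def using p by (auto intro: compact_diff)
  have "bounded (Q ` A)"
    using A hol by (intro compact_imp_bounded compact_continuous_image)
      (auto intro: holomorphic_on_imp_continuous_on holomorphic_on_subset)
  then obtain B where "\<forall>x\<in>Q ` A. norm x \<le> B"
    unfolding bounded_iff by blast
  hence B: "\<And>z. z \<in> A \<Longrightarrow> norm (Q z) \<le> B" by blast
  have per': "Q (p powi k * z) = Q z" if "z \<noteq> 0" for k :: int and z
  proof (induction k rule: int_induct[of _ 0])
    case (step1 i)
    thus ?case using per[of "p powi i * z"] that p by (simp add: power_int_add mult_ac)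
  next
    case (step2 i)
    have eq: "p * (p powi (i - 1) * z) = p powi i * z" using p by (simp add: power_int_diff)
    have "Q (p * (p powi (i - 1) * z)) = Q (p powi (i - 1) * z)" using that p by (intro per) auto
    thus ?case unfolding eq using step2 by simp
  qed auto
  have bd: "norm (Q z) \<le> B" if z: "z \<noteq> 0" for z
  proof -
    \<comment> \<open>The power of p that moves z into the annulus \<open>A\<close>: log |p^k z| is
      the fractional part of ln |z| / ln |p|, times ln |p|.\<close>
    define k where "k = - \<lfloor>ln (norm z) / ln (norm p)\<rfloor>"
    have lp: "ln (norm p) < 0" using p by simp
    have n: "norm (p powi k * z) = exp (of_int k * ln (norm p) + ln (norm z))"
      using z p by (simp add: norm_mult norm_power_int exp_add flip: powr_real_of_int') (simp add: powr_def)
    define X where "X = ln (norm z) / ln (norm p)"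
    have X: "ln (norm z) = X * ln (norm p)" using lp by (simp add: X_def)
    have "of_int \<lfloor>X\<rfloor> \<le> X" "X \<le> of_int \<lfloor>X\<rfloor> + 1" by linarith+
    hence "of_int \<lfloor>X\<rfloor> * ln (norm p) \<ge> X * ln (norm p)"
          "X * ln (norm p) \<ge> (of_int \<lfloor>X\<rfloor> + 1) * ln (norm p)"
      using lp by (auto intro!: mult_right_mono_neg)
    hence "of_int k * ln (norm p) + ln (norm z) \<le> 0" "of_int k * ln (norm p) + ln (norm z) \<ge> ln (norm p)"
      unfolding X by (auto simp: k_def X_def[symmetric] algebra_simps)
    moreover have "norm p = exp (ln (norm p))" using p by simp
    ultimately have "norm (p powi k * z) \<le> 1" "norm (p powi k * z) \<ge> norm p"
      unfolding n by (simp, metis exp_le_cancel_iff)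
    hence "p powi k * z \<in> A" by (auto simp: A_def)
    thus ?thesis using B per'[OF z, of k] by metis
  qed
  \<comment> \<open>Composition with exp gives a bounded entire function, to which Liouville's
    theorem applies.\<close>
  have "(\<lambda>s. Q (exp s)) holomorphic_on UNIV"
  proof -
    have "exp ` UNIV \<subseteq> - {0::complex}" by auto
    from holomorphic_on_compose_gen[OF holomorphic_on_exp hol this] show ?thesis by (simp add: o_def)
  qed
  moreover have "bounded (range (\<lambda>s. Q (exp s)))" by (auto simp: bounded_iff intro!: exI[of _ B] bd)
  ultimately have "(\<lambda>s. Q (exp s)) constant_on UNIV" by (rule Liouville_theorem)
  then obtain c where c: "\<And>s. Q (exp s) = c" by (auto simp: constant_on_def)
  show ?thesis using c[of "Ln x"] c[of "Ln y"] assms by simp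
qed

text \<open>At a zero of D the value of the quotient is given by l'Hopital's rule. Near such a zero
  it is the quotient of the difference quotients of F and D, and the latter is nonzero there because
  the zero is simple.\<close>

lemma holomorphic_divide_simple_zeros:
  assumes S: "open S" and F: "F holomorphic_on S" and D: "D holomorphic_on S"
    and simple: "\<And>z. z \<in> S \<Longrightarrow> D z = 0 \<Longrightarrow> deriv D z \<noteq> 0"
    and zero: "\<And>z. z \<in> S \<Longrightarrow> D z = 0 \<Longrightarrow> F z = 0"
  obtains Q :: "complex \<Rightarrow> complex" where "Q holomorphic_on S" "\<And>z. z \<in> S \<Longrightarrow> F z = D z * Q z"
proof
  define Q where "Q = (\<lambda>z. if D z = 0 then deriv F z / deriv D z else F z / D z)"
  show "F z = D z * Q z" if "z \<in> S" for z
    using zero that by (auto simp: Q_def)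
  show "Q holomorphic_on S"
    unfolding holomorphic_on_open[OF S]
  proof
    fix x assume x: "x \<in> S"
    show "\<exists>f'. (Q has_field_derivative f') (at x)"
    proof (cases "D x = 0")
      case False
      have "\<forall>\<^sub>F z in nhds x. D z \<noteq> 0"
        using False holomorphic_on_imp_continuous_on[OF D] x S
        by (metis continuous_on_eq_continuous_at isCont_def tendsto_at_iff_tendsto_nhds tendsto_imp_eventually_ne)
      hence ev: "\<forall>\<^sub>F z in nhds x. F z / D z = Q z"
        by eventually_elim (auto simp: Q_def)
      have d: "((\<lambda>z. F z / D z) has_field_derivative (deriv F x * D x - F x * deriv D x) / (D x * D x)) (at x)"
        using False by (intro DERIV_divide holomorphic_derivI[OF F S x] holomorphic_derivI[OF D S x]) auto
      from iffD1[OF DERIV_cong_ev[OF refl ev refl] d] show ?thesis ..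
    next
      case True
      define F1 where "F1 = (\<lambda>z. if z = x then deriv F x else (F z - F x) / (z - x))"
      define D1 where "D1 = (\<lambda>z. if z = x then deriv D x else (D z - D x) / (z - x))"
      have F1: "F1 holomorphic_on S" and D1: "D1 holomorphic_on S"
        unfolding F1_def D1_def by (rule pole_lemma_open[OF F S] pole_lemma_open[OF D S])+
      have nz: "D1 x \<noteq> 0" using simple[OF x True] by (simp add: D1_def)
      have "\<forall>\<^sub>F z in nhds x. D1 z \<noteq> 0"
        using nz holomorphic_on_imp_continuous_on[OF D1] x S
        by (metis continuous_on_eq_continuous_at isCont_def tendsto_at_iff_tendsto_nhds tendsto_imp_eventually_ne)
      hence ev: "\<forall>\<^sub>F z in nhds x. F1 z / D1 z = Q z"
        by eventually_elim (use zero[OF x True] True in \<open>auto simp: Q_def F1_def D1_def\<close>)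
      have d: "((\<lambda>z. F1 z / D1 z) has_field_derivative (deriv F1 x * D1 x - F1 x * deriv D1 x) / (D1 x * D1 x)) (at x)"
        using nz by (intro DERIV_divide holomorphic_derivI[OF F1 S x] holomorphic_derivI[OF D1 S x]) auto
      from iffD1[OF DERIV_cong_ev[OF refl ev refl] d] show ?thesis ..
    qed
  qed
qed

section \<open>Exponential form of monomial prefactors\<close>

lemma minus_exp_conv: "- exp x = exp (x + \<i> * of_real pi)"
  by (simp add: exp_add exp_pi_i')

lemma of_int_half: "of_int (m * (m - 1) div 2) = (of_int m * (of_int m - 1) / 2 :: complex)"
  by (subst of_int_div) simp_all

lemma six_dvd: "6 dvd m * (m - 1) * (m - 2 :: int)"
proof -
  have "3 dvd m \<or> 3 dvd m - 1 \<or> 3 dvd m - 2" by presburger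
  hence "3 dvd m * (m - 1) * (m - 2)" by (auto intro: dvd_mult dvd_mult2)
  moreover have "2 dvd m * (m - 1) * (m - 2)" by simp
  ultimately have "2 * 3 dvd m * (m - 1) * (m - 2)" by (intro divides_mult) auto
  thus ?thesis by simp
qed

lemma of_int_sixth: "of_int (m * (m - 1) * (m - 2) div 6) = (of_int m * (of_int m - 1) * (of_int m - 2) / 6 :: complex)"
  using six_dvd by (subst of_int_div) simp_all

lemma of_int_sixth': "of_int (m * (m ^ 2 - 1) div 6) = ((of_int m + 1) * of_int m * (of_int m - 1) / 6 :: complex)"
proof -
  have eq: "m * (m ^ 2 - 1) = (m + 1) * (m + 1 - 1) * (m + 1 - 2)"
    by (simp add: power2_eq_square algebra_simps)
  show ?thesis by (subst eq, subst of_int_sixth) (simp add: algebra_simps)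
qed

text \<open>Prefactors are compared through their exponents, which often agree only modulo 2 pi i; k
  counts the multiple, in which all signs are collected.\<close>

lemma exp_eqI_int:
  assumes "x = y + 2 * of_int k * (\<i> * of_real pi)"
  shows "exp x = exp (y :: complex)"
proof -
  have "exp (2 * of_int k * (\<i> * of_real pi)) = (1 :: complex)"
    using exp_power_int[of "2 * complex_of_real pi * \<i>" k] by (simp add: mult_ac exp_two_pi_i')
  thus ?thesis by (simp add: assms exp_add)
qed

text \<open>Induction on \<open>qtheta_mult_p\<close> in both directions. In multiplicative notation
  the factor is (-z)^(-k) p^(-k(k-1)/2); i pi serves as the logarithm of -1.\<close>

lemma qtheta_exp_shift:
  assumes "norm (exp l) < 1"
  shows "qtheta (exp (y + of_int k * l)) (exp l) =
           exp (- of_int k * (y + \<i> * of_real pi) - of_int k * (of_int k - 1) / 2 * l) * qtheta (exp y) (exp l)"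
proof (induction k rule: int_induct[of _ 0])
  case (step1 i)
  let ?w = "exp (y + of_int i * l)"
  have "exp (y + of_int (i + 1) * l) = exp l * ?w" by (simp add: exp_add algebra_simps)
  hence "qtheta (exp (y + of_int (i + 1) * l)) (exp l) = - qtheta ?w (exp l) / ?w"
    using qtheta_mult_p[OF assms, of ?w] by simp
  also have "\<dots> = exp (- (y + of_int i * l + \<i> * of_real pi)) * qtheta ?w (exp l)"
    by (simp only: exp_minus minus_exp_conv[symmetric]) (simp add: field_simps)
  also have "\<dots> = exp (- of_int (i + 1) * (y + \<i> * of_real pi) - of_int (i + 1) * (of_int (i + 1) - 1) / 2 * l) * qtheta (exp y) (exp l)"
    unfolding step1 mult.assoc[symmetric] exp_add[symmetric]
    by (intro arg_cong2[where f = "(*)"] arg_cong[where f = exp] refl) (simp add: field_simps)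
  finally show ?case .
next
  case (step2 i)
  let ?w = "exp (y + of_int (i - 1) * l)"
  have *: "exp (y + of_int i * l) = exp l * ?w" by (simp add: exp_add[symmetric] algebra_simps)
  have "qtheta ?w (exp l) = exp (y + of_int (i - 1) * l + \<i> * of_real pi) * qtheta (exp (y + of_int i * l)) (exp l)"
    unfolding * using qtheta_mult_p[OF assms, of ?w] by (simp add: minus_exp_conv[symmetric])
  also have "\<dots> = exp (- of_int (i - 1) * (y + \<i> * of_real pi) - of_int (i - 1) * (of_int (i - 1) - 1) / 2 * l) * qtheta (exp y) (exp l)"
    unfolding step2 mult.assoc[symmetric] exp_add[symmetric]
    by (intro arg_cong2[where f = "(*)"] arg_cong[where f = exp] refl) (simp add: field_simps)
  finally show ?case .
qed auto

context
  fixes p q :: complex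
  assumes p: "norm p < 1" "p \<noteq> 0" and q: "norm q < 1" "q \<noteq> 0"
begin

text \<open>Poles have to be excluded: where a pole of the gamma function on the right is cancelled
  by a zero of the theta function, the convention x / 0 = 0 would give 0 against a nonzero left-hand
  side.\<close>

lemma elliptic_gamma_mult_p:
  assumes "z \<noteq> 0" "qpoch2 z p q \<noteq> 0"
  shows "elliptic_gamma (p * z) p q = qtheta z q * elliptic_gamma z p q"
proof -
  have 1: "qpoch2 (p * q / (p * z)) p q = qpoch_inf (q / z) q * qpoch2 (p * q / z) p q"
    using qpoch2_rec1[OF p(1) q(1), of "q / z"] p by simp
  have 2: "qpoch2 z p q = qpoch_inf z q * qpoch2 (p * z) p q"
    by (rule qpoch2_rec1[OF p(1) q(1)])
  hence "qpoch_inf z q \<noteq> 0" "qpoch2 (p * z) p q \<noteq> 0" using assms by auto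
  thus ?thesis
    unfolding elliptic_gamma_altdef[OF p(1) q(1)] qtheta_def 1 2 by simp
qed

lemma elliptic_gamma_mult_q:
  assumes "z \<noteq> 0" "qpoch2 z p q \<noteq> 0"
  shows "elliptic_gamma (q * z) p q = qtheta z p * elliptic_gamma z p q"
proof -
  have "p * q / (q * z) = p / z" "q * (p / z) = p * q / z" using q by auto
  hence 1: "qpoch2 (p * q / (q * z)) p q = qpoch_inf (p / z) p * qpoch2 (p * q / z) p q"
    using qpoch2_rec2[OF p(1) q(1), of "p / z"] by (simp only:)
  have 2: "qpoch2 z p q = qpoch_inf z p * qpoch2 (q * z) p q"
    by (rule qpoch2_rec2[OF p(1) q(1)])
  hence "qpoch_inf z p \<noteq> 0" "qpoch2 (q * z) p q \<noteq> 0" using assms by auto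
  thus ?thesis
    unfolding elliptic_gamma_altdef[OF p(1) q(1)] qtheta_def 1 2 by simp
qed

lemma elliptic_gamma_reflect:
  assumes "z \<noteq> 0" "qpoch2 z p q \<noteq> 0" "qpoch2 (p * q / z) p q \<noteq> 0"
  shows "elliptic_gamma z p q * elliptic_gamma (p * q / z) p q = 1"
  using assms p q unfolding elliptic_gamma_altdef[OF p(1) q(1)] by simp

text \<open>Identity theorem: the double product does not vanish at 1/2, a point of the unit disc.
  Hence formulas that hold off its zeros hold in punctured neighbourhoods of every point, which
  suffices for passing to limits.\<close>

lemma eventually_qpoch2_nonzero:
  assumes "z \<noteq> 0" "c \<noteq> 0"
  shows "\<forall>\<^sub>F w in at z. qpoch2 (c * w) p q \<noteq> 0" "\<forall>\<^sub>F w in at z. qpoch2 (c / w) p q \<noteq> 0"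
proof -
  have nz: "qpoch2 (1 / 2) p q \<noteq> 0"
  proof
    assume "qpoch2 (1 / 2) p q = 0"
    then obtain j k where "1 / 2 * p ^ j * q ^ k = 1" using qpoch2_eq_0_iff[OF p(1) q(1)] by blast
    hence "norm (1 / 2 * p ^ j * q ^ k) = 1" by simp
    moreover have "norm (1 / 2 * p ^ j * q ^ k) \<le> 1 / 2 * 1 * 1"
      unfolding norm_mult norm_power using p q by (intro mult_mono power_le_one) auto
    ultimately show False by simp
  qed
  have con: "connected (- {0::complex})"
    using connected_punctured_universe[of "0::complex"] by simp
  have op: "open (- {0::complex})" by auto
  have "(\<lambda>w. qpoch2 (c * w) p q) holomorphic_on -{0}" "(\<lambda>w. qpoch2 (c / w) p q) holomorphic_on -{0}"
    by (auto intro!: holomorphic_on_compose_UNIV[OF holomorphic_qpoch2[OF p(1) q(1)]] holomorphic_intros)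
  thus "\<forall>\<^sub>F w in at z. qpoch2 (c * w) p q \<noteq> 0" "\<forall>\<^sub>F w in at z. qpoch2 (c / w) p q \<noteq> 0"
    using non_zero_neighbour_alt[OF _ op con, of "\<lambda>w. qpoch2 (c * w) p q" z "1 / (2 * c)"]
      non_zero_neighbour_alt[OF _ op con, of "\<lambda>w. qpoch2 (c / w) p q" z "2 * c"] assms nz
    by (simp_all add: eventually_conj_iff)
qed

end

lemma filterlim_mult_at: "c \<noteq> 0 \<Longrightarrow> filterlim (\<lambda>w. c * w) (at (c * z)) (at (z::complex))"
  by (rule filterlim_atI) (auto intro!: tendsto_intros simp: eventually_at_filter)

lemma filterlim_divide_at: "c \<noteq> 0 \<Longrightarrow> z \<noteq> 0 \<Longrightarrow> filterlim (\<lambda>w. c / w) (at (c / z)) (at (z::complex))"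
  by (rule filterlim_atI) (auto intro!: tendsto_intros simp: eventually_at_filter)

section \<open>The rarefied elliptic gamma function\<close>

text \<open>
  Fixing logarithms of $p$ and $q$ turns every monomial prefactor with a quadratic or cubic exponent into
  an exponential of a polynomial, so that functional equations become polynomial identities.
\<close>

locale rarefied =
  fixes r :: nat and p q lp lq :: complex
  assumes r: "r > 0" and p_exp: "p = exp lp" and q_exp: "q = exp lq"
    and np: "norm p < 1" and nq: "norm q < 1"
begin

lemma p0: "p \<noteq> 0" and q0: "q \<noteq> 0"
  by (simp_all add: p_exp q_exp)

lemma pr: "norm (p ^ r) < 1" "p ^ r \<noteq> 0" and qr: "norm (q ^ r) < 1" "q ^ r \<noteq> 0"
  and pq: "norm (p * q) < 1" "p * q \<noteq> 0"
  using np nq r p0 q0 power_Suc_less_one[of "norm p" "r - 1"] power_Suc_less_one[of "norm q" "r - 1"]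
    mult_strict_mono[of "norm p" 1 "norm q" 1]
  by (auto simp: norm_power norm_mult)

text \<open>The explicit formula inside \<open>remove_sings\<close>. Identities are proved for it at
  generic points; \<open>rarefied_gamma\<close> inherits them through limits.\<close>

definition rform :: "int \<Rightarrow> complex \<Rightarrow> complex" where
  "rform m w = (- w) powi (m * (m - 1) div 2)
       * p powi (m * (m - 1) * (m - 2) div 6)
       * q powi (- (m * (m ^ 2 - 1) div 6))
       * elliptic_gamma (w * p powi m) (p ^ r) (p * q)
       * elliptic_gamma (w * q powi (int r - m)) (q ^ r) (p * q)"

lemma rarefied_gamma_altdef: "rarefied_gamma r z m p q = remove_sings (rform m) z"
  by (simp add: rarefied_gamma_def rform_def[abs_def])

lemma rform_exp: "rform m (exp x) =
    exp (of_int m * (of_int m - 1) / 2 * (x + \<i> * of_real pi)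
       + of_int m * (of_int m - 1) * (of_int m - 2) / 6 * lp
       - (of_int m + 1) * of_int m * (of_int m - 1) / 6 * lq)
    * elliptic_gamma (exp (x + of_int m * lp)) (p ^ r) (p * q)
    * elliptic_gamma (exp (x + (of_nat r - of_int m) * lq)) (q ^ r) (p * q)"
proof -
  have 1: "exp x * p powi m = exp (x + of_int m * lp)"
    by (simp add: p_exp exp_power_int exp_add)
  have 2: "exp x * q powi (int r - m) = exp (x + (of_nat r - of_int m) * lq)"
    by (simp add: q_exp exp_power_int exp_add)
  have 3: "(- exp x) powi (m * (m - 1) div 2) * p powi (m * (m - 1) * (m - 2) div 6) * q powi (- (m * (m ^ 2 - 1) div 6)) =
    exp (of_int m * (of_int m - 1) / 2 * (x + \<i> * of_real pi)
       + of_int m * (of_int m - 1) * (of_int m - 2) / 6 * lp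
       - (of_int m + 1) * of_int m * (of_int m - 1) / 6 * lq)"
    unfolding minus_exp_conv p_exp q_exp exp_power_int exp_add[symmetric]
      of_int_minus of_int_half of_int_sixth of_int_sixth' by simp
  show ?thesis unfolding rform_def 1 2 3 ..
qed

text \<open>
  The multiplier in $\Gamma^{(r)}(qz, m+1) = \mathrm{Th}(z,m) \Gamma^{(r)}(z, m)$.
\<close>

definition Th :: "complex \<Rightarrow> int \<Rightarrow> complex" where
  "Th w m = (- w) powi m * p powi (m * (m - 1) div 2) * qtheta (w * p powi m) (p ^ r)"

lemma Th_exp: "Th (exp x) m =
    exp (of_int m * (x + \<i> * of_real pi) + of_int m * (of_int m - 1) / 2 * lp)
    * qtheta (exp (x + of_int m * lp)) (p ^ r)"
proof -
  have 1: "exp x * p powi m = exp (x + of_int m * lp)"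
    by (simp add: p_exp exp_power_int exp_add)
  have 2: "(- exp x) powi m * p powi (m * (m - 1) div 2) = exp (of_int m * (x + \<i> * of_real pi) + of_int m * (of_int m - 1) / 2 * lp)"
    unfolding minus_exp_conv p_exp exp_power_int exp_add[symmetric] of_int_half ..
  show ?thesis unfolding Th_def 1 2 ..
qed

text \<open>
  The multiplier in $\Gamma^{(r)}(z, m+r) = \lambda(z,m) \Gamma^{(r)}(z, m)$.
\<close>

definition lam :: "complex \<Rightarrow> int \<Rightarrow> complex" where
  "lam w m = (- w) powi ((int r - 1) * m + int r * (int r - 1) div 2) *
     exp ((of_nat r - 1) * ((- (lp + lq) / 2) * (of_int m + of_nat r / 2)
        + (lp - lq) / 2 * ((of_int m + of_nat r / 2) ^ 2 + (of_nat r ^ 2 - 2 * of_nat r) / 12)))"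

text \<open>The shift from m to m + r changes cubic exponents by quadratic ones; written around the
  midpoint m + r/2 these become short enough for the sums over six parameters below.\<close>

lemma lam_exp: "lam (exp x) m =
     exp ((of_nat r - 1) * ((x + \<i> * of_real pi - (lp + lq) / 2) * (of_int m + of_nat r / 2)
        + (lp - lq) / 2 * ((of_int m + of_nat r / 2) ^ 2 + (of_nat r ^ 2 - 2 * of_nat r) / 12)))"
proof -
  have "of_int ((int r - 1) * m + int r * (int r - 1) div 2) = ((of_nat r - 1) * (of_int m + of_nat r / 2) :: complex)"
    using of_int_half[of "int r"] by (simp add: field_simps)
  thus ?thesis
    unfolding lam_def minus_exp_conv exp_power_int exp_add[symmetric]
    by (intro arg_cong[where f = exp]) (simp only:, simp add: field_simps power2_eq_square)
qed

lemma lam_nonzero: "w \<noteq> 0 \<Longrightarrow> lam w m \<noteq> 0"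
  by (simp add: lam_def)

lemma lam_analytic: "z \<noteq> 0 \<Longrightarrow> (\<lambda>w. lam w m) analytic_on {z}"
  unfolding lam_def by (intro analytic_intros) auto

lemma eventually_qpoch2_nonzero':
  assumes "z \<noteq> 0" "c \<noteq> 0"
  shows "\<forall>\<^sub>F w in at z. qpoch2 (w * c) (p ^ r) (p * q) \<noteq> 0" "\<forall>\<^sub>F w in at z. qpoch2 (c / w) (p ^ r) (p * q) \<noteq> 0"
    "\<forall>\<^sub>F w in at z. qpoch2 (w * c) (q ^ r) (p * q) \<noteq> 0" "\<forall>\<^sub>F w in at z. qpoch2 (c / w) (q ^ r) (p * q) \<noteq> 0"
  using eventually_qpoch2_nonzero[OF pr pq assms] eventually_qpoch2_nonzero[OF qr pq assms]
  by (simp_all add: mult.commute)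

lemma eventually_nonzero: "\<forall>\<^sub>F w in at z. w \<noteq> (0::complex)"
  by (cases "z = 0") (auto simp: eventually_at_filter intro: eventually_mono[OF t1_space_nhds])

text \<open>The argument w p^m of the first gamma factor is multiplied by its base pq, which
  produces a theta function with base p^r; the argument w q^(r-m) of the second one is unchanged.
  Only monomials then have to be compared.\<close>

lemma rform_shift:
  assumes "w \<noteq> 0" "qpoch2 (w * p powi m) (p ^ r) (p * q) \<noteq> 0"
  shows "rform (m + 1) (q * w) = Th w m * rform m w"
proof -
  obtain x where x: "w = exp x" using assms(1) by (metis exp_Ln)
  have qw: "q * w = exp (lq + x)" by (simp add: x q_exp exp_add)
  have wp: "w * p powi m = exp (x + of_int m * lp)" by (simp add: x p_exp exp_power_int exp_add)
  have 1: "elliptic_gamma (exp (lq + x + of_int (m + 1) * lp)) (p ^ r) (p * q) =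
     qtheta (exp (x + of_int m * lp)) (p ^ r) * elliptic_gamma (exp (x + of_int m * lp)) (p ^ r) (p * q)"
  proof -
    have "exp (lq + x + of_int (m + 1) * lp) = (p * q) * exp (x + of_int m * lp)"
      by (simp add: p_exp q_exp exp_add[symmetric] algebra_simps)
    thus ?thesis using elliptic_gamma_mult_q[OF pr pq, of "exp (x + of_int m * lp)"] assms wp by simp
  qed
  have 2: "lq + x + (of_nat r - of_int (m + 1)) * lq = x + (of_nat r - of_int m) * lq"
    by (simp add: algebra_simps)
  have 3: "of_int (m + 1) * (of_int (m + 1) - 1) / 2 * (lq + x + \<i> * of_real pi)
       + of_int (m + 1) * (of_int (m + 1) - 1) * (of_int (m + 1) - 2) / 6 * lp
       - (of_int (m + 1) + 1) * of_int (m + 1) * (of_int (m + 1) - 1) / 6 * lq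
     = (of_int m * (x + \<i> * of_real pi) + of_int m * (of_int m - 1) / 2 * lp) +
      (of_int m * (of_int m - 1) / 2 * (x + \<i> * of_real pi)
       + of_int m * (of_int m - 1) * (of_int m - 2) / 6 * lp
       - (of_int m + 1) * of_int m * (of_int m - 1) / 6 * lq)"
    by (simp add: field_simps)
  show ?thesis
    unfolding qw rform_exp 1 2 3 unfolding x rform_exp Th_exp exp_add[of "of_int m * (x + \<i> * of_real pi) + of_int m * (of_int m - 1) / 2 * lp"]
    by (simp only: mult_ac)
qed

lemma eventually_rform_shift: "z \<noteq> 0 \<Longrightarrow> \<forall>\<^sub>F w in at z. rform (m + 1) (q * w) = Th w m * rform m w"
  using eventually_elim2[OF eventually_nonzero eventually_qpoch2_nonzero'(1)[of z "p powi m"]] p0 rform_shift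
  by simp

text \<open>The first gamma factor moves by p^r and the second one by q^(-r), so theta functions
  with base pq at w p^m and w q^(-m) appear in a quotient. Their arguments differ by (pq)^m, and
  quasi-periodicity reduces the quotient to a monomial.\<close>

lemma rform_quasi:
  assumes "w \<noteq> 0" "qpoch2 (w * p powi m) (p ^ r) (p * q) \<noteq> 0"
    "qpoch2 (w * q powi (- m)) (q ^ r) (p * q) \<noteq> 0"
    "qpoch2 (w * q powi (int r - m)) (q ^ r) (p * q) \<noteq> 0"
  shows "rform (m + int r) w = lam w m * rform m w"
proof -
  obtain x where x: "w = exp x" using assms(1) by (metis exp_Ln)
  define u where "u = exp (x + of_int m * lp)"
  define v where "v = exp (x - of_int m * lq)"
  have wp: "w * p powi m = u" by (simp add: x u_def p_exp exp_power_int exp_add)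
  have wq: "w * q powi (- m) = v" by (simp add: x v_def q_exp exp_power_int exp_add exp_diff exp_minus field_simps)
  have wq': "w * q powi (int r - m) = q ^ r * v"
    using q0 by (simp add: wq[symmetric] power_int_diff power_int_minus field_simps)
  have wq'': "exp (x + (of_nat r - of_int m) * lq) = q ^ r * v"
    by (simp add: v_def q_exp exp_of_nat_mult[symmetric] exp_add[symmetric] algebra_simps)
  have up: "exp (x + of_int (m + int r) * lp) = p ^ r * u"
    by (simp add: u_def p_exp exp_of_nat_mult[symmetric] exp_add[symmetric] algebra_simps)
  have vq: "exp (x + (of_nat r - of_int (m + int r)) * lq) = v"
    by (simp add: v_def)
  have u0: "u \<noteq> 0" "v \<noteq> 0" by (auto simp: u_def v_def)
  have g1: "elliptic_gamma (p ^ r * u) (p ^ r) (p * q) = qtheta u (p * q) * elliptic_gamma u (p ^ r) (p * q)"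
    using assms(2) unfolding wp by (intro elliptic_gamma_mult_p[OF pr pq] u0)
  have g2: "elliptic_gamma (q ^ r * v) (q ^ r) (p * q) = qtheta v (p * q) * elliptic_gamma v (q ^ r) (p * q)"
    using assms(3) unfolding wq by (intro elliptic_gamma_mult_p[OF qr pq] u0)
  have "exp (lp + lq) = p * q" by (simp add: p_exp q_exp exp_add)
  hence "qtheta (exp ((x - of_int m * lq) + of_int m * (lp + lq))) (p * q) =
      exp (- of_int m * (x - of_int m * lq + \<i> * of_real pi) - of_int m * (of_int m - 1) / 2 * (lp + lq)) * qtheta v (p * q)"
    unfolding v_def using qtheta_exp_shift[of "lp + lq" "x - of_int m * lq" m] pq by simp
  also have "(x - of_int m * lq) + of_int m * (lp + lq) = x + of_int m * lp"
    by (simp add: algebra_simps)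
  finally have th: "qtheta u (p * q) = exp (- of_int m * (x - of_int m * lq + \<i> * of_real pi) - of_int m * (of_int m - 1) / 2 * (lp + lq)) * qtheta v (p * q)"
    by (simp add: u_def)
  define M :: complex where "M = of_int m"
  define R :: complex where "R = of_nat r"
  have M: "of_int (m + int r) = M + R" "of_int m = M" "of_nat r = R" by (simp_all add: M_def R_def)
  have e: "exp ((M + R) * ((M + R) - 1) / 2 * (x + \<i> * of_real pi)
       + (M + R) * ((M + R) - 1) * ((M + R) - 2) / 6 * lp
       - ((M + R) + 1) * (M + R) * ((M + R) - 1) / 6 * lq) *
      exp (- M * (x - M * lq + \<i> * of_real pi) - M * (M - 1) / 2 * (lp + lq)) =
      exp ((R - 1) * ((x + \<i> * of_real pi - (lp + lq) / 2) * (M + R / 2)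
        + (lp - lq) / 2 * ((M + R / 2) ^ 2 + (R ^ 2 - 2 * R) / 12))) *
      exp (M * (M - 1) / 2 * (x + \<i> * of_real pi)
       + M * (M - 1) * (M - 2) / 6 * lp
       - (M + 1) * M * (M - 1) / 6 * lq)"
    unfolding exp_add[symmetric]
    by (intro arg_cong[where f = exp]) (simp add: field_simps power2_eq_square)
  have "rform (m + int r) w = exp ((M + R) * ((M + R) - 1) / 2 * (x + \<i> * of_real pi)
       + (M + R) * ((M + R) - 1) * ((M + R) - 2) / 6 * lp
       - ((M + R) + 1) * (M + R) * ((M + R) - 1) / 6 * lq) *
      exp (- M * (x - M * lq + \<i> * of_real pi) - M * (M - 1) / 2 * (lp + lq)) *
      (qtheta v (p * q) * elliptic_gamma u (p ^ r) (p * q) * elliptic_gamma v (q ^ r) (p * q))"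
    unfolding x rform_exp M up[unfolded M] vq[unfolded M] g1 th by (simp only: mult_ac)
  also have "\<dots> = lam w m * rform m w"
    unfolding e unfolding x rform_exp lam_exp M wq''[unfolded M] g2 u_def[unfolded M, symmetric] by (simp only: mult_ac)
  finally show ?thesis .
qed

lemma eventually_rform_quasi:
  assumes "z \<noteq> 0"
  shows "\<forall>\<^sub>F w in at z. rform (m + int r) w = lam w m * rform m w"
proof -
  have "\<forall>\<^sub>F w in at z. w \<noteq> 0 \<and> qpoch2 (w * p powi m) (p ^ r) (p * q) \<noteq> 0 \<and>
    qpoch2 (w * q powi (- m)) (q ^ r) (p * q) \<noteq> 0 \<and> qpoch2 (w * q powi (int r - m)) (q ^ r) (p * q) \<noteq> 0"
    using assms p0 q0 by (intro eventually_conj eventually_nonzero eventually_qpoch2_nonzero') auto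
  thus ?thesis by eventually_elim (auto intro: rform_quasi)
qed

text \<open>Reflection of each elliptic gamma factor misses the required argument by one period, p^r
  or q^r. The two corrections are theta functions with base pq at w p^m and w q^(-m), which are
  proportional as in \<open>rform_quasi\<close> and cancel.\<close>

lemma rform_reflect:
  assumes "w \<noteq> 0" and "qpoch2 (w * p powi m) (p ^ r) (p * q) \<noteq> 0"
    "qpoch2 (p * q * p powi (- m) / w) (p ^ r) (p * q) \<noteq> 0"
    "qpoch2 (p ^ r * p * q * p powi (- m) / w) (p ^ r) (p * q) \<noteq> 0"
    "qpoch2 (w * q powi (- m)) (q ^ r) (p * q) \<noteq> 0"
    "qpoch2 (w * q powi (int r - m)) (q ^ r) (p * q) \<noteq> 0"
    "qpoch2 (p * q * q powi m / w) (q ^ r) (p * q) \<noteq> 0"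
    "qpoch2 (q ^ r * p * q * q powi m / w) (q ^ r) (p * q) \<noteq> 0"
  shows "rform m w * rform (- m) (p * q / w) = 1"
proof -
  obtain x where x: "w = exp x" using assms(1) by (metis exp_Ln)
  define u where "u = exp (x + of_int m * lp)"
  define v where "v = exp (x - of_int m * lq)"
  have wp: "w * p powi m = u" by (simp add: x u_def p_exp exp_power_int exp_add)
  have wp': "p * q * p powi (- m) / w = p * q / u" "p ^ r * p * q * p powi (- m) / w = p ^ r * (p * q) / u"
    using p0 assms(1) by (simp_all add: wp[symmetric] power_int_minus field_simps)
  have wq: "w * q powi (- m) = v" by (simp add: x v_def q_exp exp_power_int exp_add exp_diff exp_minus field_simps)
  have wq': "w * q powi (int r - m) = q ^ r * v" "p * q * q powi m / w = p * q / v" "q ^ r * p * q * q powi m / w = q ^ r * (p * q) / v"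
    using q0 assms(1) by (simp_all add: wq[symmetric] power_int_diff power_int_minus field_simps)
  note A = assms[unfolded wp wp' wq wq']
  have pqw: "p * q / w = exp (lp + lq - x)" by (simp add: p_exp q_exp x exp_add exp_diff)
  have e1: "exp (x + (of_nat r - of_int m) * lq) = q ^ r * v"
    by (simp add: v_def q_exp exp_of_nat_mult[symmetric] exp_add[symmetric] algebra_simps)
  have e2: "exp (lp + lq - x + of_int (- m) * lp) = p * q / u"
    by (simp add: u_def p_exp q_exp exp_diff[symmetric] exp_add[symmetric] algebra_simps)
  have e3: "exp (lp + lq - x + (of_nat r - of_int (- m)) * lq) = q ^ r * (p * q / v)"
    by (simp add: v_def p_exp q_exp exp_of_nat_mult[symmetric] exp_diff[symmetric] exp_add[symmetric] algebra_simps)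
  have u0: "u \<noteq> 0" "v \<noteq> 0" by (auto simp: u_def v_def)
  define Gu where "Gu = elliptic_gamma u (p ^ r) (p * q)"
  define Gu' where "Gu' = elliptic_gamma (p * q / u) (p ^ r) (p * q)"
  define Gv where "Gv = elliptic_gamma v (q ^ r) (p * q)"
  define Gv' where "Gv' = elliptic_gamma (q ^ r * (p * q / v)) (q ^ r) (p * q)"
  have tu: "qtheta (p * q / u) (p * q) = qtheta u (p * q)"
    using u0 pq by (simp add: qtheta_def)
  have "Gu * elliptic_gamma (p ^ r * (p * q) / u) (p ^ r) (p * q) = 1"
    unfolding Gu_def using A u0 by (intro elliptic_gamma_reflect[OF pr pq]) auto
  moreover have "elliptic_gamma (p ^ r * (p * q / u)) (p ^ r) (p * q) = qtheta u (p * q) * Gu'"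
    unfolding Gu'_def tu[symmetric] using A u0 pq by (intro elliptic_gamma_mult_p[OF pr pq]) auto
  ultimately have G1: "Gu * Gu' * qtheta u (p * q) = 1" by (simp add: mult_ac)
  have "Gv * Gv' = 1"
    unfolding Gv_def Gv'_def using elliptic_gamma_reflect[OF qr pq, of v] A u0 by simp
  moreover have "elliptic_gamma (q ^ r * v) (q ^ r) (p * q) = qtheta v (p * q) * Gv"
    unfolding Gv_def using A u0 by (intro elliptic_gamma_mult_p[OF qr pq]) auto
  ultimately have G2: "elliptic_gamma (q ^ r * v) (q ^ r) (p * q) * Gv' = qtheta v (p * q)"
    by (simp add: mult_ac)
  have "exp (lp + lq) = p * q" by (simp add: p_exp q_exp exp_add)
  hence "qtheta (exp ((x - of_int m * lq) + of_int m * (lp + lq))) (p * q) =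
      exp (- of_int m * (x - of_int m * lq + \<i> * of_real pi) - of_int m * (of_int m - 1) / 2 * (lp + lq)) * qtheta v (p * q)"
    unfolding v_def using qtheta_exp_shift[of "lp + lq" "x - of_int m * lq" m] pq by simp
  also have "(x - of_int m * lq) + of_int m * (lp + lq) = x + of_int m * lp"
    by (simp add: algebra_simps)
  finally have th: "qtheta u (p * q) = exp (- of_int m * (x - of_int m * lq + \<i> * of_real pi) - of_int m * (of_int m - 1) / 2 * (lp + lq)) * qtheta v (p * q)"
    by (simp add: u_def)
  define M :: complex where "M = of_int m"
  have M: "of_int (- m) = - M" "of_int m = M" by (simp_all add: M_def)
  \<comment> \<open>The exponents differ by i pi m (m + 1), an even multiple of i pi.\<close>
  obtain k where k: "m * (m + 1) = 2 * k"
    using dvdE[of 2 "m * (m + 1)"] by auto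
  have k': "M * (M + 1) = 2 * of_int k"
    using arg_cong[OF k, of "of_int :: int \<Rightarrow> complex"] by (simp add: M_def)
  have "exp ((M * (M - 1) / 2 * (x + \<i> * of_real pi)
       + M * (M - 1) * (M - 2) / 6 * lp - (M + 1) * M * (M - 1) / 6 * lq)
     + ((- M) * (- M - 1) / 2 * (lp + lq - x + \<i> * of_real pi)
       + (- M) * (- M - 1) * (- M - 2) / 6 * lp - (- M + 1) * (- M) * (- M - 1) / 6 * lq)) =
     exp (- M * (x - M * lq + \<i> * of_real pi) - M * (M - 1) / 2 * (lp + lq))"
  proof (rule exp_eqI_int[of _ _ k])
    have "2 * of_int k * (\<i> * complex_of_real pi) = M * (M + 1) * (\<i> * of_real pi)" by (simp only: k')
    thus "(M * (M - 1) / 2 * (x + \<i> * of_real pi)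
       + M * (M - 1) * (M - 2) / 6 * lp - (M + 1) * M * (M - 1) / 6 * lq)
     + ((- M) * (- M - 1) / 2 * (lp + lq - x + \<i> * of_real pi)
       + (- M) * (- M - 1) * (- M - 2) / 6 * lp - (- M + 1) * (- M) * (- M - 1) / 6 * lq) =
     - M * (x - M * lq + \<i> * of_real pi) - M * (M - 1) / 2 * (lp + lq) + 2 * of_int k * (\<i> * of_real pi)"
      by (simp only:) (simp add: field_simps)
  qed
  note e = this[unfolded exp_add[of "M * (M - 1) / 2 * (x + \<i> * of_real pi)
       + M * (M - 1) * (M - 2) / 6 * lp - (M + 1) * M * (M - 1) / 6 * lq"]]
  have "rform m w * rform (- m) (p * q / w) =
     exp (- M * (x - M * lq + \<i> * of_real pi) - M * (M - 1) / 2 * (lp + lq))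
      * (Gu * Gu') * (elliptic_gamma (q ^ r * v) (q ^ r) (p * q) * Gv')"
    unfolding e[symmetric] pqw unfolding x rform_exp M e1[unfolded M] e2[unfolded M] e3[unfolded M]
      u_def[unfolded M, symmetric] Gu_def Gu'_def Gv'_def by (simp only: mult_ac)
  also have "\<dots> = 1"
    using G1 unfolding G2 th M by (simp only: mult_ac)
  finally show ?thesis .
qed

lemma eventually_rform_reflect:
  assumes "z \<noteq> 0"
  shows "\<forall>\<^sub>F w in at z. rform m w * rform (- m) (p * q / w) = 1"
proof -
  have "\<forall>\<^sub>F w in at z. w \<noteq> 0 \<and> qpoch2 (w * p powi m) (p ^ r) (p * q) \<noteq> 0 \<and>
    qpoch2 (p * q * p powi (- m) / w) (p ^ r) (p * q) \<noteq> 0 \<and>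
    qpoch2 (p ^ r * p * q * p powi (- m) / w) (p ^ r) (p * q) \<noteq> 0 \<and>
    qpoch2 (w * q powi (- m)) (q ^ r) (p * q) \<noteq> 0 \<and>
    qpoch2 (w * q powi (int r - m)) (q ^ r) (p * q) \<noteq> 0 \<and>
    qpoch2 (p * q * q powi m / w) (q ^ r) (p * q) \<noteq> 0 \<and>
    qpoch2 (q ^ r * p * q * q powi m / w) (q ^ r) (p * q) \<noteq> 0"
    using assms p0 q0 by (intro eventually_conj eventually_nonzero eventually_qpoch2_nonzero') auto
  thus ?thesis by eventually_elim (auto intro: rform_reflect)
qed

end

section \<open>Regularization in the punctured unit disc\<close>

lemma qpoch2_nonzero:
  assumes "norm p < 1" "norm q < 1" "norm z < 1"
  shows "qpoch2 z p q \<noteq> 0"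
proof
  assume "qpoch2 z p q = 0"
  then obtain j k where "z * p ^ j * q ^ k = 1" using qpoch2_eq_0_iff[OF assms(1,2)] by blast
  hence "norm (z * p ^ j * q ^ k) = 1" by simp
  moreover have "norm (z * p ^ j * q ^ k) \<le> norm z * 1 * 1"
    unfolding norm_mult norm_power using assms by (intro mult_mono power_le_one) auto
  ultimately show False using assms by simp
qed

lemma qpoch_inf_nonzero:
  assumes "norm q < 1" "norm z < 1"
  shows "qpoch_inf z q \<noteq> 0"
proof
  assume "qpoch_inf z q = 0"
  then obtain k where "z * q ^ k = 1" using qpoch_inf_eq_0_iff[OF assms(1)] by blast
  hence "norm (z * q ^ k) = 1" by simp
  moreover have "norm (z * q ^ k) \<le> norm z * 1"
    unfolding norm_mult norm_power using assms by (intro mult_mono power_le_one) auto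
  ultimately show False using assms by simp
qed

lemma analytic_on_compose_UNIV:
  "f holomorphic_on UNIV \<Longrightarrow> g analytic_on A \<Longrightarrow> (\<lambda>z. f (g z)) analytic_on A"
  using analytic_on_compose_gen[of g A f UNIV] analytic_on_open[of UNIV f] by (simp add: o_def)

lemma analytic_at_imp_tendsto: "f analytic_on {z} \<Longrightarrow> (f \<longlongrightarrow> f z) (at z)"
  using analytic_at_imp_isCont isContD by blast

context rarefied
begin

definition G :: "complex \<Rightarrow> int \<Rightarrow> complex" where
  "G z m = rarefied_gamma r z m p q"

definition punct :: "complex set" where "punct = cball 0 1 - {0}"

text \<open>
  On the punctured closed unit disc the only possible pole of the rarefied gamma function is a simple
  one at $1$, which occurs only if $r \mid m$.
\<close>

definition regularized :: "int \<Rightarrow> (complex \<Rightarrow> complex) \<Rightarrow> bool" where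
  "regularized m h \<longleftrightarrow> (\<forall>z\<in>punct. h analytic_on {z}) \<and>
     (\<forall>z\<in>punct. \<forall>\<^sub>F w in at z. (1 - w) * rform m w = h w) \<and> (h 1 \<noteq> 0 \<longleftrightarrow> int r dvd m)"

text \<open>For 0 < m < r both p^m and q^(r-m) have modulus below 1, so neither denominator vanishes
  on the punctured closed disc.\<close>

lemma rform_analytic:
  assumes "z \<noteq> 0" "norm z \<le> 1" "0 < m" "m < int r"
  shows "rform m analytic_on {z}"
proof -
  have "norm (z * p powi m) < 1"
  proof -
    have "norm (z * p powi m) \<le> norm (p powi m)" using assms by (simp add: norm_mult mult_left_le_one_le)
    also have "norm (p powi m) < 1"
      using assms np power_Suc_less_one[of "norm p" "nat m - 1"] p0 by (simp add: norm_power power_int_def)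
    finally show ?thesis .
  qed
  hence 1: "qpoch2 (z * p powi m) (p ^ r) (p * q) \<noteq> 0" using pr pq by (intro qpoch2_nonzero) auto
  have "norm (z * q powi (int r - m)) < 1"
  proof -
    have "norm (z * q powi (int r - m)) \<le> norm (q powi (int r - m))" using assms by (simp add: norm_mult mult_left_le_one_le)
    also have "norm (q powi (int r - m)) < 1"
      using assms nq power_Suc_less_one[of "norm q" "nat (int r - m) - 1"] q0 by (simp add: norm_power power_int_def)
    finally show ?thesis .
  qed
  hence 2: "qpoch2 (z * q powi (int r - m)) (q ^ r) (p * q) \<noteq> 0" using qr pq by (intro qpoch2_nonzero) auto
  show ?thesis
    unfolding rform_def elliptic_gamma_altdef[OF pr(1) pq(1)] elliptic_gamma_altdef[OF qr(1) pq(1)]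
    using assms 1 2 p0 q0
    by (intro analytic_intros analytic_on_compose_UNIV[OF holomorphic_qpoch2[OF pr(1) pq(1)]]
        analytic_on_compose_UNIV[OF holomorphic_qpoch2[OF qr(1) pq(1)]]) auto
qed

lemma ex_regularized_base:
  assumes "0 \<le> m" "m < int r"
  shows "\<exists>h. regularized m h"
proof (cases "m = 0")
  case False
  have "(\<lambda>w. (1 - w) * rform m w) analytic_on {z}" if "z \<in> punct" for z
    using that assms False by (intro analytic_intros rform_analytic) (auto simp: punct_def)
  thus ?thesis
    using False assms zdvd_imp_le[of "int r" m] by (intro exI[of _ "\<lambda>w. (1 - w) * rform m w"]) (auto simp: regularized_def)
next
  case True
  \<comment> \<open>The factor 1 - w of the denominator, the one with j = k = 0, is the only one
    that vanishes in the closed disc; the recursions of the double and of the single product isolate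
    it.\<close>
  define h where "h = (\<lambda>w. qpoch2 (p ^ r * (p * q) / w) (p ^ r) (p * q) / (qpoch_inf (p * q * w) (p * q) * qpoch2 (p ^ r * w) (p ^ r) (p * q))
       * (qpoch2 (p * q / w) (q ^ r) (p * q) / qpoch2 (q ^ r * w) (q ^ r) (p * q)))"
  have lt: "norm (c * z) < 1" if "norm c < 1" "z \<in> punct" for c z
  proof -
    have "norm (c * z) \<le> norm c * 1" unfolding norm_mult using that by (intro mult_left_mono) (auto simp: punct_def)
    thus ?thesis using that by simp
  qed
  have nz: "qpoch_inf (p * q * z) (p * q) \<noteq> 0" "qpoch2 (p ^ r * z) (p ^ r) (p * q) \<noteq> 0" "qpoch2 (q ^ r * z) (q ^ r) (p * q) \<noteq> 0"
    if "z \<in> punct" for z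
    using qpoch_inf_nonzero[OF pq(1) lt[OF pq(1) that]] qpoch2_nonzero[OF pr(1) pq(1) lt[OF pr(1) that]]
      qpoch2_nonzero[OF qr(1) pq(1) lt[OF qr(1) that]] by simp_all
  have an: "h analytic_on {z}" if "z \<in> punct" for z
    unfolding h_def using nz[OF that] that
    by (intro analytic_intros analytic_on_compose_UNIV[OF holomorphic_qpoch2[OF pr(1) pq(1)]]
        analytic_on_compose_UNIV[OF holomorphic_qpoch_inf[OF pq(1)]]
        analytic_on_compose_UNIV[OF holomorphic_qpoch2[OF qr(1) pq(1)]]) (auto simp: punct_def)
  have eq: "(1 - w) * rform m w = h w" if "w \<noteq> 0" "w \<noteq> 1" for w
  proof -
    have "qpoch2 w (p ^ r) (p * q) = (1 - w) * qpoch_inf (p * q * w) (p * q) * qpoch2 (p ^ r * w) (p ^ r) (p * q)"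
      using qpoch2_rec1[OF pr(1) pq(1), of w] qpoch_inf_rec[OF pq(1), of w] by simp
    thus ?thesis
      unfolding True rform_def elliptic_gamma_altdef[OF pr(1) pq(1)] elliptic_gamma_altdef[OF qr(1) pq(1)] h_def
      using that q0 by (simp add: mult_ac)
  qed
  have ev: "\<forall>\<^sub>F w in at z. (1 - w) * rform m w = h w" for z
    using eventually_elim2[OF eventually_nonzero eventually_neq_at_within[of 1]] eq by auto
  have "p * q \<in> punct" "1 \<in> punct" using pq by (auto simp: punct_def)
  \<comment> \<open>At 1 the numerators are double products at p^r pq and at pq, points of the open
    disc.\<close>
  hence "h 1 \<noteq> 0"
    unfolding h_def using nz[of 1] qpoch2_nonzero[OF pr(1) pq(1) lt[OF pr(1), of "p * q"]] qpoch2_nonzero[OF qr(1) pq(1) pq(1)]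
    by simp
  thus ?thesis using an ev True unfolding regularized_def by (intro exI[of _ h]) auto
qed

lemma regularized_add_r:
  assumes "regularized m h"
  shows "regularized (m + int r) (\<lambda>w. lam w m * h w)"
proof -
  have "\<forall>\<^sub>F w in at z. (1 - w) * rform (m + int r) w = lam w m * h w" if "z \<in> punct" for z
  proof -
    have "\<forall>\<^sub>F w in at z. (1 - w) * rform m w = h w" using assms that by (auto simp: regularized_def)
    moreover have "\<forall>\<^sub>F w in at z. rform (m + int r) w = lam w m * rform m w"
      using that by (intro eventually_rform_quasi) (auto simp: punct_def)
    ultimately show ?thesis by eventually_elim (metis mult.left_commute)
  qed
  thus ?thesis
    using assms unfolding regularized_def
    by (auto intro!: analytic_on_mult lam_analytic simp: lam_nonzero punct_def)
qed

lemma regularized_diff_r: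
  assumes "regularized m h"
  shows "regularized (m - int r) (\<lambda>w. h w / lam w (m - int r))"
proof -
  have "\<forall>\<^sub>F w in at z. (1 - w) * rform (m - int r) w = h w / lam w (m - int r)" if "z \<in> punct" for z
  proof -
    have "\<forall>\<^sub>F w in at z. (1 - w) * rform m w = h w" using assms that by (auto simp: regularized_def)
    moreover have "\<forall>\<^sub>F w in at z. rform (m - int r + int r) w = lam w (m - int r) * rform (m - int r) w"
      using that by (intro eventually_rform_quasi) (auto simp: punct_def)
    ultimately show ?thesis using eventually_nonzero[of z]
      by eventually_elim (auto simp: field_simps lam_nonzero)
  qed
  moreover have "int r dvd m - int r \<longleftrightarrow> int r dvd m" by (simp add: dvd_diff_left_iff)
  ultimately show ?thesis
    using assms unfolding regularized_def
    by (auto intro!: analytic_on_divide lam_analytic simp: lam_nonzero punct_def)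
qed

text \<open>Residues modulo r are the base case; steps by r multiply by \<open>lam\<close> or its
  inverse, which is analytic and nonzero off 0, so the behaviour at 1 depends only on m modulo
  r.\<close>

lemma ex_regularized: "\<exists>h. regularized m h"
proof -
  have "\<exists>h. regularized (m mod int r + k * int r) h" for k
  proof (induction k rule: int_induct[of _ 0])
    case base
    thus ?case using ex_regularized_base[of "m mod int r"] r by simp
  next
    case (step1 i)
    then obtain h where "regularized (m mod int r + i * int r) h" by blast
    from regularized_add_r[OF this] show ?case by (auto simp: algebra_simps)
  next
    case (step2 i)
    then obtain h where "regularized (m mod int r + i * int r) h" by blast
    from regularized_diff_r[OF this] show ?case by (auto simp: algebra_simps)
  qed
  from this[of "m div int r"] show ?thesis by simp
qed

text \<open>The choice is immaterial on \<open>punct\<close>, where the values are forced as limits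
  of \<open>(1 - w) * rform m w\<close>. The function stays continuous at 1, where G may have its
  pole.\<close>

definition Hh :: "int \<Rightarrow> complex \<Rightarrow> complex" where
  "Hh m = (SOME h. regularized m h)"

lemma regularized_Hh: "regularized m (Hh m)"
  unfolding Hh_def using ex_regularized by (rule someI_ex)

lemma Hh_analytic: "z \<in> punct \<Longrightarrow> Hh m analytic_on {z}"
  using regularized_Hh by (auto simp: regularized_def)

lemma Hh_continuous: "continuous_on punct (Hh m)"
  using Hh_analytic analytic_at_imp_isCont by (intro continuous_at_imp_continuous_on) blast

lemma Hh_1_eq_0_iff: "Hh m 1 = 0 \<longleftrightarrow> \<not> int r dvd m"
  using regularized_Hh[of m] by (auto simp: regularized_def)

lemma rform_tendsto:
  assumes "z \<in> punct" "z \<noteq> 1"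
  shows "(rform m \<longlongrightarrow> Hh m z / (1 - z)) (at z)"
proof -
  have "(Hh m \<longlongrightarrow> Hh m z) (at z)" using Hh_analytic[OF assms(1)] by (rule analytic_at_imp_tendsto)
  hence "((\<lambda>w. Hh m w / (1 - w)) \<longlongrightarrow> Hh m z / (1 - z)) (at z)"
    using assms by (intro tendsto_intros) auto
  moreover have "\<forall>\<^sub>F w in at z. (1 - w) * rform m w = Hh m w"
    using regularized_Hh assms by (auto simp: regularized_def)
  hence "\<forall>\<^sub>F w in at z. Hh m w / (1 - w) = rform m w"
    using eventually_neq_at_within[of 1] by eventually_elim (auto simp: field_simps)
  ultimately show ?thesis by (rule Lim_transform_eventually)
qed

lemma G_eq:
  assumes "z \<in> punct" "z \<noteq> 1"
  shows "G z m = Hh m z / (1 - z)"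
  unfolding G_def rarefied_gamma_altdef using rform_tendsto[OF assms] by (rule remove_sings_eqI)

lemma rform_tendsto_G:
  assumes "z \<in> punct" "z \<noteq> 1"
  shows "(rform m \<longlongrightarrow> G z m) (at z)"
  using rform_tendsto[OF assms] G_eq[OF assms] by simp

lemma G_holomorphic: "(\<lambda>z. G z m) holomorphic_on (ball 0 1 - {0})"
proof (rule holomorphic_transform)
  have "Hh m analytic_on (ball 0 1 - {0})"
    by (subst analytic_on_analytic_at) (auto simp: punct_def intro: Hh_analytic)
  hence "Hh m holomorphic_on (ball 0 1 - {0})"
    by (rule analytic_imp_holomorphic)
  thus "(\<lambda>z. Hh m z / (1 - z)) holomorphic_on (ball 0 1 - {0})"
    by (intro holomorphic_intros) auto
next
  fix z :: complex assume "z \<in> ball 0 1 - {0}"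
  hence "z \<in> punct" "z \<noteq> 1" by (auto simp: punct_def)
  thus "Hh m z / (1 - z) = G z m" by (simp add: G_eq)
qed

text \<open>\<open>rform_shift\<close> holds in a punctured neighbourhood of z, and its two sides
  tend to the asserted values, as z and q z are points of the disc other than 0 and 1.\<close>

lemma G_shift:
  assumes "z \<noteq> 0" "norm z < 1"
  shows "G (q * z) (m + 1) = Th z m * G z m"
proof (rule tendsto_unique[of "at z"])
  have "norm (q * z) < 1" using assms nq mult_strict_mono[of "norm q" 1 "norm z" 1] by (simp add: norm_mult)
  hence "(rform (m + 1) \<longlongrightarrow> G (q * z) (m + 1)) (at (q * z))"
    using assms q0 by (intro rform_tendsto_G) (auto simp: punct_def)
  from filterlim_compose[OF this filterlim_mult_at[OF q0]]
  have "((\<lambda>w. rform (m + 1) (q * w)) \<longlongrightarrow> G (q * z) (m + 1)) (at z)" .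
  thus "((\<lambda>w. Th w m * rform m w) \<longlongrightarrow> G (q * z) (m + 1)) (at z)"
    using eventually_rform_shift[OF assms(1)] by (rule Lim_transform_eventually)
  have op: "open (- {0::complex})" by auto
  have "isCont (\<lambda>w. qtheta w (p ^ r)) (z * p powi m)"
    by (rule continuous_on_eq_continuous_at[THEN iffD1, rule_format, OF op
          holomorphic_on_imp_continuous_on[OF holomorphic_qtheta[OF pr]]])
       (use assms p0 in auto)
  hence "isCont (\<lambda>w. qtheta (w * p powi m) (p ^ r)) z"
    using isCont_o2[where f = "\<lambda>w. w * p powi m" and g = "\<lambda>w. qtheta w (p ^ r)" and a = z] by simp
  hence "isCont (\<lambda>w. Th w m) z"
    unfolding Th_def using assms by (intro continuous_intros) auto
  hence "((\<lambda>w. Th w m) \<longlongrightarrow> Th z m) (at z)" by (simp add: isCont_def)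
  thus "((\<lambda>w. Th w m * rform m w) \<longlongrightarrow> Th z m * G z m) (at z)"
    using assms by (intro tendsto_mult rform_tendsto_G) (auto simp: punct_def)
qed auto

lemma G_quasi:
  assumes "z \<noteq> 0" "norm z < 1"
  shows "G z (m + int r) = lam z m * G z m"
proof (rule tendsto_unique[of "at z"])
  have z: "z \<in> punct" "z \<noteq> 1" using assms by (auto simp: punct_def)
  show "((\<lambda>w. lam w m * rform m w) \<longlongrightarrow> lam z m * G z m) (at z)"
    using assms by (intro tendsto_mult rform_tendsto_G z analytic_at_imp_tendsto lam_analytic)
  show "((\<lambda>w. lam w m * rform m w) \<longlongrightarrow> G z (m + int r)) (at z)"
    using rform_tendsto_G[OF z] eventually_rform_quasi[OF assms(1)] by (rule Lim_transform_eventually)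
qed auto

text \<open>The closed bound |z| <= 1 matters: the denominator of the integrand has arguments z^2
  and z^(-2) on the unit circle. The lower bound keeps pq / z inside the disc.\<close>

lemma G_reflect:
  assumes "norm (p * q) < norm z" "norm z \<le> 1" "z \<noteq> 1"
  shows "G z m * G (p * q / z) (- m) = 1"
proof (rule tendsto_unique[of "at z"])
  have z: "z \<in> punct" "z \<noteq> 1" using assms by (auto simp: punct_def)
  hence z0: "z \<noteq> 0" by (auto simp: punct_def)
  have "norm (p * q / z) < 1" using assms z0 by (simp add: norm_divide divide_simps)
  hence "(rform (- m) \<longlongrightarrow> G (p * q / z) (- m)) (at (p * q / z))"
    using z0 pq by (intro rform_tendsto_G) (auto simp: punct_def)
  from filterlim_compose[OF this filterlim_divide_at[OF pq(2) z0]]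
  show "((\<lambda>w. rform m w * rform (- m) (p * q / w)) \<longlongrightarrow> G z m * G (p * q / z) (- m)) (at z)"
    by (intro tendsto_mult rform_tendsto_G z)
  have "\<forall>\<^sub>F w in at z. 1 = rform m w * rform (- m) (p * q / w)"
    using eventually_rform_reflect[OF z0] by eventually_elim simp
  thus "((\<lambda>w. rform m w * rform (- m) (p * q / w)) \<longlongrightarrow> 1) (at z)"
    by (rule Lim_transform_eventually[OF tendsto_const])
qed auto

lemma G_nonzero:
  assumes "norm (p * q) < norm z" "norm z < 1"
  shows "G z m \<noteq> 0"
proof -
  have "z \<noteq> 1" using assms by auto
  thus ?thesis using G_reflect[of z m] assms by auto
qed

end

section \<open>Means over circles\<close>

definition unit_exp :: "real \<Rightarrow> complex" where
  "unit_exp x = exp (2 * of_real pi * \<i> * of_real x)"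

text \<open>The integral of F(z) dz / (2 pi i z) over the circle |z| = |c|, written as a real
  integral so that substitutions and Fubini's theorem apply directly.\<close>

definition circ_mean :: "complex \<Rightarrow> (complex \<Rightarrow> complex) \<Rightarrow> complex" where
  "circ_mean c F = integral {0..1} (\<lambda>x. F (c * unit_exp x))"

lemma norm_unit_exp [simp]: "norm (unit_exp x) = 1"
  by (simp add: unit_exp_def norm_exp_eq_Re)

lemma unit_exp_nonzero [simp]: "unit_exp x \<noteq> 0"
  by (simp add: unit_exp_def)

lemma unit_exp_diff: "unit_exp (1 - x) = inverse (unit_exp x)"
  by (simp add: unit_exp_def exp_minus[symmetric] ring_distribs exp_diff) (simp add: exp_minus divide_simps)

lemma continuous_on_unit_exp [continuous_intros]:
  "continuous_on A f \<Longrightarrow> continuous_on A (\<lambda>x. unit_exp (f x))"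
  unfolding unit_exp_def by (intro continuous_intros)

lemma continuous_on_compose_unit_exp:
  assumes "continuous_on (A \<times> sphere 0 1) (\<lambda>(w, z). f w z)"
    and "continuous_on B g" "\<And>x. x \<in> B \<Longrightarrow> g x \<in> A" "continuous_on B h"
  shows "continuous_on B (\<lambda>x. f (g x) (unit_exp (h x)))"
proof -
  have "continuous_on B (\<lambda>x. (g x, unit_exp (h x)))"
    using assms by (intro continuous_intros)
  moreover have "(\<lambda>x. (g x, unit_exp (h x))) ` B \<subseteq> A \<times> sphere 0 1"
    using assms by auto
  ultimately show ?thesis
    using continuous_on_compose2[OF assms(1)] by fastforce
qed

lemma circ_mean_integrable:
  fixes F :: "complex \<Rightarrow> complex"
  assumes "continuous_on (sphere 0 1) F"
  shows "(\<lambda>x. F (unit_exp x)) integrable_on {0..1}"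
proof (rule integrable_continuous_real)
  have "continuous_on {0..1} unit_exp"
    using continuous_on_unit_exp[OF continuous_on_id] by simp
  thus "continuous_on {0..1} (\<lambda>x. F (unit_exp x))"
    by (rule continuous_on_compose2[OF assms]) auto
qed

lemma circ_mean_add:
  assumes "continuous_on (sphere 0 1) F" "continuous_on (sphere 0 1) H"
  shows "circ_mean 1 (\<lambda>z. F z + H z) = circ_mean 1 F + circ_mean 1 H"
  using integral_add[OF circ_mean_integrable[OF assms(1)] circ_mean_integrable[OF assms(2)]]
  by (simp add: circ_mean_def)

lemma circ_mean_diff:
  assumes "continuous_on (sphere 0 1) F" "continuous_on (sphere 0 1) H"
  shows "circ_mean 1 (\<lambda>z. F z - H z) = circ_mean 1 F - circ_mean 1 H"
  using integral_diff[OF circ_mean_integrable[OF assms(1)] circ_mean_integrable[OF assms(2)]]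
  by (simp add: circ_mean_def)

lemma circ_mean_cmult: "circ_mean c (\<lambda>z. a * F z) = a * circ_mean c F"
  by (simp add: circ_mean_def)

lemma circ_mean_sum:
  assumes "finite I" "\<And>i. i \<in> I \<Longrightarrow> continuous_on (sphere 0 1) (F i)"
  shows "circ_mean 1 (\<lambda>z. \<Sum>i\<in>I. F i z) = (\<Sum>i\<in>I. circ_mean 1 (F i))"
  using integral_sum[OF assms(1) circ_mean_integrable[OF assms(2)]] by (simp add: circ_mean_def)

lemma circ_mean_cong:
  assumes "\<And>z. norm z = norm c \<Longrightarrow> F z = H z"
  shows "circ_mean c F = circ_mean c H"
  unfolding circ_mean_def by (intro integral_cong assms) (simp add: norm_mult)

lemma circ_mean_norm_bound:
  assumes "continuous_on (sphere 0 1) F" "continuous_on (sphere 0 1) K"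
    and "\<And>z. norm z = 1 \<Longrightarrow> norm (F z) \<le> Re (K z)"
  shows "norm (circ_mean 1 F) \<le> Re (circ_mean 1 K)"
proof -
  have "((\<lambda>x. Re (K (unit_exp x))) has_integral Re (circ_mean 1 K)) {0..1}"
    using has_integral_linear[OF integrable_integral[OF circ_mean_integrable[OF assms(2)]] bounded_linear_Re]
    by (simp add: circ_mean_def o_def)
  moreover have "norm (circ_mean 1 F) \<le> integral {0..1} (\<lambda>x. Re (K (unit_exp x)))"
    unfolding circ_mean_def mult_1 using calculation
    by (intro integral_norm_bound_integral circ_mean_integrable assms has_integral_integrable) auto
  ultimately show ?thesis by (simp add: integral_unique)
qed

text \<open>The substitution z -> a / z maps the circle |z| = |c| to |z| = |a / c| and reverses the
  parameter, x -> 1 - x: a reflection followed by a shift by one period.\<close>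

lemma circ_mean_divide: "circ_mean c (\<lambda>z. F (a / z)) = circ_mean (a / c) F"
proof -
  have "integral {0..1} (\<lambda>x. F (a / c * unit_exp x)) = integral {-1..-0} (\<lambda>x. F (a / c * unit_exp (- x)))"
    using Henstock_Kurzweil_Integration.integral_reflect_real[of 1 0 "\<lambda>x. F (a / c * unit_exp x)"] by simp
  also have "\<dots> = integral {0..1} (\<lambda>x. F (a / c * unit_exp (- (x - 1))))"
    using integral_shift_real_ivl[of "-1" "-1" 0 "\<lambda>x. F (a / c * unit_exp (- x))"]
    by simp
  also have "\<dots> = integral {0..1} (\<lambda>x. F (a / (c * unit_exp x)))"
    by (intro integral_cong) (simp add: unit_exp_diff divide_simps)
  finally show ?thesis by (simp add: circ_mean_def)
qed

lemma contour_integral_circ_mean: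
  "contour_integral (circlepath 0 1) (\<lambda>z. F z / z) = 2 * of_real pi * \<i> * circ_mean 1 F"
proof -
  have "contour_integral (circlepath 0 1) (\<lambda>z. F z / z) =
      integral {0..1} (\<lambda>x. 2 * of_real pi * \<i> * F (unit_exp x))"
    unfolding contour_integral_integral vector_derivative_circlepath
    by (intro integral_cong) (simp add: circlepath unit_exp_def field_simps)
  thus ?thesis by (simp add: circ_mean_def)
qed

lemma circ_mean_holomorphic_disc:
  assumes "F holomorphic_on ball 0 R" "R > 1"
  shows "circ_mean 1 F = F 0"
proof -
  have "((\<lambda>u. F u / (u - 0)) has_contour_integral 2 * of_real pi * \<i> * F 0) (circlepath 0 1)"
  proof (intro Cauchy_integral_circlepath)
    have "F holomorphic_on cball 0 1" "F holomorphic_on ball 0 1"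
      by (rule holomorphic_on_subset[OF assms(1)]; use assms(2) in auto)+
    thus "continuous_on (cball 0 1) F" "F holomorphic_on ball 0 1"
      by (auto intro: holomorphic_on_imp_continuous_on)
  qed auto
  hence "contour_integral (circlepath 0 1) (\<lambda>z. F z / z) = 2 * of_real pi * \<i> * F 0"
    by (simp add: contour_integral_unique)
  thus ?thesis by (simp add: contour_integral_circ_mean)
qed

text \<open>In the coordinate s = log z the mean is an average of \<open>\<phi>\<close> over a
  vertical segment of length 2 pi that starts at s. Its derivative telescopes by the periodicity of
  exp, and the strip S is convex.\<close>

lemma circ_mean_independent:
  assumes F: "F holomorphic_on {z. a < norm z \<and> norm z < b}"
    and "0 < a" "a < norm c" "norm c < b" "a < norm d" "norm d < b"
  shows "circ_mean c F = circ_mean d F"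
proof -
  define S where "S = {s. ln a < Re s \<and> Re s < ln b}"
  have ab: "0 < a" "0 < b" using assms by auto
  have S: "convex S" "open S"
    unfolding S_def by (auto intro!: convex_Int convex_halfspace_Re_gt convex_halfspace_Re_lt
        open_Int open_halfspace_Re_gt open_halfspace_Re_lt simp: Collect_conj_eq)
  define \<phi> where "\<phi> = (\<lambda>s. F (exp s))"
  have ex: "exp s \<in> {z. a < norm z \<and> norm z < b}" if "s \<in> S" for s
    using that ab unfolding S_def by (simp add: norm_exp_eq_Re) (metis exp_less_cancel_iff exp_ln)
  have \<phi>: "\<phi> holomorphic_on S"
    unfolding \<phi>_def using holomorphic_on_compose_gen[OF holomorphic_on_exp F, of S] ex
    by (force simp: o_def)
  have d\<phi>: "deriv \<phi> holomorphic_on S" by (rule holomorphic_deriv[OF \<phi> S(2)])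
  define p where "p = (\<lambda>s x. s + 2 * of_real pi * \<i> * of_real x :: complex)"
  have pS: "p s x \<in> S" if "s \<in> S" for s and x :: real using that by (simp add: S_def p_def)
  define M where "M = (\<lambda>s. integral (cbox 0 1) (\<lambda>x::real. \<phi> (p s x)))"
  have "(M has_field_derivative 0) (at s within S)" if s: "s \<in> S" for s
  proof -
    have "(M has_field_derivative integral (cbox 0 1) (\<lambda>x. deriv \<phi> (p s x))) (at s within S)"
      unfolding M_def
    proof (rule leibniz_rule_field_derivative[where fx = "\<lambda>s x. deriv \<phi> (p s x)" and U = S])
      fix s and t :: real assume "s \<in> S"
      from holomorphic_derivI[OF \<phi> S(2) pS[OF this]]
      have "(\<phi> has_field_derivative deriv \<phi> (p s t)) (at (p s t))" .
      moreover have "((\<lambda>s. p s t) has_field_derivative 1) (at s within S)"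
        unfolding p_def by (auto intro!: derivative_eq_intros)
      ultimately have "((\<lambda>s. \<phi> (p s t)) has_field_derivative deriv \<phi> (p s t) * 1) (at s within S)"
        by (rule DERIV_chain2)
      thus "((\<lambda>s. \<phi> (p s t)) has_field_derivative deriv \<phi> (p s t)) (at s within S)" by simp
    next
      fix s assume "s \<in> S"
      thus "(\<lambda>x. \<phi> (p s x)) integrable_on cbox 0 (1::real)"
        by (intro integrable_continuous continuous_on_compose2[OF holomorphic_on_imp_continuous_on[OF \<phi>]])
           (auto simp: pS p_def intro!: continuous_intros intro: pS[unfolded p_def])
    next
      show "continuous_on (S \<times> cbox 0 (1::real)) (\<lambda>(s, x). deriv \<phi> (p s x))"
        unfolding split_beta
        by (rule continuous_on_compose2[OF holomorphic_on_imp_continuous_on[OF d\<phi>]])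
           (auto simp: p_def intro!: continuous_intros intro: pS[unfolded p_def])
    qed (use s S in auto)
    also have "((\<lambda>x::real. deriv \<phi> (p s x)) has_integral
        (\<phi> (p s 1) / (2 * of_real pi * \<i>) - \<phi> (p s 0) / (2 * of_real pi * \<i>))) {0..1}"
    proof (rule fundamental_theorem_of_calculus)
      fix x :: real
      have "(p s has_vector_derivative 2 * of_real pi * \<i>) (at x within {0..1})"
        unfolding p_def by (auto intro!: derivative_eq_intros)
      moreover have "(\<phi> has_field_derivative deriv \<phi> (p s x)) (at (p s x) within p s ` {0..1})"
        using holomorphic_derivI[OF \<phi> S(2) pS[OF s]] by (rule has_field_derivative_at_within)
      ultimately have "((\<lambda>x. \<phi> (p s x)) has_vector_derivative (2 * of_real pi * \<i>) * deriv \<phi> (p s x)) (at x within {0..1})"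
        using field_vector_diff_chain_within[of "p s"] by (simp add: o_def)
      hence "((\<lambda>x. \<phi> (p s x) / (2 * of_real pi * \<i>)) has_vector_derivative
         (2 * of_real pi * \<i>) * deriv \<phi> (p s x) / (2 * of_real pi * \<i>)) (at x within {0..1})"
        by (rule has_vector_derivative_divide)
      thus "((\<lambda>x. \<phi> (p s x) / (2 * of_real pi * \<i>)) has_vector_derivative deriv \<phi> (p s x)) (at x within {0..1})"
        by simp
    qed auto
    hence "integral (cbox 0 1) (\<lambda>x::real. deriv \<phi> (p s x)) =
        \<phi> (p s 1) / (2 * of_real pi * \<i>) - \<phi> (p s 0) / (2 * of_real pi * \<i>)"
      by (simp add: integral_unique)
    also have "\<dots> = 0"
      by (simp add: \<phi>_def p_def exp_add exp_two_pi_i)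
    finally show ?thesis .
  qed
  then obtain K where K: "\<And>s. s \<in> S \<Longrightarrow> M s = K"
    using has_field_derivative_zero_constant[OF S(1)] by blast
  have *: "circ_mean c F = K" if "a < norm c" "norm c < b" for c
  proof -
    have c0: "c \<noteq> 0" using that assms by auto
    have "Ln c \<in> S" using that ab c0 by (simp add: S_def)
    from K[OF this] show ?thesis
      unfolding M_def circ_mean_def \<phi>_def p_def unit_exp_def exp_add exp_Ln[OF c0] by simp
  qed
  show ?thesis using *[of c] *[of d] assms by simp
qed

lemma circ_mean_swap:
  assumes "continuous_on (sphere 0 1 \<times> sphere 0 1) (\<lambda>(z, w). f z w)"
  shows "circ_mean 1 (\<lambda>z. circ_mean 1 (f z)) = circ_mean 1 (\<lambda>w. circ_mean 1 (\<lambda>z. f z w))"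
proof -
  have "continuous_on (cbox (0, 0) (1, 1)) (\<lambda>(x, y). f (unit_exp x) (unit_exp y))"
    unfolding split_beta
    by (rule continuous_on_compose_unit_exp[OF assms]) (auto intro!: continuous_intros)
  from integral_swap_continuous[OF this] show ?thesis by (simp add: circ_mean_def)
qed

text \<open>Morera's theorem: integrals over triangles are interchanged with the mean by continuity,
  and they vanish for each fixed z by Cauchy's theorem.\<close>

lemma circ_mean_holomorphic:
  assumes U: "open U" and cont: "continuous_on (U \<times> sphere 0 1) (\<lambda>(w, z). f w z)"
    and hol: "\<And>z. norm z = 1 \<Longrightarrow> (\<lambda>w. f w z) holomorphic_on U"
  shows "(\<lambda>w. circ_mean 1 (f w)) holomorphic_on U"
proof (rule analytic_imp_holomorphic, rule Morera_triangle[OF _ U])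
  have "continuous_on (U \<times> cbox 0 1) (\<lambda>(w, x). f w (unit_exp x))"
    unfolding split_beta
    by (rule continuous_on_compose_unit_exp[OF cont]) (auto intro!: continuous_intros)
  from integral_continuous_on_param[OF this]
  show "continuous_on U (\<lambda>w. circ_mean 1 (f w))" by (simp add: circ_mean_def)
next
  fix a b c
  show "convex hull {a, b, c} \<subseteq> U \<longrightarrow>
     contour_integral (linepath a b) (\<lambda>w. circ_mean 1 (f w)) +
     contour_integral (linepath b c) (\<lambda>w. circ_mean 1 (f w)) +
     contour_integral (linepath c a) (\<lambda>w. circ_mean 1 (f w)) = 0"
  proof
    assume hull: "convex hull {a, b, c} \<subseteq> U"
    have swap: "contour_integral (linepath u v) (\<lambda>w. circ_mean 1 (f w)) =
        circ_mean 1 (\<lambda>z. contour_integral (linepath u v) (\<lambda>w. f w z))"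
      and cont2: "continuous_on (sphere 0 1) (\<lambda>z. contour_integral (linepath u v) (\<lambda>w. f w z))"
      if "closed_segment u v \<subseteq> U" for u v
    proof -
      have seg: "linepath u v x \<in> U" if "x \<in> {0..1}" for x
        using that \<open>closed_segment u v \<subseteq> U\<close> path_image_linepath[of u v] unfolding path_image_def by blast
      have lp: "continuous_on A h \<Longrightarrow> continuous_on A (\<lambda>x. linepath u v (h x))"
        for A :: "(real \<times> real) set" and h
        unfolding linepath_def by (intro continuous_intros)
      have c: "continuous_on (cbox (0, 0) (1, 1)) (\<lambda>(x, y). f (linepath u v x) (unit_exp y) * (v - u))"
        unfolding split_beta
        by (intro continuous_intros continuous_on_compose_unit_exp[OF cont])
           (auto intro!: continuous_intros seg lp simp: cbox_Pair_eq)
      from integral_swap_continuous[OF c]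
      show "contour_integral (linepath u v) (\<lambda>w. circ_mean 1 (f w)) =
        circ_mean 1 (\<lambda>z. contour_integral (linepath u v) (\<lambda>w. f w z))"
        by (simp add: circ_mean_def contour_integral_integral)
      have "continuous_on (sphere 0 1 \<times> cbox 0 1) (\<lambda>(z, x). f (linepath u v x) z * (v - u))"
      proof -
        have "continuous_on (sphere 0 1 \<times> cbox 0 1) (\<lambda>xy. (linepath u v (snd xy), fst xy) :: complex \<times> complex)"
          unfolding linepath_def by (intro continuous_intros)
        from continuous_on_compose2[OF cont this]
        have "continuous_on (sphere 0 1 \<times> cbox 0 1) (\<lambda>xy. f (linepath u v (snd xy)) (fst xy))"
          using seg by fastforce
        thus ?thesis unfolding split_beta by (intro continuous_intros)
      qed
      from integral_continuous_on_param[OF this]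
      show "continuous_on (sphere 0 1) (\<lambda>z. contour_integral (linepath u v) (\<lambda>w. f w z))"
        by (simp add: contour_integral_integral)
    qed
    have seg: "closed_segment a b \<subseteq> U" "closed_segment b c \<subseteq> U" "closed_segment c a \<subseteq> U"
      using segments_subset_convex_hull(1)[where a = a and b = b and c = c]
        segments_subset_convex_hull(3)[where a = a and b = b and c = c]
        segments_subset_convex_hull(5)[where a = a and b = b and c = c] hull by blast+
    have "contour_integral (linepath a b) (\<lambda>w. circ_mean 1 (f w)) +
     contour_integral (linepath b c) (\<lambda>w. circ_mean 1 (f w)) +
     contour_integral (linepath c a) (\<lambda>w. circ_mean 1 (f w)) =
     circ_mean 1 (\<lambda>z. contour_integral (linepath a b) (\<lambda>w. f w z) +
       contour_integral (linepath b c) (\<lambda>w. f w z) + contour_integral (linepath c a) (\<lambda>w. f w z))"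
      unfolding swap[OF seg(1)] swap[OF seg(2)] swap[OF seg(3)]
      by (subst circ_mean_add circ_mean_add; (intro continuous_intros cont2 seg)?)+ simp
    also have "\<dots> = circ_mean 1 (\<lambda>z. 0)"
    proof (rule circ_mean_cong)
      fix z :: complex assume "norm z = norm (1 :: complex)"
      hence "(\<lambda>w. f w z) holomorphic_on convex hull {a, b, c}"
        using hol[of z] hull holomorphic_on_subset by auto
      from has_chain_integral_chain_integral3[OF Cauchy_theorem_triangle[OF this]]
      show "contour_integral (linepath a b) (\<lambda>w. f w z) +
       contour_integral (linepath b c) (\<lambda>w. f w z) + contour_integral (linepath c a) (\<lambda>w. f w z) = 0" .
    qed
    finally show "contour_integral (linepath a b) (\<lambda>w. circ_mean 1 (f w)) +
     contour_integral (linepath b c) (\<lambda>w. circ_mean 1 (f w)) +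
     contour_integral (linepath c a) (\<lambda>w. circ_mean 1 (f w)) = 0" by (simp add: circ_mean_def)
  qed
qed

section \<open>Concentration of mass at z = i and z = -i\<close>

definition poisson_kernel :: "real \<Rightarrow> complex \<Rightarrow> complex" where
  "poisson_kernel \<rho> z = of_real (1 - \<rho> ^ 4) / ((1 + of_real \<rho> ^ 2 * z ^ 2) * (1 + of_real \<rho> ^ 2 / z ^ 2))"

text \<open>On the unit circle this is the Poisson kernel of radius \<rho>^2 at the point -z^2.
  Partial fractions split it into functions holomorphic in a disc around 0 and images of such
  functions under z -> 1/z, whose means are values at 0.\<close>

lemma poisson_kernel_moments:
  fixes \<rho> :: real
  assumes "0 < \<rho>" "\<rho> < 1"
  defines "K \<equiv> poisson_kernel \<rho>"
  shows "circ_mean 1 K = 1" "circ_mean 1 (\<lambda>z. K z * z) = 0"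
    "\<And>z. norm z = 1 \<Longrightarrow> K z = of_real ((1 - \<rho> ^ 4) / norm (1 + of_real \<rho> ^ 2 * z ^ 2) ^ 2)"
    "\<And>z :: complex. norm z = 1 \<Longrightarrow> 1 + of_real \<rho> ^ 2 * z ^ 2 \<noteq> 0 \<and> 1 + of_real \<rho> ^ 2 / z ^ 2 \<noteq> 0"
    "continuous_on (sphere 0 1) K"
proof -
  \<comment> \<open>Radius of the disc in which 1 + \<rho>^2 z^2 has no zero.\<close>
  define R where "R = 1 / \<rho>"
  have R: "R > 1" using assms by (simp add: R_def)
  have r2: "\<rho> ^ 2 < 1" using assms by (simp add: power_less_one_iff)
  have nz: "1 + of_real \<rho> ^ 2 * z ^ 2 \<noteq> 0" if "norm z < R" for z :: complex
  proof
    assume "1 + of_real \<rho> ^ 2 * z ^ 2 = 0"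
    hence "of_real \<rho> ^ 2 * z ^ 2 = - 1" by (simp add: add_eq_0_iff)
    hence "norm (of_real \<rho> ^ 2 * z ^ 2) = 1" by (simp only: norm_minus_cancel norm_one)
    hence "(\<rho> * norm z) ^ 2 = 1" using assms by (simp add: norm_mult norm_power power_mult_distrib)
    hence "\<rho> * norm z = 1" using assms by (simp add: power2_eq_1_iff) (smt (verit) mult_nonneg_nonneg norm_ge_zero)
    thus False using that assms by (simp add: R_def field_simps)
  qed
  have nz': "1 + of_real \<rho> ^ 2 / z ^ 2 \<noteq> 0" if "norm z = 1" for z :: complex
    using nz[of "1 / z"] that R by (simp add: norm_divide power_divide)
  have F1: "(\<lambda>z. 1 / (1 + of_real \<rho> ^ 2 * z ^ 2)) holomorphic_on ball 0 R"
    "(\<lambda>z. z / (1 + of_real \<rho> ^ 2 * z ^ 2)) holomorphic_on ball 0 R"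
    by (intro holomorphic_intros; use nz in auto)+
  have c1: "continuous_on (sphere 0 1) (\<lambda>z. 1 / (1 + of_real \<rho> ^ 2 * z ^ 2) :: complex)"
    "continuous_on (sphere 0 1) (\<lambda>z. z / (1 + of_real \<rho> ^ 2 * z ^ 2) :: complex)"
    "continuous_on (sphere 0 1) (\<lambda>z. 1 / (1 + of_real \<rho> ^ 2 / z ^ 2) :: complex)"
    "continuous_on (sphere 0 1) (\<lambda>z. 1 / z / (1 + of_real \<rho> ^ 2 / z ^ 2) :: complex)"
    by (intro continuous_intros; use nz nz' R in force)+
  have m1: "circ_mean 1 (\<lambda>z. 1 / (1 + of_real \<rho> ^ 2 * z ^ 2)) = 1"
    using circ_mean_holomorphic_disc[OF F1(1) R] by simp
  have m2: "circ_mean 1 (\<lambda>z. z / (1 + of_real \<rho> ^ 2 * z ^ 2)) = 0"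
    using circ_mean_holomorphic_disc[OF F1(2) R] by simp
  have m3: "circ_mean 1 (\<lambda>z. 1 / (1 + of_real \<rho> ^ 2 / z ^ 2)) = 1"
    using circ_mean_divide[of 1 "\<lambda>z. 1 / (1 + of_real \<rho> ^ 2 * z ^ 2)" 1] m1 by (simp add: power_divide)
  have m4: "circ_mean 1 (\<lambda>z. 1 / z / (1 + of_real \<rho> ^ 2 / z ^ 2)) = 0"
    using circ_mean_divide[of 1 "\<lambda>z. z / (1 + of_real \<rho> ^ 2 * z ^ 2)" 1] m2 by (simp add: power_divide)
  have m5: "circ_mean 1 (\<lambda>z. z) = 0"
    using circ_mean_holomorphic_disc[of "\<lambda>z. z" 2] by (simp add: holomorphic_on_ident)
  have m6: "circ_mean 1 (\<lambda>z. 1) = 1" by (simp add: circ_mean_def)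
  have K1: "K z = 1 / (1 + of_real \<rho> ^ 2 * z ^ 2) + 1 / (1 + of_real \<rho> ^ 2 / z ^ 2) - 1" if z: "norm z = 1" for z
  proof -
    define u where "u = of_real \<rho> ^ 2 * z ^ 2"
    define v where "v = of_real \<rho> ^ 2 / z ^ 2"
    have "u * v = of_real (\<rho> ^ 4)" using z by (auto simp: u_def v_def simp flip: power_add)
    hence "K z = (1 - u * v) / ((1 + u) * (1 + v))" by (simp add: K_def poisson_kernel_def u_def v_def)
    moreover have "1 + u \<noteq> 0" "1 + v \<noteq> 0" using nz[of z] nz'[of z] z R by (auto simp: u_def v_def)
    ultimately have "K z = 1 / (1 + u) + 1 / (1 + v) - 1" by (simp add: divide_simps) (simp add: algebra_simps)
    thus ?thesis by (simp add: u_def v_def)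
  qed
  have K2: "K z * z = z / (1 + of_real \<rho> ^ 2 * z ^ 2) - of_real \<rho> ^ 2 * (1 / z / (1 + of_real \<rho> ^ 2 / z ^ 2))" if z: "norm z = 1" for z
  proof -
    have "z \<noteq> 0" "1 + of_real \<rho> ^ 2 / z ^ 2 \<noteq> 0" using z nz'[of z] by auto
    hence "z / (1 + of_real \<rho> ^ 2 / z ^ 2) - z = - (of_real \<rho> ^ 2 * (1 / z / (1 + of_real \<rho> ^ 2 / z ^ 2)))"
      by (simp add: divide_simps) (simp add: algebra_simps power2_eq_square)
    thus ?thesis unfolding K1[OF z] by (simp add: algebra_simps)
  qed
  have "circ_mean 1 K = circ_mean 1 (\<lambda>z. 1 / (1 + of_real \<rho> ^ 2 * z ^ 2) + 1 / (1 + of_real \<rho> ^ 2 / z ^ 2) - 1)"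
    by (rule circ_mean_cong) (simp add: K1)
  also have "\<dots> = 1"
    using c1 by (simp add: circ_mean_diff circ_mean_add continuous_on_add m1 m3 m6)
  finally show "circ_mean 1 K = 1" .
  have "circ_mean 1 (\<lambda>z. K z * z) = circ_mean 1 (\<lambda>z. z / (1 + of_real \<rho> ^ 2 * z ^ 2) - of_real \<rho> ^ 2 * (1 / z / (1 + of_real \<rho> ^ 2 / z ^ 2)))"
    by (rule circ_mean_cong) (simp add: K2)
  also have "\<dots> = circ_mean 1 (\<lambda>z. z / (1 + of_real \<rho> ^ 2 * z ^ 2)) - circ_mean 1 (\<lambda>z. of_real \<rho> ^ 2 * (1 / z / (1 + of_real \<rho> ^ 2 / z ^ 2)))"
    by (intro circ_mean_diff c1 continuous_on_mult continuous_on_const)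
  also have "\<dots> = 0" unfolding circ_mean_cmult m2 m4 by simp
  finally show "circ_mean 1 (\<lambda>z. K z * z) = 0" .
  show "1 + of_real \<rho> ^ 2 * z ^ 2 \<noteq> 0 \<and> 1 + of_real \<rho> ^ 2 / z ^ 2 \<noteq> 0" if "norm z = 1" for z :: complex
    using nz[of z] nz'[of z] that R by auto
  show "K z = of_real ((1 - \<rho> ^ 4) / norm (1 + of_real \<rho> ^ 2 * z ^ 2) ^ 2)" if "norm z = 1" for z
  proof -
    have "cnj z = 1 / z" using that by (metis complex_div_cnj div_by_1 mult_1 of_real_1 one_power2)
    hence "cnj (1 + of_real \<rho> ^ 2 * z ^ 2) = 1 + of_real \<rho> ^ 2 / z ^ 2" by (simp add: power_divide)
    hence "(1 + of_real \<rho> ^ 2 * z ^ 2) * (1 + of_real \<rho> ^ 2 / z ^ 2) = of_real (norm (1 + of_real \<rho> ^ 2 * z ^ 2) ^ 2)"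
      by (metis complex_norm_square of_real_power)
    thus ?thesis by (simp add: K_def poisson_kernel_def)
  qed
  show "continuous_on (sphere 0 1) K"
    unfolding K_def poisson_kernel_def by (intro continuous_intros; use nz nz' R in force)
qed

text \<open>The kernel times a linear function has an exactly known mean, by the two moments. After
  subtracting the linear function that agrees with g 1 at i and -i, uniform continuity handles
  neighbourhoods of these points, and smallness of the kernel handles the rest of the
  circle.\<close>

lemma poisson_kernel_limit:
  fixes F g :: "real \<Rightarrow> complex \<Rightarrow> complex"
  assumes g: "continuous_on ({a..1} \<times> sphere 0 1) (\<lambda>(\<rho>, z). g \<rho> z)" and a: "0 < a" "a < 1"
    and F: "\<And>\<rho> z. a < \<rho> \<Longrightarrow> \<rho> < 1 \<Longrightarrow> norm z = 1 \<Longrightarrow>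
       g \<rho> z = (1 + of_real \<rho> ^ 2 * z ^ 2) * (1 + of_real \<rho> ^ 2 / z ^ 2) * F \<rho> z"
  shows "((\<lambda>\<rho>. of_real (1 - \<rho> ^ 4) * circ_mean 1 (F \<rho>)) \<longlongrightarrow> (g 1 \<i> + g 1 (-\<i>)) / 2) (at_left 1)"
proof (rule tendstoI)
  fix e :: real assume e: "e > 0"
  \<comment> \<open>Interpolates g 1 at i and -i. Its mean against the kernel is its constant term,
    as the kernel has mean 1 and first moment 0.\<close>
  define L where "L = (\<lambda>z. (g 1 \<i> + g 1 (-\<i>)) / 2 + (g 1 \<i> - g 1 (-\<i>)) / (2 * \<i>) * z)"
  have L: "L \<i> = g 1 \<i>" "L (-\<i>) = g 1 (-\<i>)" by (simp_all add: L_def field_simps)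
  define h where "h = (\<lambda>\<rho> z. g \<rho> z - L z)"
  have h: "continuous_on ({a..1} \<times> sphere 0 1) (\<lambda>(\<rho>, z). h \<rho> z)"
    using g unfolding h_def L_def split_beta by (intro continuous_intros)
  have cpt: "compact ({a..1} \<times> sphere 0 1 :: (real \<times> complex) set)"
    by (intro compact_Times) auto
  have "uniformly_continuous_on ({a..1} \<times> sphere 0 1) (\<lambda>(\<rho>, z). h \<rho> z)"
    using h cpt by (rule compact_uniformly_continuous)
  then obtain d where d: "d > 0" "\<And>x x'. x \<in> {a..1} \<times> sphere 0 1 \<Longrightarrow> x' \<in> {a..1} \<times> sphere 0 1 \<Longrightarrow>
      dist x' x < d \<Longrightarrow> dist ((\<lambda>(\<rho>, z). h \<rho> z) x') ((\<lambda>(\<rho>, z). h \<rho> z) x) < e / 2"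
    unfolding uniformly_continuous_on_def using e by (metis half_gt_zero)
  have "bounded ((\<lambda>(\<rho>, z). h \<rho> z) ` ({a..1} \<times> sphere 0 1))"
    using h cpt by (intro compact_imp_bounded compact_continuous_image)
  then obtain B where B: "\<And>\<rho> z. \<rho> \<in> {a..1} \<Longrightarrow> norm z = 1 \<Longrightarrow> norm (h \<rho> z) \<le> B"
    unfolding bounded_iff by fastforce
  have B0: "B \<ge> 0" using B[of 1 1] a norm_ge_zero[of "h 1 1"] by (smt (verit) atLeastAtMost_iff norm_one)
  \<comment> \<open>Away from i and -i, |z^2 + 1| is at least d^2/4, of which passing to 1 +
    \<rho>^2 z^2 costs at most d^2/8 for \<rho> near 1. So the kernel is at most 64 (1 - \<rho>^4) /
    d^4 there, while h is at most B.\<close>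
  define C where "C = 64 * B / d ^ 4"
  have l: "((\<lambda>\<rho>. (1 - \<rho> ^ 4) * C) \<longlongrightarrow> (1 - 1 ^ 4) * C) (at_left 1)" "((\<lambda>\<rho>. 1 - \<rho> ^ 2) \<longlongrightarrow> 1 - 1 ^ 2) (at_left (1::real))"
    by (intro tendsto_intros)+
  have "\<forall>\<^sub>F \<rho> in at_left 1. (1 - \<rho> ^ 4) * C < e / 2"
    by (rule order_tendstoD(2)[OF l(1)]) (use e in simp)
  moreover have "\<forall>\<^sub>F \<rho> in at_left (1::real). 1 - \<rho> ^ 2 < d ^ 2 / 8"
    by (rule order_tendstoD(2)[OF l(2)]) (use d in simp)
  moreover have "\<forall>\<^sub>F \<rho> in at_left (1::real). max a (1 - d / 2) < \<rho>"
    using a d by (intro eventually_at_leftI[of "max a (1 - d / 2)"]) auto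
  moreover have "\<forall>\<^sub>F \<rho> in at_left (1::real). \<rho> < 1" by (simp add: eventually_at_filter)
  ultimately show "\<forall>\<^sub>F \<rho> in at_left 1. dist (of_real (1 - \<rho> ^ 4) * circ_mean 1 (F \<rho>)) ((g 1 \<i> + g 1 (-\<i>)) / 2) < e"
  proof eventually_elim
    case (elim \<rho>)
    hence \<rho>: "0 < \<rho>" "\<rho> < 1" "\<rho> \<in> {a..1}" "1 - \<rho> < d / 2" "a < \<rho>" using a by auto
    define K where "K = poisson_kernel \<rho>"
    note P = poisson_kernel_moments[OF \<rho>(1,2), folded K_def]
    have r4: "0 \<le> 1 - \<rho> ^ 4" using \<rho> by (simp add: power_le_one)
    have ReK: "Re (K z) = (1 - \<rho> ^ 4) / norm (1 + of_real \<rho> ^ 2 * z ^ 2) ^ 2" if "norm z = 1" for z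
      by (simp only: P(3)[OF that] Re_complex_of_real)
    have nK: "norm (K z) = Re (K z)" if "norm z = 1" for z
      unfolding ReK[OF that] unfolding P(3)[OF that] norm_of_real using r4 by simp
    have K0: "Re (K z) \<ge> 0" if "norm z = 1" for z using nK[OF that] by (metis norm_ge_zero)
    have bound: "norm (K z * h \<rho> z) \<le> Re (of_real (e / 2) * K z + of_real ((1 - \<rho> ^ 4) * C))" if z: "norm z = 1" for z
    proof -
      have "norm (h \<rho> z) < e / 2 \<or> Re (K z) * B \<le> (1 - \<rho> ^ 4) * C"
      proof (cases "norm (z - \<i>) < d / 2 \<or> norm (z - (-\<i>)) < d / 2")
        case True
        then obtain w where w: "w = \<i> \<or> w = -\<i>" "norm (z - w) < d / 2" by blast
        hence hw: "h 1 w = 0" "norm w = 1" using L by (auto simp: h_def)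
        have "dist (\<rho>, z) (1, w) \<le> dist \<rho> 1 + dist z w"
          unfolding dist_Pair_Pair by (rule sqrt_sum_squares_le_sum) auto
        also have "\<dots> < d" using \<rho> w by (simp add: dist_norm)
        finally have "dist (h \<rho> z) (h 1 w) < e / 2"
          using d(2)[of "(1, w)" "(\<rho>, z)"] z hw \<rho> by auto
        thus ?thesis using hw by simp
      next
        case False
        have "z ^ 2 + 1 = (z - \<i>) * (z - (-\<i>))" by (simp add: algebra_simps power2_eq_square)
        hence "norm (z ^ 2 + 1) = norm (z - \<i>) * norm (z - (-\<i>))" by (metis norm_mult)
        also have "\<dots> \<ge> d / 2 * (d / 2)" using False d by (intro mult_mono) auto
        finally have 1: "norm (z ^ 2 + 1) \<ge> d ^ 2 / 4" by (simp add: power2_eq_square)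
        have "z ^ 2 + 1 = (1 + of_real \<rho> ^ 2 * z ^ 2) + of_real (1 - \<rho> ^ 2) * z ^ 2" by (simp add: algebra_simps)
        hence "norm (z ^ 2 + 1) \<le> norm (1 + of_real \<rho> ^ 2 * z ^ 2) + norm (of_real (1 - \<rho> ^ 2) * z ^ 2)"
          by (metis norm_triangle_ineq)
        also have "norm (of_real (1 - \<rho> ^ 2) * z ^ 2) = 1 - \<rho> ^ 2"
          unfolding norm_mult norm_of_real norm_power z using \<rho> by (simp add: power_le_one)
        finally have "norm (1 + of_real \<rho> ^ 2 * z ^ 2) \<ge> d ^ 2 / 8" using 1 elim by simp
        hence "norm (1 + of_real \<rho> ^ 2 * z ^ 2) ^ 2 \<ge> (d ^ 2 / 8) ^ 2" by (intro power_mono) auto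
        hence "Re (K z) \<le> (1 - \<rho> ^ 4) / (d ^ 2 / 8) ^ 2"
          unfolding ReK[OF z] using r4 d by (intro divide_left_mono mult_pos_pos) auto
        hence "Re (K z) * B \<le> (1 - \<rho> ^ 4) / (d ^ 2 / 8) ^ 2 * B" using B0 by (rule mult_right_mono)
        also have "\<dots> = (1 - \<rho> ^ 4) * C" using d by (simp add: C_def field_simps power2_eq_square eval_nat_numeral)
        finally show ?thesis ..
      qed
      moreover have "norm (K z * h \<rho> z) \<le> Re (K z) * B"
        unfolding norm_mult nK[OF z] using B[OF \<rho>(3) z] K0[OF z] by (rule mult_left_mono)
      moreover have "norm (h \<rho> z) < e / 2 \<Longrightarrow> norm (K z * h \<rho> z) \<le> Re (K z) * (e / 2)"
        unfolding norm_mult nK[OF z] using K0[OF z] by (intro mult_left_mono) auto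
      moreover have "0 \<le> (1 - \<rho> ^ 4) * C" "0 \<le> Re (K z) * (e / 2)"
        using r4 B0 d K0[OF z] e by (auto simp: C_def)
      ultimately have "norm (K z * h \<rho> z) \<le> Re (K z) * (e / 2) + (1 - \<rho> ^ 4) * C" by linarith
      also have "\<dots> = Re (of_real (e / 2) * K z + of_real ((1 - \<rho> ^ 4) * C))"
        unfolding plus_complex.sel Re_complex_of_real by (simp only: Re_complex_of_real times_complex.sel Im_complex_of_real) simp
      finally show ?thesis .
    qed
    have hc: "continuous_on (sphere 0 1) (h \<rho>)"
    proof -
      have "continuous_on (sphere 0 1) (\<lambda>z. case (\<rho>, z) of (\<rho>, z) \<Rightarrow> h \<rho> z)"
        by (rule continuous_on_compose2[OF h]) (use \<rho> in \<open>auto intro!: continuous_intros\<close>)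
      thus ?thesis by simp
    qed
    have Lc: "continuous_on (sphere 0 1) L" unfolding L_def by (intro continuous_intros)
    have "norm (circ_mean 1 (\<lambda>z. K z * h \<rho> z)) \<le> Re (circ_mean 1 (\<lambda>z. of_real (e / 2) * K z + of_real ((1 - \<rho> ^ 4) * C)))"
      by (rule circ_mean_norm_bound) (intro continuous_intros P hc bound; assumption?)+
    also have "circ_mean 1 (\<lambda>z. of_real (e / 2) * K z + of_real ((1 - \<rho> ^ 4) * C)) = circ_mean 1 (\<lambda>z. of_real (e / 2) * K z) + circ_mean 1 (\<lambda>z. of_real ((1 - \<rho> ^ 4) * C))"
      by (intro circ_mean_add continuous_intros P)
    also have "\<dots> = of_real (e / 2 + (1 - \<rho> ^ 4) * C)"
      unfolding circ_mean_cmult P(1) by (simp add: circ_mean_def)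
    finally have 1: "norm (circ_mean 1 (\<lambda>z. K z * h \<rho> z)) < e" using elim by simp
    have "circ_mean 1 (\<lambda>z. K z * L z) = circ_mean 1 (\<lambda>z. (g 1 \<i> + g 1 (-\<i>)) / 2 * K z + (g 1 \<i> - g 1 (-\<i>)) / (2 * \<i>) * (K z * z))"
      by (intro circ_mean_cong) (simp add: L_def algebra_simps)
    also have "\<dots> = circ_mean 1 (\<lambda>z. (g 1 \<i> + g 1 (-\<i>)) / 2 * K z) + circ_mean 1 (\<lambda>z. (g 1 \<i> - g 1 (-\<i>)) / (2 * \<i>) * (K z * z))"
      by (intro circ_mean_add continuous_intros P)
    also have "\<dots> = (g 1 \<i> + g 1 (-\<i>)) / 2" unfolding circ_mean_cmult P by simp
    finally have 2: "circ_mean 1 (\<lambda>z. K z * L z) = (g 1 \<i> + g 1 (-\<i>)) / 2" .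
    have "of_real (1 - \<rho> ^ 4) * circ_mean 1 (F \<rho>) = circ_mean 1 (\<lambda>z. of_real (1 - \<rho> ^ 4) * F \<rho> z)"
      by (simp add: circ_mean_cmult)
    also have "\<dots> = circ_mean 1 (\<lambda>z. K z * h \<rho> z + K z * L z)"
    proof (rule circ_mean_cong)
      fix z :: complex assume "norm z = norm (1::complex)"
      hence z: "norm z = 1" by simp
      have "K z * h \<rho> z + K z * L z = K z * g \<rho> z" by (simp add: h_def algebra_simps)
      also have "\<dots> = of_real (1 - \<rho> ^ 4) * F \<rho> z"
        using P(4)[OF z] unfolding F[OF \<rho>(5,2) z] K_def poisson_kernel_def by simp
      finally show "of_real (1 - \<rho> ^ 4) * F \<rho> z = K z * h \<rho> z + K z * L z" by simp
    qed
    also have "\<dots> = circ_mean 1 (\<lambda>z. K z * h \<rho> z) + circ_mean 1 (\<lambda>z. K z * L z)"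
      by (intro circ_mean_add continuous_intros P hc Lc)
    finally show ?case using 1 2 by (simp add: dist_norm)
  qed
qed

section \<open>A theta function identity\<close>

definition simple_zeros :: "complex set \<Rightarrow> (complex \<Rightarrow> complex) \<Rightarrow> bool" where
  "simple_zeros S f \<longleftrightarrow> (\<forall>z\<in>S. f z = 0 \<longrightarrow> deriv f z \<noteq> 0)"

lemma simple_zeros_mult:
  assumes "open S" "f holomorphic_on S" "g holomorphic_on S" "simple_zeros S f" "simple_zeros S g"
    and "\<And>z. z \<in> S \<Longrightarrow> f z = 0 \<Longrightarrow> g z \<noteq> 0"
  shows "simple_zeros S (\<lambda>z. f z * g z)"
  unfolding simple_zeros_def
proof safe
  fix z assume z: "z \<in> S" "f z * g z = 0" "deriv (\<lambda>z. f z * g z) z = 0"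
  have "deriv (\<lambda>z. f z * g z) z = deriv f z * g z + deriv g z * f z"
    using DERIV_imp_deriv[OF DERIV_mult[OF holomorphic_derivI[OF assms(2,1) z(1)] holomorphic_derivI[OF assms(3,1) z(1)]]] .
  thus False using z assms(4,5,6) by (auto simp: simple_zeros_def)
qed

text \<open>The open set where f is nonzero would contain a ball, which is uncountable. This removes
  genericity conditions that exclude only countably many values.\<close>

lemma continuous_zero_off_countable:
  fixes f :: "complex \<Rightarrow> complex"
  assumes "continuous_on S f" "open S" "countable B" "\<And>z. z \<in> S \<Longrightarrow> z \<notin> B \<Longrightarrow> f z = 0" "z \<in> S"
  shows "f z = 0"
proof (rule ccontr)
  assume "f z \<noteq> 0"
  have "open (f -` (- {0}) \<inter> S)"
    using assms(1,2) by (intro continuous_open_preimage[of S f "- {0}", unfolded Int_commute[of S]]) auto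
  moreover have "z \<in> f -` (- {0}) \<inter> S" using assms \<open>f z \<noteq> 0\<close> by auto
  ultimately obtain e where e: "e > 0" "ball z e \<subseteq> f -` (- {0}) \<inter> S" by (meson open_contains_ball)
  hence "ball z e \<subseteq> B" using assms(4) by blast
  hence "countable (ball z e)" using assms(3) countable_subset by blast
  thus False using uncountable_ball[OF e(1), of z] by simp
qed

text \<open>Exhaustion by the closed sets |z| >= 1/(n+1). The countability of the zero set of a
  holomorphic function is applied on this domain.\<close>

lemma fsigma_punctured_plane: "fsigma (- {0::complex})"
proof -
  have "- {0::complex} = (\<Union>n. {z. inverse (real (Suc n)) \<le> norm z})"
  proof safe
    fix z :: complex assume "z \<notin> (\<Union>n. {z. inverse (real (Suc n)) \<le> norm z})"
    hence "\<And>n. norm z < inverse (real (Suc n))" by (auto simp: not_le)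
    thus "z = 0" using reals_Archimedean[of "norm z"] by (meson less_asym zero_less_norm_iff)
  qed auto
  moreover have "closed {z::complex. inverse (real (Suc n)) \<le> norm z}" for n
    by (intro closed_Collect_le continuous_intros)
  ultimately show ?thesis using fsigma.intros[of "\<lambda>n. {z::complex. inverse (real (Suc n)) \<le> norm z}"] by simp
qed

context
  fixes P :: complex
  assumes P: "norm P < 1" "P \<noteq> 0"
begin

abbreviation (input) T :: "complex \<Rightarrow> complex" where "T z \<equiv> qtheta z P"

lemma holomorphic_qtheta_comp:
  assumes "g holomorphic_on A" "\<And>z. z \<in> A \<Longrightarrow> g z \<noteq> 0"
  shows "(\<lambda>z. T (g z)) holomorphic_on A"
proof -
  have "g ` A \<subseteq> - {0}" using assms(2) by auto
  from holomorphic_on_compose_gen[OF assms(1) holomorphic_qtheta[OF P] this]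
  show ?thesis by (simp add: o_def)
qed

lemma continuous_qtheta_comp:
  assumes "continuous_on A g" "\<And>z. z \<in> A \<Longrightarrow> g z \<noteq> 0"
  shows "continuous_on A (\<lambda>z. T (g z))"
  by (rule continuous_on_compose2[OF holomorphic_on_imp_continuous_on[OF holomorphic_qtheta[OF P]] assms(1)])
     (use assms(2) in auto)

lemma simple_zeros_qtheta_comp:
  assumes "open S" "g holomorphic_on S" "\<And>z. z \<in> S \<Longrightarrow> g z \<noteq> 0 \<and> deriv g z \<noteq> 0"
  shows "simple_zeros S (\<lambda>z. T (g z))"
  unfolding simple_zeros_def
proof safe
  fix z assume z: "z \<in> S" "T (g z) = 0" "deriv (\<lambda>z. T (g z)) z = 0"
  have op: "open (- {0::complex})" by auto
  have "(T has_field_derivative deriv T (g z)) (at (g z))"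
    by (rule holomorphic_derivI[OF holomorphic_qtheta[OF P] op]) (use assms z in auto)
  from DERIV_imp_deriv[OF DERIV_chain2[OF this holomorphic_derivI[OF assms(2,1) z(1)]]]
  have "deriv (\<lambda>z. T (g z)) z = deriv T (g z) * deriv g z" .
  thus False using z assms(3) deriv_qtheta_nonzero[OF P, of "g z"] by auto
qed

lemma qtheta_1: "T 1 = 0"
  using qtheta_eq_0_iff[OF P, of 1] by (auto intro!: exI[of _ 0])

lemma qtheta_div_P: "z \<noteq> 0 \<Longrightarrow> T (z / P) = - (z / P) * T z"
  using qtheta_mult_p[OF P, of "z / P"] P by (simp add: field_simps)

lemma qtheta_pair_shift:
  assumes "z \<noteq> 0" "y \<noteq> 0"
  shows "T (y * (P * z)) * T (y / (P * z)) = T (y * z) * T (y / z) / (P * z ^ 2)"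
proof -
  have 1: "T (y * (P * z)) = - T (y * z) / (y * z)"
    using qtheta_mult_p[OF P, of "y * z"] assms by (simp add: mult_ac)
  have 2: "T (y / (P * z)) = - (y / z / P) * T (y / z)"
    using qtheta_div_P[of "y / z"] assms P by (simp add: mult_ac)
  show ?thesis unfolding 1 2 using assms P by (simp add: field_simps power2_eq_square)
qed

text \<open>
  The difference of both sides, divided by \<open>z\<^sup>2 T (z\<^sup>2) T (x z) T (x / z)\<close>, is elliptic, and the zeros of the denominator are
  cancelled, so it is constant; the choice \<open>z = y\<close> makes it vanish. Genericity keeps these zeros simple.
\<close>

lemma theta_identity_generic:
  fixes x y a b c d :: complex
  assumes prod: "x * y * a * b * c * d = 1"
    and gen: "T (x ^ 2) \<noteq> 0" "T (y ^ 2) \<noteq> 0" "T (x * y) \<noteq> 0" "T (x / y) \<noteq> 0"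
  defines "N \<equiv> (\<lambda>z. T (x * z) * T (y * z) * T (a * z) * T (b * z) * T (c * z) * T (d * z))"
  assumes z: "z \<noteq> 0"
  shows "x ^ 2 * y * T (y / x) * (N z - z ^ 6 * N (1 / z)) =
    z ^ 2 * T (z ^ 2) * (y * (T (x * a) * T (x * b) * T (x * c) * T (x * d)) * (T (y * z) * T (y / z))
      - x * (T (y * a) * T (y * b) * T (y * c) * T (y * d)) * (T (x * z) * T (x / z)))"
proof -
  have nz: "x \<noteq> 0" "y \<noteq> 0" "a \<noteq> 0" "b \<noteq> 0" "c \<noteq> 0" "d \<noteq> 0"
    using prod by auto
  define A where "A = y * (T (x * a) * T (x * b) * T (x * c) * T (x * d))"
  define B where "B = x * (T (y * a) * T (y * b) * T (y * c) * T (y * d))"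
  \<comment> \<open>Both W and D take the factor z^(-6) under z -> P z, so their quotient is
    elliptic.\<close>
  define W where "W = (\<lambda>z. x ^ 2 * y * T (y / x) * (N z - z ^ 6 * N (1 / z)) -
    z ^ 2 * T (z ^ 2) * (A * (T (y * z) * T (y / z)) - B * (T (x * z) * T (x / z))))"
  define D where "D = (\<lambda>z. z ^ 2 * T (z ^ 2) * (T (x * z) * T (x / z)))"
  have NP: "N (P * z) = N z / z ^ 6" if "z \<noteq> 0" for z
  proof -
    have *: "T (u * (P * z)) = - T (u * z) / (u * z)" if "u \<noteq> 0" for u
      using qtheta_mult_p[OF P, of "u * z"] \<open>z \<noteq> 0\<close> that by (simp add: mult_ac)
    have "N (P * z) = N z / (x * y * a * b * c * d * z ^ 6)"
      unfolding N_def *[OF nz(1)] *[OF nz(2)] *[OF nz(3)] *[OF nz(4)] *[OF nz(5)] *[OF nz(6)]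
      using nz that by (simp add: field_simps eval_nat_numeral)
    thus ?thesis using prod by simp
  qed
  have TP: "(P * z) ^ 2 * T ((P * z) ^ 2) = P * (z ^ 2 * T (z ^ 2)) / z ^ 4" if "z \<noteq> 0" for z
  proof -
    have "T ((P * z) ^ 2) = T (P * (P * z ^ 2))" by (simp add: power2_eq_square mult_ac)
    also have "\<dots> = T (z ^ 2) / (P * z ^ 2 * z ^ 2)"
      using that P qtheta_mult_p[OF P, of "P * z ^ 2"] qtheta_mult_p[OF P, of "z ^ 2"] by (simp add: field_simps)
    finally show ?thesis using that P by (simp add: field_simps eval_nat_numeral)
  qed
  have WP: "W (P * z) = W z / z ^ 6" if "z \<noteq> 0" for z
  proof -
    have "N (1 / z) = N (P * (1 / (P * z)))" using P by simp
    also have "\<dots> = N (1 / (P * z)) * (P * z) ^ 6"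
      using NP[of "1 / (P * z)"] that P by (simp add: field_simps)
    finally have n: "(P * z) ^ 6 * N (1 / (P * z)) = N (1 / z)" by simp
    show ?thesis
      unfolding W_def n TP[OF that] qtheta_pair_shift[OF that nz(1)] qtheta_pair_shift[OF that nz(2)] NP[OF that]
      using that P by (simp add: field_simps eval_nat_numeral)
  qed
  have DP: "D (P * z) = D z / z ^ 6" if "z \<noteq> 0" for z
    unfolding D_def TP[OF that] qtheta_pair_shift[OF that nz(1)]
    using that P by (simp add: field_simps eval_nat_numeral)
  have Winv: "W (1 / z) = - W z / z ^ 6" if "z \<noteq> 0" for z
  proof -
    have "T ((1 / z) ^ 2) = - T (z ^ 2) / z ^ 2"
      using qtheta_inverse[OF P, of "z ^ 2"] that by (simp add: power_divide inverse_eq_divide)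
    thus ?thesis unfolding W_def using that by (simp add: field_simps eval_nat_numeral)
  qed
  have W0: "W (P powi k * z) = 0 \<longleftrightarrow> W z = 0" if "z \<noteq> 0" for k z
  proof (induction k rule: int_induct[of _ 0])
    case (step1 i)
    have eq: "P powi (i + 1) * z = P * (P powi i * z)" using P by (simp add: power_int_add)
    show ?case unfolding eq using WP[of "P powi i * z"] step1 that P by simp
  next
    case (step2 i)
    have eq: "P * (P powi (i - 1) * z) = P powi i * z" using P by (simp add: power_int_diff)
    show ?case using WP[of "P powi (i - 1) * z"] step2 that P unfolding eq by simp
  qed auto
  have Wx: "W x = 0"
    unfolding W_def A_def N_def using nz by (simp add: qtheta_1 mult_ac power2_eq_square)
  have txy: "T (x / y) = - (x / y) * T (y / x)"
    using qtheta_inverse[OF P, of "y / x"] nz by simp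
  have Wy: "W y = 0"
    unfolding W_def B_def N_def txy using nz by (simp add: qtheta_1 txy mult_ac power2_eq_square)
  \<comment> \<open>At these points 1/w equals w up to a power of P, so N w - w^6 N(1/w) vanishes
    together with T (w^2).\<close>
  have Wsq: "W w = 0" if "w \<noteq> 0" "w ^ 2 = 1 \<or> w ^ 2 = P" for w
  proof -
    have "N w = w ^ 6 * N (1 / w)"
    proof (cases "w ^ 2 = 1")
      case True
      hence "1 / w = w" using that by (simp add: field_simps power2_eq_square)
      moreover have "w ^ 6 = (w ^ 2) ^ 3" by simp
      ultimately show ?thesis using True by simp
    next
      case False
      hence "P * (1 / w) = w" using that by (auto simp: field_simps power2_eq_square)
      thus ?thesis using NP[of "1 / w"] that by (simp add: field_simps)
    qed
    moreover have "T (w ^ 2) = 0"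
      using that qtheta_1 qtheta_mult_p[OF P, of 1] by auto
    ultimately show ?thesis unfolding W_def by simp
  qed
  have root: "\<exists>k. u = P powi k" if "T u = 0" "u \<noteq> 0" for u
    using qtheta_eq_0_iff[OF P that(2)] that(1) by blast
  have zero: "W w = 0" if "w \<noteq> 0" "D w = 0" for w
  proof -
    from that have "T (w ^ 2) = 0 \<or> T (x * w) = 0 \<or> T (x / w) = 0" unfolding D_def by auto
    then consider "T (w ^ 2) = 0" | "T (x * w) = 0" | "T (x / w) = 0" by blast
    thus ?thesis
    proof cases
      case 1
      have "w ^ 2 \<noteq> 0" using that by simp
      with root[OF 1] obtain k where k: "w ^ 2 = P powi k" by blast
      \<comment> \<open>Halving the exponent reduces w^2 = P^k to w^2 = 1 or w^2 = P; the equation W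
        = 0 is unaffected by powers of P.\<close>
      define j where "j = - (k div 2)"
      have "k + (j + j) = 0 \<or> k + (j + j) = 1" unfolding j_def by presburger
      moreover have "(P powi j * w) ^ 2 = w ^ 2 * (P powi j * P powi j)"
        by (simp add: power2_eq_square mult_ac)
      hence "(P powi j * w) ^ 2 = P powi (k + (j + j))"
        unfolding k power_int_add[OF disjI1[OF P(2)]] .
      ultimately have "(P powi j * w) ^ 2 = 1 \<or> (P powi j * w) ^ 2 = P" by auto
      hence "W (P powi j * w) = 0" using that P by (intro Wsq) auto
      thus ?thesis using W0 that by blast
    next
      case 2
      have "x * w \<noteq> 0" using that nz by simp
      with root[OF 2] obtain k where "x * w = P powi k" by blast
      hence "w = P powi k * (1 / x)" using nz by (simp add: field_simps)
      moreover have "W (1 / x) = 0" using Winv[of x] Wx nz by simp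
      ultimately show ?thesis using W0[of "1 / x" k] nz by simp
    next
      case 3
      have "x / w \<noteq> 0" using that nz by simp
      with root[OF 3] obtain k where "x / w = P powi k" by blast
      hence "w = P powi (- k) * x" using nz that P by (simp add: field_simps power_int_minus)
      thus ?thesis using W0[of x "- k"] Wx nz by simp
    qed
  qed
  have op: "open (- {0::complex})" by auto
  have Nhol: "N holomorphic_on - {0}" "(\<lambda>z. N (1 / z)) holomorphic_on - {0}"
    unfolding N_def using nz by (auto intro!: holomorphic_intros holomorphic_qtheta_comp)
  have Whol: "W holomorphic_on - {0}"
    unfolding W_def using nz by (auto intro!: holomorphic_intros holomorphic_qtheta_comp Nhol)
  have hol: "(\<lambda>z. z ^ 2 * T (z ^ 2)) holomorphic_on - {0}" "(\<lambda>z. T (x * z)) holomorphic_on - {0}"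
    "(\<lambda>z. T (x / z)) holomorphic_on - {0}" "(\<lambda>z. T (z ^ 2)) holomorphic_on - {0}" "(\<lambda>z::complex. z ^ 2) holomorphic_on - {0}"
    "(\<lambda>z. T (x * z) * T (x / z)) holomorphic_on - {0}"
    using nz by (auto intro!: holomorphic_intros holomorphic_qtheta_comp)
  have Dhol: "D holomorphic_on - {0}" unfolding D_def by (intro holomorphic_on_mult hol)
  \<comment> \<open>A common zero of two factors of D would make x^2 a power of P, which T (x^2)
    \<noteq> 0 forbids.\<close>
  have incompat: "T (x ^ 2) = 0" if "x ^ 2 = P powi k" for k
    using qtheta_eq_0_iff[OF P, of "x ^ 2"] nz(1) that by (metis power_not_zero)
  have Dsimple: "simple_zeros (- {0}) D"
    unfolding D_def
  proof (intro simple_zeros_mult op hol)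
    show "simple_zeros (- {0}) (\<lambda>z. z ^ 2)" by (auto simp: simple_zeros_def)
    have d1: "deriv (\<lambda>z. z ^ 2) w = 2 * w" for w :: complex
      by (rule DERIV_imp_deriv) (auto intro!: derivative_eq_intros)
    show "simple_zeros (- {0}) (\<lambda>z. T (z ^ 2))"
      by (rule simple_zeros_qtheta_comp) (auto intro!: holomorphic_intros simp: d1)
    have d2: "deriv (\<lambda>z. x * z) w = x" for w
      by (rule DERIV_imp_deriv) (auto intro!: derivative_eq_intros)
    show "simple_zeros (- {0}) (\<lambda>z. T (x * z))"
      by (rule simple_zeros_qtheta_comp) (use nz in \<open>auto intro!: holomorphic_intros simp: d2\<close>)
    have d3: "deriv (\<lambda>z. x / z) w = - x / w ^ 2" if "w \<noteq> 0" for w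
      by (rule DERIV_imp_deriv) (use that in \<open>auto intro!: derivative_eq_intros simp: power2_eq_square\<close>)
    show "simple_zeros (- {0}) (\<lambda>z. T (x / z))"
      by (rule simple_zeros_qtheta_comp) (use nz in \<open>auto intro!: holomorphic_intros simp: d3\<close>)
    fix w :: complex assume w: "w \<in> - {0}"
    show "T (w ^ 2) \<noteq> 0" if "w ^ 2 = 0" using that w by simp
    show "T (x / w) \<noteq> 0" if tx: "T (x * w) = 0"
    proof
      assume "T (x / w) = 0"
      moreover have "x / w \<noteq> 0" "x * w \<noteq> 0" using w nz by auto
      ultimately obtain j k where j: "x / w = P powi j" and k: "x * w = P powi k"
        using root tx by meson
      have "x ^ 2 = (x * w) * (x / w)" using w by (simp add: power2_eq_square)
      also have "\<dots> = P powi (k + j)" unfolding j k using P by (simp add: power_int_add)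
      finally show False using incompat gen by blast
    qed
    show "T (x * w) * T (x / w) \<noteq> 0" if "w ^ 2 * T (w ^ 2) = 0"
    proof
      assume "T (x * w) * T (x / w) = 0"
      have nz': "w ^ 2 \<noteq> 0" "x * w \<noteq> 0" "x / w \<noteq> 0" using w nz by auto
      have "T (w ^ 2) = 0" using that nz' by simp
      with root nz' obtain k where k: "w ^ 2 = P powi k" by blast
      from \<open>T (x * w) * T (x / w) = 0\<close> have "T (x * w) = 0 \<or> T (x / w) = 0" by simp
      then obtain u j where u: "x * u = P powi j" "u = w \<or> u = 1 / w"
      proof
        assume "T (x * w) = 0"
        with root nz' obtain j where "x * w = P powi j" by blast
        thus ?thesis by (intro that[of w j]) auto
      next
        assume "T (x / w) = 0"
        with root nz' obtain j where "x / w = P powi j" by blast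
        thus ?thesis by (intro that[of "1 / w" j]) auto
      qed
      have "u ^ 2 = P powi k \<or> u ^ 2 = P powi (- k)" "u \<noteq> 0"
        using u k w by (auto simp: power_divide power_int_minus inverse_eq_divide)
      then obtain l where l: "u ^ 2 = P powi l" by blast
      have "x ^ 2 = (x * u) ^ 2 / u ^ 2" using \<open>u \<noteq> 0\<close> by (simp add: power_mult_distrib)
      also have "\<dots> = P powi (j + j - l)"
        unfolding u(1) l unfolding power2_eq_square power_int_add[OF disjI1[OF P(2)]] power_int_diff[OF disjI1[OF P(2)]]
        by (rule refl)
      finally show False using incompat gen by blast
    qed
  qed
  obtain Q where Q: "Q holomorphic_on - {0}" "\<And>z. z \<in> - {0} \<Longrightarrow> W z = D z * Q z"
    using holomorphic_divide_simple_zeros[OF op Whol Dhol] zero Dsimple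
    unfolding simple_zeros_def by (metis ComplD singletonI)
  have Qnz: "Q (P * w) = Q w" if "w \<noteq> 0" "D w \<noteq> 0" for w
    using Q(2)[of w] Q(2)[of "P * w"] WP[of w] DP[of w] that P by (auto simp: field_simps)
  have Qper: "Q (P * w) = Q w" if "w \<noteq> 0" for w
  proof -
    \<comment> \<open>At zeros of D the periodicity of Q follows by continuity, since these zeros
      are countable.\<close>
    have "Q (P * w) - Q w = 0"
    proof (rule continuous_zero_off_countable[where S = "- {0}" and f = "\<lambda>w. Q (P * w) - Q w" and B = "{w \<in> - {0}. D w = 0}" and z = w])
      have c1: "continuous_on (- {0}) Q" using Q(1) by (rule holomorphic_on_imp_continuous_on)
      have c2: "continuous_on (- {0}) (\<lambda>w. Q (P * w))"
        by (rule continuous_on_compose2[OF c1]) (use P in \<open>auto intro!: continuous_intros\<close>)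
      show "continuous_on (- {0}) (\<lambda>w. Q (P * w) - Q w)"
        using c2 c1 by (rule continuous_on_diff)
      show "countable {w \<in> - {0}. D w = 0}"
      proof -
        have Dy: "D y \<noteq> 0" unfolding D_def using gen nz by simp
        have "connected (- {0::complex})" using connected_punctured_universe[of "0::complex"] by simp
        moreover have "D 1 = 0" unfolding D_def by (simp add: qtheta_1)
        hence "\<not> D constant_on - {0}" using Dy nz unfolding constant_on_def by (metis ComplI singletonD zero_neq_one)
        ultimately show ?thesis by (intro holomorphic_countable_zeros Dhol op fsigma_punctured_plane)
      qed
    qed (use Qnz that in auto)
    thus ?thesis by simp
  qed
  \<comment> \<open>Evaluation at y determines the constant: W vanishes there and D does
    not.\<close>
  have "Q z = Q y" by (rule elliptic_constant[OF Q(1) P Qper z nz(2)])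
  moreover have "D y \<noteq> 0" unfolding D_def using gen nz by simp
  hence "Q y = 0" using Q(2)[of y] Wy nz by auto
  ultimately have "W z = 0" using Q(2)[of z] z by simp
  thus ?thesis unfolding W_def A_def B_def by simp
qed

text \<open>Solving the product condition for d makes x and y independent variables. The excluded
  values are countable, so continuity removes the conditions, first in x for generic y and then in
  y.\<close>

lemma theta_identity:
  fixes x y a b c d z :: complex
  assumes prod: "x * y * a * b * c * d = 1" and z: "z \<noteq> 0"
  shows "x ^ 2 * y * T (y / x) * (T (x * z) * T (y * z) * T (a * z) * T (b * z) * T (c * z) * T (d * z)
      - z ^ 6 * (T (x * (1 / z)) * T (y * (1 / z)) * T (a * (1 / z)) * T (b * (1 / z)) * T (c * (1 / z)) * T (d * (1 / z)))) =
    z ^ 2 * T (z ^ 2) * (y * (T (x * a) * T (x * b) * T (x * c) * T (x * d)) * (T (y * z) * T (y / z))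
      - x * (T (y * a) * T (y * b) * T (y * c) * T (y * d)) * (T (x * z) * T (x / z)))"
proof -
  have nz: "x \<noteq> 0" "y \<noteq> 0" "a \<noteq> 0" "b \<noteq> 0" "c \<noteq> 0"
    using prod by auto
  define e where "e = (\<lambda>x y. 1 / (x * y * a * b * c))"
  have d: "d = e x y" using prod nz by (simp add: e_def field_simps)
  define \<Phi> where "\<Phi> = (\<lambda>x y. x ^ 2 * y * T (y / x) * (T (x * z) * T (y * z) * T (a * z) * T (b * z) * T (c * z) * T (e x y * z)
      - z ^ 6 * (T (x * (1 / z)) * T (y * (1 / z)) * T (a * (1 / z)) * T (b * (1 / z)) * T (c * (1 / z)) * T (e x y * (1 / z)))) -
    z ^ 2 * T (z ^ 2) * (y * (T (x * a) * T (x * b) * T (x * c) * T (x * e x y)) * (T (y * z) * T (y / z))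
      - x * (T (y * a) * T (y * b) * T (y * c) * T (y * e x y)) * (T (x * z) * T (x / z))))"
  define bad where "bad = {w. T (w ^ 2) = 0 \<and> w \<noteq> 0}"
  define bad2 where "bad2 = (\<lambda>y. {x. x \<noteq> 0 \<and> (T (x * y) = 0 \<or> T (x / y) = 0)})"
  have cbad: "countable bad"
  proof -
    define R where "R = (\<lambda>k::int. {w. w ^ 2 = P powi k})"
    have "finite (R k)" for k
    proof (cases "\<exists>u. u \<in> R k")
      case True
      then obtain u where "u \<in> R k" by blast
      hence "w = u \<or> w = - u" if "w \<in> R k" for w
        using that power2_eq_iff[of w u] by (simp add: R_def)
      hence "R k \<subseteq> {u, - u}" by blast
      thus ?thesis using finite_subset by blast
    qed auto
    hence "countable (\<Union>k. R k)" by (intro countable_UN) (auto intro: countable_finite)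
    moreover have "bad \<subseteq> (\<Union>k. R k)" unfolding bad_def R_def using qtheta_eq_0_iff[OF P] by auto
    ultimately show ?thesis using countable_subset by blast
  qed
  have cbad2: "countable (bad2 y)" if "y \<noteq> 0" for y
  proof -
    have "bad2 y \<subseteq> range (\<lambda>k::int. P powi k / y) \<union> range (\<lambda>k::int. P powi k * y)"
      unfolding bad2_def using qtheta_eq_0_iff[OF P] that by (auto simp: image_iff field_simps)
    moreover have "countable (range (\<lambda>k::int. P powi k / y) \<union> range (\<lambda>k::int. P powi k * y))" by auto
    ultimately show ?thesis using countable_subset by blast
  qed
  have cont1: "continuous_on (- {0}) (\<lambda>x. \<Phi> x y)" if "y \<noteq> 0" for y
    unfolding \<Phi>_def e_def using nz z that
    by (intro continuous_intros continuous_qtheta_comp) auto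
  have cont2: "continuous_on (- {0}) (\<lambda>y. \<Phi> x y)" if "x \<noteq> 0" for x
    unfolding \<Phi>_def e_def using nz z that
    by (intro continuous_intros continuous_qtheta_comp) auto
  have op: "open (- {0::complex})" by auto
  have gen: "\<Phi> x y = 0" if "x \<noteq> 0" "y \<noteq> 0" "y \<notin> bad" "x \<notin> bad" "x \<notin> bad2 y" for x y
  proof -
    have "x * y * a * b * c * e x y = 1" using that nz by (simp add: e_def)
    from theta_identity_generic[OF this _ _ _ _ z] show ?thesis
      unfolding \<Phi>_def using that by (simp add: bad_def bad2_def)
  qed
  have "\<Phi> x y = 0" if "x \<noteq> 0" "y \<noteq> 0" "y \<notin> bad" for x y
    by (rule continuous_zero_off_countable[OF cont1[OF that(2)] op, where B = "bad \<union> bad2 y" and z = x])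
       (use gen that cbad cbad2 in auto)
  hence "\<Phi> x y = 0"
    by (intro continuous_zero_off_countable[OF cont2[OF nz(1)] op cbad, where z = y]) (use nz in auto)
  thus ?thesis unfolding \<Phi>_def d by simp
qed

end

text \<open>For l = lp, a logarithm of the monomial prefactor of \<open>Th (exp s) k\<close>; k is
  complex so that exponents can be compared as polynomials.\<close>

definition theta_exponent :: "complex \<Rightarrow> complex \<Rightarrow> complex \<Rightarrow> complex" where
  "theta_exponent l k s = k * (s + \<i> * of_real pi) + k * (k - 1) / 2 * l"

section \<open>The theta identity for the multipliers of the q-shift\<close>

context rarefied
begin

lemma Th_exp': "Th (exp s) k = exp (theta_exponent lp (of_int k) s) * qtheta (exp (s + of_int k * lp)) (p ^ r)"
  unfolding Th_exp theta_exponent_def by simp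

text \<open>With X_i = t_i p^(n_i + e/2) and Z = z p^(m + e/2) the theta arguments become X_i Z, X_i
  / Z, X_i X_j, X_2 / X_1 and Z^2, and the balancing conditions say that the X_i have product 1. So
  \<open>theta_identity\<close> with base p^r applies, and the monomials combine into one common
  factor.\<close>

lemma Th_identity:
  fixes t1 t2 t3 t4 t5 t6 z :: complex and n1 n2 n3 n4 n5 n6 e m :: int
  assumes prod: "t1 * t2 * t3 * t4 * t5 * t6 = p" and sum: "n1 + n2 + n3 + n4 + n5 + n6 + 3 * e = - 1"
    and z: "z \<noteq> 0"
  shows "t1 * Th (t2 / t1) (n2 - n1) * (Th (t1 * z) (n1 + e + m) * Th (t2 * z) (n2 + e + m) * Th (t3 * z) (n3 + e + m)
        * Th (t4 * z) (n4 + e + m) * Th (t5 * z) (n5 + e + m) * Th (t6 * z) (n6 + e + m)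
      - z ^ 4 * (Th (t1 / z) (n1 - m) * Th (t2 / z) (n2 - m) * Th (t3 / z) (n3 - m)
        * Th (t4 / z) (n4 - m) * Th (t5 / z) (n5 - m) * Th (t6 / z) (n6 - m))) =
    z * Th (z ^ 2) (2 * m + e) *
     (Th (t1 * t3) (n1 + n3 + e) * Th (t1 * t4) (n1 + n4 + e) * Th (t1 * t5) (n1 + n5 + e) * Th (t1 * t6) (n1 + n6 + e)
        * (Th (t2 * z) (n2 + e + m) * Th (t2 / z) (n2 - m))
    - Th (t2 * t3) (n2 + n3 + e) * Th (t2 * t4) (n2 + n4 + e) * Th (t2 * t5) (n2 + n5 + e) * Th (t2 * t6) (n2 + n6 + e)
        * (Th (t1 * z) (n1 + e + m) * Th (t1 / z) (n1 - m)))"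
proof -
  have nz: "t1 \<noteq> 0" "t2 \<noteq> 0" "t3 \<noteq> 0" "t4 \<noteq> 0" "t5 \<noteq> 0" "t6 \<noteq> 0"
    using prod p0 by auto
  define s1 s2 s3 s4 s5 \<zeta> where "s1 = Ln t1" "s2 = Ln t2" "s3 = Ln t3" "s4 = Ln t4" "s5 = Ln t5" "\<zeta> = Ln z"
  define s6 where "s6 = lp - s1 - s2 - s3 - s4 - s5"
  have t: "t1 = exp s1" "t2 = exp s2" "t3 = exp s3" "t4 = exp s4" "t5 = exp s5" "z = exp \<zeta>"
    using nz z by (simp_all add: s1_s2_s3_s4_s5_\<zeta>_def)
  have t6: "t6 = exp s6"
    using prod nz unfolding s6_def exp_diff p_exp t[symmetric] by (simp add: field_simps)
  define I where "I = \<i> * complex_of_real pi"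
  define M E :: complex where "M = of_int m" "E = of_int e"
  define N1 N2 N3 N4 N5 N6 :: complex where "N1 = of_int n1" "N2 = of_int n2" "N3 = of_int n3" "N4 = of_int n4" "N5 = of_int n5" "N6 = of_int n6"
  note defs = M_E_def N1_N2_N3_N4_N5_N6_def
  have N6: "N6 = - 1 - 3 * E - N1 - N2 - N3 - N4 - N5"
  proof -
    have "n6 = - 1 - 3 * e - n1 - n2 - n3 - n4 - n5" using sum by simp
    thus ?thesis unfolding defs by simp
  qed
  let ?T = "\<lambda>x. qtheta x (p ^ r)"
  \<comment> \<open>Half-integral powers of p are taken with the fixed logarithm lp.\<close>
  define X where "X = (\<lambda>s N. exp (s + (N + E / 2) * lp))"
  define Z where "Z = exp (\<zeta> + (M + E / 2) * lp)"
  have plus: "Th (exp s * z) (n + e + m) = exp (theta_exponent lp (of_int n + E + M) (s + \<zeta>)) * ?T (X s (of_int n) * Z)" for s n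
  proof -
    have "exp s * z = exp (s + \<zeta>)" by (simp add: t exp_add)
    moreover have "exp (s + \<zeta> + of_int (n + e + m) * lp) = X s (of_int n) * Z"
      unfolding X_def Z_def exp_add[symmetric] by (rule arg_cong[where f = exp]) (simp add: defs field_simps)
    ultimately show ?thesis using Th_exp'[of "s + \<zeta>" "n + e + m"] by (simp add: defs)
  qed
  have minus: "Th (exp s / z) (n - m) = exp (theta_exponent lp (of_int n - M) (s - \<zeta>)) * ?T (X s (of_int n) * (1 / Z))" for s n
  proof -
    have "exp s / z = exp (s - \<zeta>)" by (simp add: t exp_diff)
    moreover have "exp (s - \<zeta> + of_int (n - m) * lp) = X s (of_int n) * (1 / Z)"
      unfolding X_def Z_def inverse_eq_divide[symmetric] exp_minus[symmetric] exp_add[symmetric]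
      by (rule arg_cong[where f = exp]) (simp add: defs field_simps)
    ultimately show ?thesis using Th_exp'[of "s - \<zeta>" "n - m"] by (simp add: defs)
  qed
  have pair: "Th (exp s * exp s') (n + n' + e) = exp (theta_exponent lp (of_int n + of_int n' + E) (s + s')) * ?T (X s (of_int n) * X s' (of_int n'))" for s s' n n'
  proof -
    have "exp (s + s' + of_int (n + n' + e) * lp) = X s (of_int n) * X s' (of_int n')"
      unfolding X_def exp_add[symmetric] by (rule arg_cong[where f = exp]) (simp add: defs field_simps)
    thus ?thesis using Th_exp'[of "s + s'" "n + n' + e"] by (simp add: defs exp_add)
  qed
  have quot: "Th (exp s / exp s') (n - n') = exp (theta_exponent lp (of_int n - of_int n') (s - s')) * ?T (X s (of_int n) / X s' (of_int n'))" for s s' n n'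
  proof -
    have "exp (s - s' + of_int (n - n') * lp) = X s (of_int n) / X s' (of_int n')"
      unfolding X_def exp_diff[symmetric] by (rule arg_cong[where f = exp]) (simp add: defs field_simps)
    thus ?thesis using Th_exp'[of "s - s'" "n - n'"] by (simp add: defs exp_diff)
  qed
  have square: "Th (z ^ 2) (2 * m + e) = exp (theta_exponent lp (2 * M + E) (2 * \<zeta>)) * ?T (Z ^ 2)"
  proof -
    have "z ^ 2 = exp (2 * \<zeta>)" by (simp add: t exp_double)
    moreover have "exp (2 * \<zeta> + of_int (2 * m + e) * lp) = Z ^ 2"
      unfolding Z_def exp_double[symmetric] by (rule arg_cong[where f = exp]) (simp add: defs field_simps)
    ultimately show ?thesis using Th_exp'[of "2 * \<zeta>" "2 * m + e"] by (simp add: defs)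
  qed
  define X1 X2 X3 X4 X5 X6 where "X1 = X s1 N1" "X2 = X s2 N2" "X3 = X s3 N3" "X4 = X s4 N4" "X5 = X s5 N5" "X6 = X s6 N6"
  note Xs = X1_X2_X3_X4_X5_X6_def
  have Xprod: "X1 * X2 * X3 * X4 * X5 * X6 = 1"
    unfolding Xs X_def N6 s6_def exp_add[symmetric] by (simp add: field_simps)
  have Z0: "Z \<noteq> 0" by (simp add: Z_def)
  note TI = theta_identity[OF pr Xprod Z0]
  \<comment> \<open>The exponent of the prefactor of the first product, with the monomial X1^2 X2 of
    the theta identity divided out. The other three products lead to the same K up to multiples of 2
    pi i, which are recorded as integers.\<close>
  define \<kappa> where "\<kappa> = s1 + theta_exponent lp (N2 - N1) (s2 - s1)
    + (theta_exponent lp (N1 + E + M) (s1 + \<zeta>) + theta_exponent lp (N2 + E + M) (s2 + \<zeta>) + theta_exponent lp (N3 + E + M) (s3 + \<zeta>)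
    + theta_exponent lp (N4 + E + M) (s4 + \<zeta>) + theta_exponent lp (N5 + E + M) (s5 + \<zeta>) + theta_exponent lp (N6 + E + M) (s6 + \<zeta>))
    - 2 * (s1 + (N1 + E / 2) * lp) - (s2 + (N2 + E / 2) * lp)"
  define K where "K = exp \<kappa>"
  have X1': "X1 = exp (s1 + (N1 + E / 2) * lp)" and X2': "X2 = exp (s2 + (N2 + E / 2) * lp)"
    by (simp_all add: Xs X_def)
  have E1: "exp s1 * exp (theta_exponent lp (N2 - N1) (s2 - s1))
    * (exp (theta_exponent lp (N1 + E + M) (s1 + \<zeta>)) * exp (theta_exponent lp (N2 + E + M) (s2 + \<zeta>)) * exp (theta_exponent lp (N3 + E + M) (s3 + \<zeta>))
    * exp (theta_exponent lp (N4 + E + M) (s4 + \<zeta>)) * exp (theta_exponent lp (N5 + E + M) (s5 + \<zeta>)) * exp (theta_exponent lp (N6 + E + M) (s6 + \<zeta>)))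
    = K * (X1 ^ 2 * X2)"
    unfolding K_def X1' X2' exp_double[symmetric] exp_add[symmetric] by (rule arg_cong[where f = exp]) (simp add: \<kappa>_def)
  have E1': "exp s1 * exp (theta_exponent lp (N2 - N1) (s2 - s1)) * z ^ 4
    * (exp (theta_exponent lp (N1 - M) (s1 - \<zeta>)) * exp (theta_exponent lp (N2 - M) (s2 - \<zeta>)) * exp (theta_exponent lp (N3 - M) (s3 - \<zeta>))
    * exp (theta_exponent lp (N4 - M) (s4 - \<zeta>)) * exp (theta_exponent lp (N5 - M) (s5 - \<zeta>)) * exp (theta_exponent lp (N6 - M) (s6 - \<zeta>)))
    = K * (X1 ^ 2 * X2 * Z ^ 6)"
  proof -
    have z4: "z ^ 4 = exp (4 * \<zeta>)" and Z6: "Z ^ 6 = exp (6 * (\<zeta> + (M + E / 2) * lp))"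
      using exp_of_nat_mult[of 4 \<zeta>] exp_of_nat_mult[of 6 "\<zeta> + (M + E / 2) * lp"] by (simp_all add: t Z_def)
    show ?thesis
      unfolding K_def X1' X2' z4 Z6 exp_double[symmetric] exp_add[symmetric]
      by (rule exp_eqI_int[of _ _ "- (6 * m + 3 * e)"])
         (simp add: \<kappa>_def theta_exponent_def s6_def N6 M_E_def[symmetric] I_def[symmetric] field_simps)
  qed
  have E2: "z * exp (theta_exponent lp (2 * M + E) (2 * \<zeta>)) * (exp (theta_exponent lp (N1 + N3 + E) (s1 + s3))
     * exp (theta_exponent lp (N1 + N4 + E) (s1 + s4)) * exp (theta_exponent lp (N1 + N5 + E) (s1 + s5))
     * exp (theta_exponent lp (N1 + N6 + E) (s1 + s6)) * (exp (theta_exponent lp (N2 + E + M) (s2 + \<zeta>)) * exp (theta_exponent lp (N2 - M) (s2 - \<zeta>))))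
     = K * (Z ^ 2 * X2)"
    unfolding K_def X2' t Z_def exp_double[symmetric] exp_add[symmetric]
    by (rule exp_eqI_int[of _ _ "2 * (n1 - m)"])
       (simp add: \<kappa>_def theta_exponent_def s6_def N6 M_E_def[symmetric] N1_N2_N3_N4_N5_N6_def[symmetric] I_def[symmetric] field_simps)
  have E3: "z * exp (theta_exponent lp (2 * M + E) (2 * \<zeta>)) * (exp (theta_exponent lp (N2 + N3 + E) (s2 + s3))
     * exp (theta_exponent lp (N2 + N4 + E) (s2 + s4)) * exp (theta_exponent lp (N2 + N5 + E) (s2 + s5))
     * exp (theta_exponent lp (N2 + N6 + E) (s2 + s6)) * (exp (theta_exponent lp (N1 + E + M) (s1 + \<zeta>)) * exp (theta_exponent lp (N1 - M) (s1 - \<zeta>))))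
     = K * (Z ^ 2 * X1)"
    unfolding K_def X1' t Z_def exp_double[symmetric] exp_add[symmetric]
    by (rule exp_eqI_int[of _ _ "n1 + n2 - 2 * m"])
       (simp add: \<kappa>_def theta_exponent_def s6_def N6 M_E_def[symmetric] N1_N2_N3_N4_N5_N6_def[symmetric] I_def[symmetric] field_simps)
  \<comment> \<open>Rearrangements that separate the exponential factors from the theta functions,
    so that the prefactor identities can be used for rewriting.\<close>
  have ring1: "t * (b * B) * ((a1 * A1) * (a2 * A2) * (a3 * A3) * (a4 * A4) * (a5 * A5) * (a6 * A6)
      - w * ((c1 * C1) * (c2 * C2) * (c3 * C3) * (c4 * C4) * (c5 * C5) * (c6 * C6)))
    = (t * b * (a1 * a2 * a3 * a4 * a5 * a6)) * (B * (A1 * A2 * A3 * A4 * A5 * A6))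
      - (t * b * w * (c1 * c2 * c3 * c4 * c5 * c6)) * (B * (C1 * C2 * C3 * C4 * C5 * C6))"
    for t b B a1 a2 a3 a4 a5 a6 c1 c2 c3 c4 c5 c6 A1 A2 A3 A4 A5 A6 C1 C2 C3 C4 C5 C6 w :: complex
    by (simp only: right_diff_distrib mult_ac)
  have ring2: "t * (b * B) * ((a1 * A1) * (a2 * A2) * (a3 * A3) * (a4 * A4) * ((a5 * A5) * (a6 * A6))
      - ((c1 * C1) * (c2 * C2) * (c3 * C3) * (c4 * C4) * ((c5 * C5) * (c6 * C6))))
    = (t * b * (a1 * a2 * a3 * a4 * (a5 * a6))) * (B * ((A1 * A2 * A3 * A4) * (A5 * A6)))
      - (t * b * (c1 * c2 * c3 * c4 * (c5 * c6))) * (B * ((C1 * C2 * C3 * C4) * (C5 * C6)))"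
    for t b B a1 a2 a3 a4 a5 a6 c1 c2 c3 c4 c5 c6 A1 A2 A3 A4 A5 A6 C1 C2 C3 C4 C5 C6 :: complex
    by (simp only: right_diff_distrib mult_ac)
  show ?thesis
    unfolding t(1-5) t6 plus minus pair quot square N1_N2_N3_N4_N5_N6_def[symmetric] Xs[symmetric] ring1 ring2 E1 E1' E2 E3
  proof -
    have XZ: "X1 / Z = X1 * (1 / Z)" "X2 / Z = X2 * (1 / Z)" by simp_all
    have "K * (X1 ^ 2 * X2) * (?T (X2 / X1) * (?T (X1 * Z) * ?T (X2 * Z) * ?T (X3 * Z) * ?T (X4 * Z) * ?T (X5 * Z) * ?T (X6 * Z))) -
      K * (X1 ^ 2 * X2 * Z ^ 6) * (?T (X2 / X1) * (?T (X1 * (1 / Z)) * ?T (X2 * (1 / Z)) * ?T (X3 * (1 / Z)) * ?T (X4 * (1 / Z)) * ?T (X5 * (1 / Z)) * ?T (X6 * (1 / Z))))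
     = K * (X1 ^ 2 * X2 * ?T (X2 / X1) * (?T (X1 * Z) * ?T (X2 * Z) * ?T (X3 * Z) * ?T (X4 * Z) * ?T (X5 * Z) * ?T (X6 * Z)
      - Z ^ 6 * (?T (X1 * (1 / Z)) * ?T (X2 * (1 / Z)) * ?T (X3 * (1 / Z)) * ?T (X4 * (1 / Z)) * ?T (X5 * (1 / Z)) * ?T (X6 * (1 / Z)))))"
      by (simp only: right_diff_distrib mult_ac)
    also have "\<dots> = K * (Z ^ 2 * ?T (Z ^ 2) * (X2 * (?T (X1 * X3) * ?T (X1 * X4) * ?T (X1 * X5) * ?T (X1 * X6)) * (?T (X2 * Z) * ?T (X2 * (1 / Z)))
      - X1 * (?T (X2 * X3) * ?T (X2 * X4) * ?T (X2 * X5) * ?T (X2 * X6)) * (?T (X1 * Z) * ?T (X1 * (1 / Z)))))"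
      using TI unfolding XZ by (simp only:)
    also have "\<dots> = K * (Z ^ 2 * X2) * (?T (Z ^ 2) * ((?T (X1 * X3) * ?T (X1 * X4) * ?T (X1 * X5) * ?T (X1 * X6)) * (?T (X2 * Z) * ?T (X2 * (1 / Z)))))
      - K * (Z ^ 2 * X1) * (?T (Z ^ 2) * ((?T (X2 * X3) * ?T (X2 * X4) * ?T (X2 * X5) * ?T (X2 * X6)) * (?T (X1 * Z) * ?T (X1 * (1 / Z)))))"
      by (simp only: right_diff_distrib mult_ac)
    finally show "K * (X1 ^ 2 * X2) * (?T (X2 / X1) * (?T (X1 * Z) * ?T (X2 * Z) * ?T (X3 * Z) * ?T (X4 * Z) * ?T (X5 * Z) * ?T (X6 * Z))) -
      K * (X1 ^ 2 * X2 * Z ^ 6) * (?T (X2 / X1) * (?T (X1 * (1 / Z)) * ?T (X2 * (1 / Z)) * ?T (X3 * (1 / Z)) * ?T (X4 * (1 / Z)) * ?T (X5 * (1 / Z)) * ?T (X6 * (1 / Z))))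
     = K * (Z ^ 2 * X2) * (?T (Z ^ 2) * ((?T (X1 * X3) * ?T (X1 * X4) * ?T (X1 * X5) * ?T (X1 * X6)) * (?T (X2 * Z) * ?T (X2 * (1 / Z)))))
      - K * (Z ^ 2 * X1) * (?T (Z ^ 2) * ((?T (X2 * X3) * ?T (X2 * X4) * ?T (X2 * X5) * ?T (X2 * X6)) * (?T (X1 * Z) * ?T (X1 * (1 / Z)))))" .
  qed
qed

lemma Th_inverse:
  assumes "z \<noteq> 0"
  shows "Th (1 / z) (- m) = - Th z m / z"
proof -
  define x where "x = Ln z"
  have x: "z = exp x" "1 / z = exp (- x)" using assms by (simp_all add: x_def exp_minus inverse_eq_divide)
  have "exp (- x + of_int (- m) * lp) = inverse (exp (x + of_int m * lp))"
    by (simp add: exp_minus[symmetric])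
  hence "Th (exp (- x)) (- m) = exp (theta_exponent lp (of_int (- m)) (- x)) * (- qtheta (exp (x + of_int m * lp)) (p ^ r) / exp (x + of_int m * lp))"
    unfolding Th_exp' using qtheta_inverse[OF pr, of "exp (x + of_int m * lp)"] by simp
  also have "\<dots> = - (exp (theta_exponent lp (of_int (- m)) (- x)) / exp (x + of_int m * lp)) * qtheta (exp (x + of_int m * lp)) (p ^ r)"
    by simp
  also have "exp (theta_exponent lp (of_int (- m)) (- x)) / exp (x + of_int m * lp) = exp (theta_exponent lp (of_int m) x) / exp x"
    unfolding exp_diff[symmetric]
    by (rule exp_eqI_int[of _ _ "- m"]) (simp add: theta_exponent_def field_simps)
  finally have *: "Th (exp (- x)) (- m) = - (exp (theta_exponent lp (of_int m) x) / exp x) * qtheta (exp (x + of_int m * lp)) (p ^ r)" .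
  show ?thesis unfolding x(2) * unfolding x(1) Th_exp' by simp
qed

text \<open>Replacing (z, m) by (p z, m - 1) leaves the theta argument z p^m fixed, so only the
  monomial prefactor changes. The step is p itself, not the period p^r.\<close>

lemma Th_mult_p:
  assumes "z \<noteq> 0"
  shows "Th (p * z) (m - 1) = - Th z m / z"
proof -
  define x where "x = Ln z"
  have x: "z = exp x" "p * z = exp (lp + x)" using assms by (simp_all add: x_def p_exp exp_add)
  have "exp (lp + x + of_int (m - 1) * lp) = exp (x + of_int m * lp)"
    by (simp add: algebra_simps)
  moreover have "exp (theta_exponent lp (of_int (m - 1)) (lp + x)) = exp (theta_exponent lp (of_int m) x - (x + \<i> * of_real pi))"
    by (rule arg_cong[where f = exp]) (simp add: theta_exponent_def field_simps)
  hence "exp (theta_exponent lp (of_int (m - 1)) (lp + x)) = - exp (theta_exponent lp (of_int m) x) / exp x"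
    by (simp add: exp_diff[symmetric] exp_diff[of _ "x + \<i> * of_real pi"] minus_exp_conv[symmetric])
  ultimately show ?thesis unfolding x(2) unfolding x(1) Th_exp' by simp
qed

end

section \<open>The rarefied elliptic beta integral\<close>

lemma periodic_int:
  fixes a :: "int \<Rightarrow> 'a"
  assumes per: "\<And>m. a (m + int r) = a m"
  shows "a (m + k * int r) = a m"
proof (induction k rule: int_induct[of _ 0])
  case (step1 i)
  thus ?case using per[of "m + i * int r"] by (simp add: algebra_simps)
next
  case (step2 i)
  thus ?case using per[of "m + (i - 1) * int r"] by (simp add: algebra_simps)
qed auto

text \<open>The map m -> c - m is an involution on the residues modulo r.\<close>

lemma sum_periodic_reflect:
  fixes a :: "int \<Rightarrow> complex"
  assumes r: "r > 0" and per: "\<And>m. a (m + int r) = a m"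
  shows "(\<Sum>m = 0..int r - 1. a (c - m)) = (\<Sum>m = 0..int r - 1. a m)"
proof -
  have amod: "a (m mod int r) = a m" for m
    using periodic_int[of a r "m mod int r" "m div int r"] per by simp
  have inv: "(c - (c - m) mod int r) mod int r = m" if "m \<in> {0..int r - 1}" for m
    using that by (simp add: mod_diff_right_eq)
  have "(\<Sum>m = 0..int r - 1. a m) = (\<Sum>m = 0..int r - 1. a ((c - m) mod int r))"
    by (rule sum.reindex_bij_witness[of _ "\<lambda>m. (c - m) mod int r" "\<lambda>m. (c - m) mod int r"])
       (use r inv in \<open>auto\<close>)
  thus ?thesis by (simp add: amod)
qed

section \<open>Integrands, the telescoper, and periodicity in m\<close>

context rarefied
begin

definition lam_exponent :: "complex \<Rightarrow> complex \<Rightarrow> complex" where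
  "lam_exponent k x = (of_nat r - 1) * ((x + \<i> * of_real pi - (lp + lq) / 2) * (k + of_nat r / 2)
        + (lp - lq) / 2 * ((k + of_nat r / 2) ^ 2 + (of_nat r ^ 2 - 2 * of_nat r) / 12))"

lemma lam_exp': "lam (exp x) m = exp (lam_exponent (of_int m) x)"
  by (simp add: lam_exp lam_exponent_def)

lemma G_holomorphic_comp:
  assumes "g holomorphic_on A" "\<And>z. z \<in> A \<Longrightarrow> g z \<noteq> 0 \<and> norm (g z) < 1"
  shows "(\<lambda>z. G (g z) m) holomorphic_on A"
proof -
  have "g ` A \<subseteq> ball 0 1 - {0}" using assms(2) by auto
  from holomorphic_on_compose_gen[OF assms(1) G_holomorphic this] show ?thesis by (simp add: o_def)
qed

lemma G_continuous_comp:
  assumes "continuous_on A g" "\<And>z. z \<in> A \<Longrightarrow> g z \<noteq> 0 \<and> norm (g z) < 1"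
  shows "continuous_on A (\<lambda>z. G (g z) m)"
  by (rule continuous_on_compose2[OF holomorphic_on_imp_continuous_on[OF G_holomorphic] assms(1)])
     (use assms(2) in auto)

definition gpair :: "int \<Rightarrow> complex \<times> int \<Rightarrow> complex \<Rightarrow> int \<Rightarrow> complex" where
  "gpair e x z m = G (fst x * z) (snd x + e + m) * G (fst x / z) (snd x - m)"

text \<open>
  The reflection formula turns the denominator $\Gamma^{(r)}(z^{\pm 2}, \pm(2m + \epsilon))$ into a
  numerator that is continuous on the unit circle.
\<close>

definition gdenom :: "int \<Rightarrow> complex \<Rightarrow> int \<Rightarrow> complex" where
  "gdenom e z m = G (p * q * z ^ 2) (2 * m + e) * G (p * q / z ^ 2) (- (2 * m + e))"

definition beta_integrand where
  "beta_integrand e x1 x2 x3 x4 x5 x6 z m =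
     gpair e x1 z m * gpair e x2 z m * gpair e x3 z m * gpair e x4 z m * gpair e x5 z m * gpair e x6 z m * gdenom e z m"

definition beta_integral where
  "beta_integral e x1 x2 x3 x4 x5 x6 = (\<Sum>m = 0..int r - 1. circ_mean 1 (\<lambda>z. beta_integrand e x1 x2 x3 x4 x5 x6 z m))"

definition gcross :: "int \<Rightarrow> complex \<times> int \<Rightarrow> complex \<times> int \<Rightarrow> complex" where
  "gcross e x y = G (fst x * fst y) (snd x + snd y + e)"

definition admissible :: "complex \<times> int \<Rightarrow> bool" where
  "admissible x \<longleftrightarrow> fst x \<noteq> 0 \<and> norm (fst x) < 1"

definition qshift :: "complex \<times> int \<Rightarrow> complex \<times> int" where
  "qshift x = (q * fst x, snd x + 1)"

lemma admissible_qshift: "admissible x \<Longrightarrow> admissible (qshift x)"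
  using q0 nq mult_strict_mono[of "norm q" 1 "norm (fst x)" 1] by (auto simp: admissible_def qshift_def norm_mult)

lemma gpair_continuous:
  assumes "admissible x"
  shows "continuous_on (sphere 0 1) (\<lambda>z. gpair e x z m)"
  unfolding gpair_def using assms
  by (intro continuous_intros G_continuous_comp) (auto simp: admissible_def norm_mult norm_divide)

lemma gdenom_continuous: "continuous_on (sphere 0 1) (\<lambda>z. gdenom e z m)"
  unfolding gdenom_def using pq p0 q0
  by (intro continuous_intros G_continuous_comp) (auto simp: norm_mult norm_divide norm_power)

lemma beta_integrand_continuous:
  assumes "admissible x1" "admissible x2" "admissible x3" "admissible x4" "admissible x5" "admissible x6"
  shows "continuous_on (sphere 0 1) (\<lambda>z. beta_integrand e x1 x2 x3 x4 x5 x6 z m)"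
  unfolding beta_integrand_def by (intro continuous_intros gpair_continuous gdenom_continuous assms)

lemma gpair_reflect: "gpair e x (1 / z) (- m - e) = gpair e x z m"
  by (simp add: gpair_def algebra_simps)

lemma gdenom_reflect: "gdenom e (1 / z) (- m - e) = gdenom e z m"
  by (simp add: gdenom_def power_divide algebra_simps)

lemma beta_integrand_reflect:
  "beta_integrand e x1 x2 x3 x4 x5 x6 (1 / z) (- m - e) = beta_integrand e x1 x2 x3 x4 x5 x6 z m"
  by (simp add: beta_integrand_def gpair_reflect gdenom_reflect)

text \<open>The pair \<open>gpair\<close> with the q-shift applied to only one of its two factors.
  The substitution z -> 1/(qz), m -> -1 - m - e exchanges the two factors.\<close>

definition tpair :: "int \<Rightarrow> complex \<times> int \<Rightarrow> complex \<Rightarrow> int \<Rightarrow> complex" where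
  "tpair e x z m = G (q * fst x * z) (snd x + e + m + 1) * G (fst x / z) (snd x - m)"

definition tdenom :: "int \<Rightarrow> complex \<Rightarrow> int \<Rightarrow> complex" where
  "tdenom e z m = G (p * q * z ^ 2) (2 * m + e) * G (p / z ^ 2) (- (2 * m + e) - 1)"

text \<open>
  It changes sign under $z \mapsto 1/(qz)$, $m \mapsto -1 - m - \epsilon$, and adding its image under
  $z \mapsto 1/z$, $m \mapsto -m - \epsilon$ gives a combination of two $q$-shifted beta integrands.
\<close>

definition telescoper where
  "telescoper e x1 x2 x3 x4 x5 x6 z m = 1 / z *
     (tpair e x1 z m * tpair e x2 z m * tpair e x3 z m * tpair e x4 z m * tpair e x5 z m * tpair e x6 z m * tdenom e z m)"

lemma G_quasi_exp:
  assumes "norm (exp x) < 1"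
  shows "G (exp x) (k + int r) = exp (lam_exponent (of_int k) x) * G (exp x) k"
  using G_quasi[of "exp x" k] assms by (simp add: lam_exp')

lemma G_quasi_exp':
  assumes "norm (exp x) < 1"
  shows "G (exp x) (k - int r) = exp (- lam_exponent (of_int k - of_nat r) x) * G (exp x) k"
  using G_quasi_exp[OF assms, of "k - int r"] by (simp add: exp_minus)

lemma G_quasi_ex:
  assumes "u = exp x" "norm u < 1" "k' = k + int r"
  shows "G u k' = exp (lam_exponent (of_int k) x) * G u k"
  using G_quasi_exp[of x k] assms by simp

lemma G_quasi_ex':
  assumes "u = exp x" "norm u < 1" "k' = k - int r"
  shows "G u k' = exp (- lam_exponent (of_int k - of_nat r) x) * G u k"
  using G_quasi_exp'[of x k] assms by simp

lemma gpair_quasi: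
  assumes "admissible x" "norm z = 1" "fst x = exp s" "z = exp \<zeta>"
  shows "gpair e x z (m + int r) =
    exp (lam_exponent (of_int (snd x) + of_int e + of_int m) (s + \<zeta>) - lam_exponent (of_int (snd x) - of_int m - of_nat r) (s - \<zeta>)) * gpair e x z m"
proof -
  have "norm (fst x * z) < 1" "norm (fst x / z) < 1" using assms(1,2) by (auto simp: admissible_def norm_mult norm_divide)
  moreover have "fst x * z = exp (s + \<zeta>)" "fst x / z = exp (s - \<zeta>)" by (simp_all add: assms(3,4) exp_add exp_diff)
  ultimately have "G (fst x * z) (snd x + e + (m + int r)) = exp (lam_exponent (of_int (snd x + e + m)) (s + \<zeta>)) * G (fst x * z) (snd x + e + m)"
    "G (fst x / z) (snd x - (m + int r)) = exp (- lam_exponent (of_int (snd x - m) - of_nat r) (s - \<zeta>)) * G (fst x / z) (snd x - m)"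
    by - (rule G_quasi_ex G_quasi_ex', assumption, assumption, simp)+
  thus ?thesis unfolding gpair_def by (simp add: exp_diff exp_minus field_simps)
qed

lemma tpair_quasi:
  assumes "admissible x" "norm z = 1" "fst x = exp s" "z = exp \<zeta>"
  shows "tpair e x z (m + int r) =
    exp (lam_exponent (of_int (snd x) + of_int e + of_int m + 1) (lq + s + \<zeta>) - lam_exponent (of_int (snd x) - of_int m - of_nat r) (s - \<zeta>)) * tpair e x z m"
proof -
  have "norm (q * fst x * z) < 1" "norm (fst x / z) < 1" using assms(1,2) admissible_qshift[OF assms(1)]
    by (auto simp: admissible_def norm_mult norm_divide qshift_def)
  moreover have "q * fst x * z = exp (lq + s + \<zeta>)" "fst x / z = exp (s - \<zeta>)" by (simp_all add: assms(3,4) exp_add exp_diff q_exp)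
  ultimately have "G (q * fst x * z) (snd x + e + (m + int r) + 1) = exp (lam_exponent (of_int (snd x + e + m + 1)) (lq + s + \<zeta>)) * G (q * fst x * z) (snd x + e + m + 1)"
    "G (fst x / z) (snd x - (m + int r)) = exp (- lam_exponent (of_int (snd x - m) - of_nat r) (s - \<zeta>)) * G (fst x / z) (snd x - m)"
    by - (rule G_quasi_ex G_quasi_ex', assumption, assumption, simp)+
  thus ?thesis unfolding tpair_def by (simp add: exp_diff exp_minus field_simps)
qed

lemma gdenom_quasi:
  assumes "norm z = 1" "z = exp \<zeta>"
  shows "gdenom e z (m + int r) =
    exp (lam_exponent (2 * of_int m + of_int e) (lp + lq + 2 * \<zeta>) + lam_exponent (2 * of_int m + of_int e + of_nat r) (lp + lq + 2 * \<zeta>)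
     - lam_exponent (- (2 * of_int m + of_int e) - of_nat r) (lp + lq - 2 * \<zeta>) - lam_exponent (- (2 * of_int m + of_int e) - 2 * of_nat r) (lp + lq - 2 * \<zeta>)) * gdenom e z m"
proof -
  define u v where "u = p * q * z ^ 2" "v = p * q / z ^ 2"
  have n: "norm u < 1" "norm v < 1" using assms(1) pq by (auto simp: u_v_def norm_mult norm_divide norm_power)
  have x: "u = exp (lp + lq + 2 * \<zeta>)" "v = exp (lp + lq - 2 * \<zeta>)" by (simp_all add: u_v_def assms(2) exp_add exp_diff p_exp q_exp exp_double)
  let ?j = "2 * m + e"
  have 1: "G u (2 * (m + int r) + e) = exp (lam_exponent (of_int (?j + int r)) (lp + lq + 2 * \<zeta>)) * G u (?j + int r)"
    using x n by (intro G_quasi_ex) auto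
  have h1': "G u (?j + int r) = exp (lam_exponent (of_int ?j) (lp + lq + 2 * \<zeta>)) * G u ?j"
    using x n by (intro G_quasi_ex) auto
  have 2: "G v (- (2 * (m + int r) + e)) = exp (- lam_exponent (of_int (- ?j - int r) - of_nat r) (lp + lq - 2 * \<zeta>)) * G v (- ?j - int r)"
    using x n by (intro G_quasi_ex') auto
  have h2': "G v (- ?j - int r) = exp (- lam_exponent (of_int (- ?j) - of_nat r) (lp + lq - 2 * \<zeta>)) * G v (- ?j)"
    using x n by (intro G_quasi_ex') auto
  have 3: "exp (a + b - c - d) = exp b * exp a * (exp (- d) * exp (- c))" for a b c d :: complex
    by (simp add: exp_add[symmetric] algebra_simps)
  have 4: "of_int (- ?j - int r) - of_nat r = - (2 * of_int m + of_int e) - 2 * (of_nat r :: complex)" by simp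
  show ?thesis
    unfolding gdenom_def u_v_def[symmetric] 1 h1' 2 h2' 3 4 by (simp add: mult_ac)
qed

lemma tdenom_quasi:
  assumes "norm z = 1" "z = exp \<zeta>"
  shows "tdenom e z (m + int r) =
    exp (lam_exponent (2 * of_int m + of_int e) (lp + lq + 2 * \<zeta>) + lam_exponent (2 * of_int m + of_int e + of_nat r) (lp + lq + 2 * \<zeta>)
     - lam_exponent (- (2 * of_int m + of_int e) - 1 - of_nat r) (lp - 2 * \<zeta>) - lam_exponent (- (2 * of_int m + of_int e) - 1 - 2 * of_nat r) (lp - 2 * \<zeta>)) * tdenom e z m"
proof -
  define u v where "u = p * q * z ^ 2" "v = p / z ^ 2"
  have n: "norm u < 1" "norm v < 1" using assms(1) pq np by (auto simp: u_v_def norm_mult norm_divide norm_power)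
  have x: "u = exp (lp + lq + 2 * \<zeta>)" "v = exp (lp - 2 * \<zeta>)" by (simp_all add: u_v_def assms(2) exp_add exp_diff p_exp q_exp exp_double)
  let ?j = "2 * m + e"
  have 1: "G u (2 * (m + int r) + e) = exp (lam_exponent (of_int (?j + int r)) (lp + lq + 2 * \<zeta>)) * G u (?j + int r)"
    using x n by (intro G_quasi_ex) auto
  have h1': "G u (?j + int r) = exp (lam_exponent (of_int ?j) (lp + lq + 2 * \<zeta>)) * G u ?j"
    using x n by (intro G_quasi_ex) auto
  have 2: "G v (- (2 * (m + int r) + e) - 1) = exp (- lam_exponent (of_int (- ?j - 1 - int r) - of_nat r) (lp - 2 * \<zeta>)) * G v (- ?j - 1 - int r)"
    using x n by (intro G_quasi_ex') auto
  have h2': "G v (- ?j - 1 - int r) = exp (- lam_exponent (of_int (- ?j - 1) - of_nat r) (lp - 2 * \<zeta>)) * G v (- ?j - 1)"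
    using x n by (intro G_quasi_ex') auto
  have 3: "exp (a + b - c - d) = exp b * exp a * (exp (- d) * exp (- c))" for a b c d :: complex
    by (simp add: exp_add[symmetric] algebra_simps)
  have 4: "of_int (- ?j - 1 - int r) - of_nat r = - (2 * of_int m + of_int e) - 1 - 2 * (of_nat r :: complex)" by simp
  show ?thesis
    unfolding tdenom_def u_v_def[symmetric] 1 h1' 2 h2' 3 4 by (simp add: mult_ac)
qed

text \<open>Six parameters and the denominator give seven quasi-periodicity factors; the balancing
  conditions make their exponents add up to a multiple of 2 pi i.\<close>

lemma prod7_exp:
  fixes a1 :: complex
  assumes "a1 + a2 + a3 + a4 + a5 + a6 + a7 = 2 * of_int k * (\<i> * of_real pi)"
  shows "(exp a1 * g1) * (exp a2 * g2) * (exp a3 * g3) * (exp a4 * g4) * (exp a5 * g5) * (exp a6 * g6) * (exp a7 * g7)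
     = g1 * g2 * g3 * g4 * g5 * g6 * g7"
proof -
  have "exp (a1 + a2 + a3 + a4 + a5 + a6 + a7) = exp 0"
    by (rule exp_eqI_int[of _ _ k]) (simp add: assms)
  hence 1: "exp a1 * exp a2 * exp a3 * exp a4 * exp a5 * exp a6 * exp a7 = 1" by (simp add: exp_add)
  have "(exp a1 * g1) * (exp a2 * g2) * (exp a3 * g3) * (exp a4 * g4) * (exp a5 * g5) * (exp a6 * g6) * (exp a7 * g7)
    = (exp a1 * exp a2 * exp a3 * exp a4 * exp a5 * exp a6 * exp a7) * (g1 * g2 * g3 * g4 * g5 * g6 * g7)"
    by (simp only: mult_ac)
  thus ?thesis unfolding 1 by simp
qed

text \<open>The squares in \<open>lam_exponent\<close> cancel in the difference up to terms linear
  in n, and s enters linearly as well. Summation over the parameters then involves only the two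
  balanced sums.\<close>

lemma lam_exponent_pair:
  "lam_exponent (n + e + m) (s + \<zeta>) - lam_exponent (n - m - of_nat r) (s - \<zeta>) =
    (of_nat r - 1) * ((e + 2 * m + of_nat r) * (s + \<i> * of_real pi - (lp + lq) / 2)
      + (2 * n + e) * (\<zeta> + (lp - lq) / 2 * (e + 2 * m + of_nat r)))"
  unfolding lam_exponent_def right_diff_distrib[symmetric]
  by (rule arg_cong2[where f = "(*)", OF refl]) (simp add: field_simps power2_eq_square)

lemma lam_exponent_denom:
  "lam_exponent (2 * m + e) (lp + lq + 2 * \<zeta>) + lam_exponent (2 * m + e + of_nat r) (lp + lq + 2 * \<zeta>)
     - lam_exponent (- (2 * m + e) - of_nat r) (lp + lq - 2 * \<zeta>) - lam_exponent (- (2 * m + e) - 2 * of_nat r) (lp + lq - 2 * \<zeta>)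
   = (of_nat r - 1) * (4 * ((e + 2 * m + of_nat r) * ((lp + lq) / 2 + \<i> * of_real pi)))"
  unfolding lam_exponent_def right_diff_distrib[symmetric] distrib_left[symmetric]
  by (rule arg_cong2[where f = "(*)", OF refl]) (simp add: field_simps power2_eq_square)

lemma lam_exponent_tpair:
  "lam_exponent (n + e + m + 1) (lq + s + \<zeta>) - lam_exponent (n - m - of_nat r) (s - \<zeta>) =
    (of_nat r - 1) * ((e + 2 * m + 1 + of_nat r) * (s + \<i> * of_real pi - lp / 2)
      + (2 * n + e + 1) * (\<zeta> + lq / 2 + (lp - lq) / 2 * (e + 2 * m + 1 + of_nat r)))"
  unfolding lam_exponent_def right_diff_distrib[symmetric]
  by (rule arg_cong2[where f = "(*)", OF refl]) (simp add: field_simps power2_eq_square)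

lemma lam_exponent_tdenom:
  "lam_exponent (2 * m + e) (lp + lq + 2 * \<zeta>) + lam_exponent (2 * m + e + of_nat r) (lp + lq + 2 * \<zeta>)
     - lam_exponent (- (2 * m + e) - 1 - of_nat r) (lp - 2 * \<zeta>) - lam_exponent (- (2 * m + e) - 1 - 2 * of_nat r) (lp - 2 * \<zeta>)
   = (of_nat r - 1) * ((e + 2 * m + 1 + of_nat r) * (2 * lq + 4 * (\<i> * of_real pi)) - 2 * (\<i> * of_real pi) - 4 * \<zeta> - 2 * lq)"
  unfolding lam_exponent_def right_diff_distrib[symmetric] distrib_left[symmetric]
  by (rule arg_cong2[where f = "(*)", OF refl]) (simp add: field_simps power2_eq_square)

lemma sum_pairs:
  fixes c :: complex
  shows "c * (w * (s1 + I - S) + (2 * n1 + e) * X) + c * (w * (s2 + I - S) + (2 * n2 + e) * X)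
   + c * (w * (s3 + I - S) + (2 * n3 + e) * X) + c * (w * (s4 + I - S) + (2 * n4 + e) * X)
   + c * (w * (s5 + I - S) + (2 * n5 + e) * X) + c * (w * (s6 + I - S) + (2 * n6 + e) * X)
   = c * (w * ((s1 + s2 + s3 + s4 + s5 + s6) + 6 * I - 6 * S) + (2 * (n1 + n2 + n3 + n4 + n5 + n6) + 6 * e) * X)"
  by (simp add: algebra_simps)

lemma beta_integrand_periodic:
  assumes adm: "admissible x1" "admissible x2" "admissible x3" "admissible x4" "admissible x5" "admissible x6"
    and prod: "fst x1 * fst x2 * fst x3 * fst x4 * fst x5 * fst x6 = p * q"
    and sum: "snd x1 + snd x2 + snd x3 + snd x4 + snd x5 + snd x6 + 3 * e = 0"
    and z: "norm z = 1"
  shows "beta_integrand e x1 x2 x3 x4 x5 x6 z (m + int r) = beta_integrand e x1 x2 x3 x4 x5 x6 z m"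
proof -
  define s1 s2 s3 s4 s5 \<zeta> where "s1 = Ln (fst x1)" "s2 = Ln (fst x2)" "s3 = Ln (fst x3)" "s4 = Ln (fst x4)" "s5 = Ln (fst x5)" "\<zeta> = Ln z"
  define s6 where "s6 = lp + lq - s1 - s2 - s3 - s4 - s5"
  have z0: "z \<noteq> 0" using z by auto
  have nz: "fst x1 \<noteq> 0" "fst x2 \<noteq> 0" "fst x3 \<noteq> 0" "fst x4 \<noteq> 0" "fst x5 \<noteq> 0" "fst x6 \<noteq> 0"
    using adm by (auto simp: admissible_def)
  have t: "fst x1 = exp s1" "fst x2 = exp s2" "fst x3 = exp s3" "fst x4 = exp s4" "fst x5 = exp s5" "z = exp \<zeta>"
    using nz z0 by (simp_all add: s1_s2_s3_s4_s5_\<zeta>_def)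
  have t6: "fst x6 = exp s6"
    using prod nz unfolding s6_def exp_diff exp_add p_exp q_exp t[symmetric] by (simp add: field_simps)
  have "snd x6 = - 3 * e - snd x1 - snd x2 - snd x3 - snd x4 - snd x5" using sum by simp
  hence sums: "s1 + s2 + s3 + s4 + s5 + s6 = lp + lq"
    "of_int (snd x1) + of_int (snd x2) + of_int (snd x3) + of_int (snd x4) + of_int (snd x5) + of_int (snd x6) = (- 3 * of_int e :: complex)"
    by (simp_all add: s6_def)
  show ?thesis
    unfolding beta_integrand_def gpair_quasi[OF adm(1) z t(1,6)] gpair_quasi[OF adm(2) z t(2,6)]
      gpair_quasi[OF adm(3) z t(3,6)] gpair_quasi[OF adm(4) z t(4,6)] gpair_quasi[OF adm(5) z t(5,6)]
      gpair_quasi[OF adm(6) z t6 t(6)] gdenom_quasi[OF z t(6)]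
    \<comment> \<open>Up to the factor r - 1, the pairs contribute 6 i pi and the denominator 4 i pi
      per unit of e + 2 m + r; the logarithms of p, q and z cancel.\<close>
    by (rule prod7_exp[where k = "(int r - 1) * (5 * e + 10 * m + 5 * int r)"])
       (unfold lam_exponent_pair lam_exponent_denom sum_pairs sums, simp add: field_simps)
qed

lemma telescoper_periodic:
  assumes adm: "admissible x1" "admissible x2" "admissible x3" "admissible x4" "admissible x5" "admissible x6"
    and prod: "fst x1 * fst x2 * fst x3 * fst x4 * fst x5 * fst x6 = p"
    and sum: "snd x1 + snd x2 + snd x3 + snd x4 + snd x5 + snd x6 + 3 * e = - 1"
    and z: "norm z = 1"
  shows "telescoper e x1 x2 x3 x4 x5 x6 z (m + int r) = telescoper e x1 x2 x3 x4 x5 x6 z m"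
proof -
  define s1 s2 s3 s4 s5 \<zeta> where "s1 = Ln (fst x1)" "s2 = Ln (fst x2)" "s3 = Ln (fst x3)" "s4 = Ln (fst x4)" "s5 = Ln (fst x5)" "\<zeta> = Ln z"
  define s6 where "s6 = lp - s1 - s2 - s3 - s4 - s5"
  have z0: "z \<noteq> 0" using z by auto
  have nz: "fst x1 \<noteq> 0" "fst x2 \<noteq> 0" "fst x3 \<noteq> 0" "fst x4 \<noteq> 0" "fst x5 \<noteq> 0" "fst x6 \<noteq> 0"
    using adm by (auto simp: admissible_def)
  have t: "fst x1 = exp s1" "fst x2 = exp s2" "fst x3 = exp s3" "fst x4 = exp s4" "fst x5 = exp s5" "z = exp \<zeta>"
    using nz z0 by (simp_all add: s1_s2_s3_s4_s5_\<zeta>_def)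
  have t6: "fst x6 = exp s6"
    using prod nz unfolding s6_def exp_diff exp_add p_exp t[symmetric] by (simp add: field_simps)
  have "snd x6 = - 1 - 3 * e - snd x1 - snd x2 - snd x3 - snd x4 - snd x5" using sum by simp
  hence sums': "s1 + s2 + s3 + s4 + s5 + s6 = lp"
    "of_int (snd x1) + of_int (snd x2) + of_int (snd x3) + of_int (snd x4) + of_int (snd x5) + of_int (snd x6) = (- 1 - 3 * of_int e :: complex)"
    by (simp_all add: s6_def)
  show ?thesis
    unfolding telescoper_def tpair_quasi[OF adm(1) z t(1,6)] tpair_quasi[OF adm(2) z t(2,6)]
      tpair_quasi[OF adm(3) z t(3,6)] tpair_quasi[OF adm(4) z t(4,6)] tpair_quasi[OF adm(5) z t(5,6)]
      tpair_quasi[OF adm(6) z t6 t(6)] tdenom_quasi[OF z t(6)]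
    by (rule arg_cong2[where f = "(*)", OF refl], rule prod7_exp[where k = "(int r - 1) * (4 + 5 * e + 10 * m + 5 * int r)"])
       (unfold lam_exponent_tpair lam_exponent_tdenom, unfold add.assoc[of _ _ 1] sum_pairs sums', simp add: field_simps)
qed

lemma tpair_eq:
  assumes "admissible x" "norm z = 1"
  shows "tpair e x z m = Th (fst x * z) (snd x + e + m) * gpair e x z m"
proof -
  have "G (q * (fst x * z)) (snd x + e + m + 1) = Th (fst x * z) (snd x + e + m) * G (fst x * z) (snd x + e + m)"
    using assms by (intro G_shift) (auto simp: admissible_def norm_mult)
  thus ?thesis by (simp add: tpair_def gpair_def mult_ac)
qed

lemma tpair_reflect:
  assumes "admissible x" "norm z = 1"
  shows "tpair e x (1 / z) (- m - e) = Th (fst x / z) (snd x - m) * gpair e x z m"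
proof -
  have "G (q * (fst x / z)) (snd x - m + 1) = Th (fst x / z) (snd x - m) * G (fst x / z) (snd x - m)"
    using assms by (intro G_shift) (auto simp: admissible_def norm_divide)
  thus ?thesis by (simp add: tpair_def gpair_def algebra_simps)
qed

text \<open>\<open>Th_mult_p\<close> and \<open>Th_inverse\<close> express all three denominators
  through \<tau>. The common factor c is a product of gamma functions and not a quotient by \<tau>,
  since \<tau> vanishes at z^2 = 1 when r divides 2m + e.\<close>

lemma denominators:
  fixes z :: complex and e m :: int
  assumes z: "norm z = 1"
  defines "\<tau> \<equiv> Th (z ^ 2) (2 * m + e)"
  obtains c where "tdenom e z m = - (1 / z ^ 2) * \<tau> * c"
    "gdenom e z m = - (1 / z ^ 2) * \<tau> ^ 2 * c" "tdenom e (1 / z) (- m - e) = \<tau> * c"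
proof
  have z0: "z \<noteq> 0" using z by auto
  let ?j = "2 * m + e"
  define Ga where "Ga = G (p / z ^ 2) (- ?j - 1)"
  define Gb where "Gb = G (p * z ^ 2) (?j - 1)"
  have "G (q * (p * z ^ 2)) (?j - 1 + 1) = Th (p * z ^ 2) (?j - 1) * Gb"
    unfolding Gb_def using z p0 np by (intro G_shift) (auto simp: norm_mult norm_power)
  also have "Th (p * z ^ 2) (?j - 1) = - \<tau> / z ^ 2"
    unfolding \<tau>_def using z0 by (intro Th_mult_p) auto
  finally have b: "G (p * q * z ^ 2) ?j = - \<tau> / z ^ 2 * Gb" by (simp add: mult_ac)
  have "Th (p / z ^ 2) (- ?j - 1) = - Th (1 / z ^ 2) (- ?j) / (1 / z ^ 2)"
    using z0 Th_mult_p[of "1 / z ^ 2" "- ?j"] by simp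
  also have "\<dots> = \<tau>"
    unfolding \<tau>_def using z0 Th_inverse[of "z ^ 2" "?j"] by simp
  finally have "Th (p / z ^ 2) (- ?j - 1) = \<tau>" .
  moreover have "G (q * (p / z ^ 2)) (- ?j - 1 + 1) = Th (p / z ^ 2) (- ?j - 1) * Ga"
    unfolding Ga_def using z p0 np z0 by (intro G_shift) (auto simp: norm_divide norm_power)
  ultimately have a: "G (p * q / z ^ 2) (- ?j) = \<tau> * Ga" by (simp add: mult_ac)
  show "tdenom e z m = - (1 / z ^ 2) * \<tau> * (Ga * Gb)"
    unfolding tdenom_def b Ga_def[symmetric] by simp
  show "gdenom e z m = - (1 / z ^ 2) * \<tau> ^ 2 * (Ga * Gb)"
    unfolding gdenom_def b a by (simp add: power2_eq_square mult_ac)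
  have "tdenom e (1 / z) (- m - e) = G (p * q / z ^ 2) (- ?j) * Gb"
    using z0 unfolding tdenom_def Gb_def by (simp add: power_divide algebra_simps)
  thus "tdenom e (1 / z) (- m - e) = \<tau> * (Ga * Gb)" unfolding a by simp
qed

text \<open>Once the common product S of gamma pairs is taken out, the claim is
  \<open>Th_identity\<close>: the telescoper contributes -1/z^3 and its reflection z, which accounts
  for the factor z^4 there.\<close>

lemma telescoper_symmetrized:
  assumes adm: "admissible x1" "admissible x2" "admissible x3" "admissible x4" "admissible x5" "admissible x6"
    and prod: "fst x1 * fst x2 * fst x3 * fst x4 * fst x5 * fst x6 = p"
    and sum: "snd x1 + snd x2 + snd x3 + snd x4 + snd x5 + snd x6 + 3 * e = - 1"
    and z: "norm z = 1"
  shows "fst x1 * Th (fst x2 / fst x1) (snd x2 - snd x1) *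
      (telescoper e x1 x2 x3 x4 x5 x6 z m + telescoper e x1 x2 x3 x4 x5 x6 (1 / z) (- m - e)) =
    Th (fst x1 * fst x3) (snd x1 + snd x3 + e) * Th (fst x1 * fst x4) (snd x1 + snd x4 + e)
      * Th (fst x1 * fst x5) (snd x1 + snd x5 + e) * Th (fst x1 * fst x6) (snd x1 + snd x6 + e)
      * beta_integrand e x1 (qshift x2) x3 x4 x5 x6 z m
    - Th (fst x2 * fst x3) (snd x2 + snd x3 + e) * Th (fst x2 * fst x4) (snd x2 + snd x4 + e)
      * Th (fst x2 * fst x5) (snd x2 + snd x5 + e) * Th (fst x2 * fst x6) (snd x2 + snd x6 + e)
      * beta_integrand e (qshift x1) x2 x3 x4 x5 x6 z m"
proof -
  have z0: "z \<noteq> 0" using z by auto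
  define \<tau> where "\<tau> = Th (z ^ 2) (2 * m + e)"
  obtain c where c: "tdenom e z m = - (1 / z ^ 2) * \<tau> * c"
    "gdenom e z m = - (1 / z ^ 2) * \<tau> ^ 2 * c" "tdenom e (1 / z) (- m - e) = \<tau> * c"
    using denominators[OF z, of e m] unfolding \<tau>_def by blast
  have qs: "gpair e (qshift x) z m = Th (fst x * z) (snd x + e + m) * Th (fst x / z) (snd x - m) * gpair e x z m"
    if "admissible x" for x
  proof -
    have "G (q * (fst x * z)) (snd x + e + m + 1) = Th (fst x * z) (snd x + e + m) * G (fst x * z) (snd x + e + m)"
      using that z by (intro G_shift) (auto simp: admissible_def norm_mult)
    moreover have "G (q * (fst x / z)) (snd x - m + 1) = Th (fst x / z) (snd x - m) * G (fst x / z) (snd x - m)"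
      using that z by (intro G_shift) (auto simp: admissible_def norm_divide)
    ultimately show ?thesis by (simp add: gpair_def qshift_def algebra_simps)
  qed
  define S where "S = gpair e x1 z m * gpair e x2 z m * gpair e x3 z m * gpair e x4 z m * gpair e x5 z m * gpair e x6 z m"
  define A where "A = Th (fst x1 * z) (snd x1 + e + m) * Th (fst x2 * z) (snd x2 + e + m) * Th (fst x3 * z) (snd x3 + e + m)
        * Th (fst x4 * z) (snd x4 + e + m) * Th (fst x5 * z) (snd x5 + e + m) * Th (fst x6 * z) (snd x6 + e + m)"
  define A' where "A' = Th (fst x1 / z) (snd x1 - m) * Th (fst x2 / z) (snd x2 - m) * Th (fst x3 / z) (snd x3 - m)
        * Th (fst x4 / z) (snd x4 - m) * Th (fst x5 / z) (snd x5 - m) * Th (fst x6 / z) (snd x6 - m)"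
  define K where "K = fst x1 * Th (fst x2 / fst x1) (snd x2 - snd x1)"
  define B1 where "B1 = Th (fst x1 * fst x3) (snd x1 + snd x3 + e) * Th (fst x1 * fst x4) (snd x1 + snd x4 + e)
      * Th (fst x1 * fst x5) (snd x1 + snd x5 + e) * Th (fst x1 * fst x6) (snd x1 + snd x6 + e)"
  define B2 where "B2 = Th (fst x2 * fst x3) (snd x2 + snd x3 + e) * Th (fst x2 * fst x4) (snd x2 + snd x4 + e)
      * Th (fst x2 * fst x5) (snd x2 + snd x5 + e) * Th (fst x2 * fst x6) (snd x2 + snd x6 + e)"
  define U1 where "U1 = Th (fst x1 * z) (snd x1 + e + m) * Th (fst x1 / z) (snd x1 - m)"
  define U2 where "U2 = Th (fst x2 * z) (snd x2 + e + m) * Th (fst x2 / z) (snd x2 - m)"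
  have id: "K * (A - z ^ 4 * A') = z * \<tau> * (B1 * U2 - B2 * U1)"
    using Th_identity[OF prod sum z0, of m]
    unfolding K_def A_def A'_def \<tau>_def B1_def B2_def U1_def U2_def by (simp only: mult.assoc)
  have "telescoper e x1 x2 x3 x4 x5 x6 z m = 1 / z * (A * S * (- (1 / z ^ 2) * \<tau> * c))"
    unfolding telescoper_def A_def S_def c(1) tpair_eq[OF adm(1) z] tpair_eq[OF adm(2) z] tpair_eq[OF adm(3) z]
      tpair_eq[OF adm(4) z] tpair_eq[OF adm(5) z] tpair_eq[OF adm(6) z] by (simp only: mult_ac)
  moreover have "telescoper e x1 x2 x3 x4 x5 x6 (1 / z) (- m - e) = z * (A' * S * (\<tau> * c))"
  proof -
    have "1 / (1 / z) = z" by simp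
    thus ?thesis unfolding telescoper_def A'_def S_def c(3) tpair_reflect[OF adm(1) z] tpair_reflect[OF adm(2) z] tpair_reflect[OF adm(3) z]
      tpair_reflect[OF adm(4) z] tpair_reflect[OF adm(5) z] tpair_reflect[OF adm(6) z] by (simp only: mult_ac)
  qed
  ultimately have "K * (telescoper e x1 x2 x3 x4 x5 x6 z m + telescoper e x1 x2 x3 x4 x5 x6 (1 / z) (- m - e)) =
      - (\<tau> * c * S / z ^ 3) * (K * (A - z ^ 4 * A'))"
    using z0 by (simp add: field_simps power2_eq_square eval_nat_numeral)
  also have "\<dots> = (S * (- (1 / z ^ 2) * \<tau> ^ 2 * c)) * (B1 * U2 - B2 * U1)"
    unfolding id using z0 by (simp add: field_simps power2_eq_square eval_nat_numeral)
  also have "\<dots> = B1 * (S * U2 * (- (1 / z ^ 2) * \<tau> ^ 2 * c)) - B2 * (S * U1 * (- (1 / z ^ 2) * \<tau> ^ 2 * c))"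
    by (simp only: right_diff_distrib left_diff_distrib mult_ac)
  also have "S * U2 * (- (1 / z ^ 2) * \<tau> ^ 2 * c) = beta_integrand e x1 (qshift x2) x3 x4 x5 x6 z m"
    unfolding beta_integrand_def c(2) qs[OF adm(2)] S_def U2_def by (simp only: mult_ac)
  also have "S * U1 * (- (1 / z ^ 2) * \<tau> ^ 2 * c) = beta_integrand e (qshift x1) x2 x3 x4 x5 x6 z m"
    unfolding beta_integrand_def c(2) qs[OF adm(1)] S_def U1_def by (simp only: mult_ac)
  finally show ?thesis unfolding K_def B1_def B2_def .
qed

lemma tpair_antireflect:
  assumes "z \<noteq> 0"
  shows "tpair e x (1 / q / z) (- m - 1 - e) = tpair e x z m"
  using assms q0 by (simp add: tpair_def algebra_simps)

text \<open>Together with m -> -1 - m - e, the map z -> 1/(qz) preserves this circle and every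
  \<open>tpair\<close>; the sign comes from 1/z and \<open>tdenom\<close>. The radius also keeps the
  arguments of G in \<open>tdenom\<close> inside the unit disc.\<close>

lemma telescoper_antisymmetric:
  assumes z: "norm z ^ 2 = 1 / norm q"
  shows "telescoper e x1 x2 x3 x4 x5 x6 (1 / q / z) (- m - 1 - e) = - telescoper e x1 x2 x3 x4 x5 x6 z m"
proof -
  have z0: "z \<noteq> 0" using z q0 by auto
  let ?j = "2 * m + e"
  define w where "w = p * q * z ^ 2"
  have w: "w \<noteq> 0" "norm w < 1" using z0 p0 q0 z np by (auto simp: w_def norm_mult norm_power)
  define Ga where "Ga = G (p / (q * z ^ 2)) (- ?j - 2)"
  define Gb where "Gb = G w ?j"
  have "norm (p / (q * z ^ 2)) < 1" "p / (q * z ^ 2) \<noteq> 0"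
    using z z0 p0 q0 np by (auto simp: norm_divide norm_mult norm_power)
  hence "G (q * (p / (q * z ^ 2))) (- ?j - 2 + 1) = Th (p / (q * z ^ 2)) (- ?j - 2) * Ga"
    unfolding Ga_def by (intro G_shift)
  hence a: "G (p / z ^ 2) (- ?j - 1) = Th (p / (q * z ^ 2)) (- ?j - 2) * Ga"
    using q0 by simp
  have b: "G (q * w) (?j + 1) = Th w ?j * Gb"
    unfolding Gb_def using w by (intro G_shift)
  have "Th (p * (p / w)) (- ?j - 1 - 1) = - Th (p * (1 / w)) (- ?j - 1) / (p / w)"
    using w p0 by (subst Th_mult_p) auto
  also have "Th (p * (1 / w)) (- ?j - 1) = - Th (1 / w) (- ?j) / (1 / w)"
    using w by (intro Th_mult_p) auto
  also have "Th (1 / w) (- ?j) = - Th w ?j / w" using w by (intro Th_inverse)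
  finally have "Th (p / (q * z ^ 2)) (- ?j - 2) = - (q * z ^ 2) * Th w ?j"
    using w p0 q0 z0 by (simp add: w_def field_simps)
  note a = a[unfolded this]
  have d1: "tdenom e (1 / q / z) (- m - 1 - e) = Ga * (Th w ?j * Gb)"
  proof -
    have "p * q * (1 / q / z) ^ 2 = p / (q * z ^ 2)" "p / (1 / q / z) ^ 2 = q * w"
      "2 * (- m - 1 - e) + e = - ?j - 2" "- (- ?j - 2) - 1 = ?j + 1"
      using q0 z0 by (auto simp: w_def field_simps power2_eq_square)
    thus ?thesis unfolding tdenom_def by (simp only: Ga_def b)
  qed
  have d2: "tdenom e z m = - (q * z ^ 2) * Ga * (Th w ?j * Gb)"
    unfolding tdenom_def a by (simp add: w_def Gb_def mult_ac)
  show ?thesis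
    unfolding telescoper_def tpair_antireflect[OF z0] d1 d2
    using z0 q0 by (simp add: field_simps power2_eq_square)
qed

lemma telescoper_sum_zero:
  assumes adm: "admissible x1" "admissible x2" "admissible x3" "admissible x4" "admissible x5" "admissible x6"
    and prod: "fst x1 * fst x2 * fst x3 * fst x4 * fst x5 * fst x6 = p"
    and sum: "snd x1 + snd x2 + snd x3 + snd x4 + snd x5 + snd x6 + 3 * e = - 1"
  shows "(\<Sum>m = 0..int r - 1. circ_mean 1 (\<lambda>z. telescoper e x1 x2 x3 x4 x5 x6 z m)) = 0"
proof -
  let ?g = "telescoper e x1 x2 x3 x4 x5 x6"
  define b where "b = (\<lambda>m. circ_mean 1 (\<lambda>z. ?g z m))"
  \<comment> \<open>A fixed point of z -> 1/(qz), so that the substitution maps the circle through c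
    to itself.\<close>
  define c where "c = exp (- lq / 2)"
  have c2: "c ^ 2 = 1 / q" unfolding c_def exp_double[symmetric] q_exp by (simp add: exp_minus inverse_eq_divide)
  hence nc2: "norm c ^ 2 = 1 / norm q" by (metis norm_divide norm_one norm_power)
  have c0: "c \<noteq> 0" by (simp add: c_def)
  have cc: "1 / q / c = c" unfolding c2[symmetric] using c0 by (simp add: power2_eq_square)
  \<comment> \<open>The inner radius keeps t / z and p / z^2 in the unit disc, the outer one q t z
    and p q z^2; the annulus contains both |z| = 1 and |z| = |c|.\<close>
  define a where "a = Max {norm (fst x1), norm (fst x2), norm (fst x3), norm (fst x4), norm (fst x5), norm (fst x6), sqrt (norm p)}"
  define B where "B = min (1 / norm q) (1 / sqrt (norm (p * q)))"
  have a1: "a < 1" using adm np unfolding a_def by (simp add: admissible_def)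
  have le: "norm (fst x1) \<le> a" "norm (fst x2) \<le> a" "norm (fst x3) \<le> a" "norm (fst x4) \<le> a" "norm (fst x5) \<le> a" "norm (fst x6) \<le> a"
    and sp: "sqrt (norm p) \<le> a"
    unfolding a_def by (rule Max_ge; simp)+
  have "0 < sqrt (norm p)" using p0 by simp
  hence a0: "0 < a" using sp by linarith
  have qpos: "0 < norm q" "norm q < 1" using q0 nq by auto
  have ppos: "0 < norm p" "norm p < 1" using p0 np by auto
  have nc: "norm c = 1 / sqrt (norm q)"
    using nc2 by (metis norm_ge_zero real_sqrt_divide real_sqrt_one real_sqrt_unique)
  have nc1: "1 < norm c" unfolding nc using qpos by (simp add: real_sqrt_lt_1_iff)
  have ncB: "norm c < B"
  proof -
    have "norm q < sqrt (norm q)"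
      using qpos real_less_rsqrt[of "norm q" "norm q"] by (simp add: power2_eq_square)
    moreover have "sqrt (norm (p * q)) < sqrt (norm q)" using qpos ppos by (simp add: norm_mult)
    ultimately show ?thesis unfolding B_def nc using qpos ppos by (auto intro!: divide_strict_left_mono simp: norm_mult)
  qed
  have hol: "(\<lambda>z. ?g z m) holomorphic_on {z. a < norm z \<and> norm z < B}" for m
  proof -
    have P: "(\<lambda>z. tpair e x z m) holomorphic_on {z. a < norm z \<and> norm z < B}"
      if x: "admissible x" "norm (fst x) \<le> a" for x
      unfolding tpair_def
    proof (intro holomorphic_intros G_holomorphic_comp)
      fix z :: complex assume "z \<in> {z. a < norm z \<and> norm z < B}"
      hence z: "z \<noteq> 0" "norm (fst x) < norm z" "norm z < 1 / norm q" using a0 x by (auto simp: B_def)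
      show "fst x / z \<noteq> 0 \<and> norm (fst x / z) < 1" using z x by (auto simp: norm_divide admissible_def divide_simps)
      have "norm (q * fst x * z) = norm (fst x) * (norm q * norm z)" by (simp add: norm_mult)
      also have "\<dots> < 1 * 1" using x z qpos by (intro mult_strict_mono) (auto simp: admissible_def field_simps)
      finally show "q * fst x * z \<noteq> 0 \<and> norm (q * fst x * z) < 1" using z x q0 by (auto simp: admissible_def)
    qed (use a0 in auto)
    have D: "(\<lambda>z. tdenom e z m) holomorphic_on {z. a < norm z \<and> norm z < B}"
      unfolding tdenom_def
    proof (intro holomorphic_intros G_holomorphic_comp)
      fix z :: complex assume "z \<in> {z. a < norm z \<and> norm z < B}"
      hence z: "z \<noteq> 0" "sqrt (norm p) < norm z" "norm z < 1 / sqrt (norm (p * q))" using a0 sp by (auto simp: B_def)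
      have "sqrt (norm p) ^ 2 < norm z ^ 2" using z(2) by (intro power_strict_mono) auto
      hence "norm p < norm z ^ 2" by simp
      thus "p / z ^ 2 \<noteq> 0 \<and> norm (p / z ^ 2) < 1" using z p0 by (auto simp: norm_divide norm_power)
      have "norm z * sqrt (norm (p * q)) < 1" using z(3) pq by (simp add: field_simps)
      hence "(norm z * sqrt (norm (p * q))) ^ 2 < 1" by (simp add: abs_square_less_1)
      hence "norm (p * q * z ^ 2) < 1" by (simp add: power_mult_distrib norm_mult norm_power mult_ac)
      thus "p * q * z ^ 2 \<noteq> 0 \<and> norm (p * q * z ^ 2) < 1" using z p0 q0 by simp
    qed (use a0 in auto)
    show ?thesis
      unfolding telescoper_def by (intro holomorphic_intros P D adm le) (use a0 in auto)
  qed
  have b_c: "b m = circ_mean c (\<lambda>z. ?g z m)" for m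
    unfolding b_def by (rule circ_mean_independent[OF hol a0]) (use a1 nc1 ncB in auto)
  have anti: "b (- 1 - e - m) = - b m" for m
  proof -
    have "b (- 1 - e - m) = circ_mean c (\<lambda>z. ?g (1 / q / z) (- 1 - e - m))"
      unfolding b_c circ_mean_divide[where F = "\<lambda>z. ?g z (- 1 - e - m)"] cc ..
    also have "\<dots> = circ_mean c (\<lambda>z. - 1 * ?g z m)"
    proof (rule circ_mean_cong)
      fix z :: complex assume "norm z = norm c"
      hence "norm z ^ 2 = 1 / norm q" using nc2 by simp
      from telescoper_antisymmetric[OF this, of e x1 x2 x3 x4 x5 x6 m]
      moreover have "- m - 1 - e = - 1 - e - m" by simp
      ultimately show "?g (1 / q / z) (- 1 - e - m) = - 1 * ?g z m" by (simp only: mult_minus1)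
    qed
    also have "\<dots> = - b m" unfolding circ_mean_cmult b_c by simp
    finally show ?thesis .
  qed
  have per: "b (m + int r) = b m" for m
    unfolding b_def by (rule circ_mean_cong) (simp add: telescoper_periodic[OF adm prod sum])
  have "(\<Sum>m = 0..int r - 1. b m) = (\<Sum>m = 0..int r - 1. b (- 1 - e - m))"
    by (rule sum_periodic_reflect[where a = b, OF r per, symmetric])
  also have "\<dots> = - (\<Sum>m = 0..int r - 1. b m)" by (simp add: anti sum_negf)
  finally have "(\<Sum>m = 0..int r - 1. b m) = 0" by simp
  thus ?thesis unfolding b_def .
qed

lemma telescoper_continuous:
  assumes "admissible x1" "admissible x2" "admissible x3" "admissible x4" "admissible x5" "admissible x6"
  shows "continuous_on (sphere 0 1) (\<lambda>z. telescoper e x1 x2 x3 x4 x5 x6 z m)"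
proof -
  have P: "continuous_on (sphere 0 1) (\<lambda>z. tpair e x z m)" if "admissible x" for x
    unfolding tpair_def using that admissible_qshift[OF that]
    by (intro continuous_intros G_continuous_comp) (auto simp: admissible_def norm_mult norm_divide qshift_def)
  have D: "continuous_on (sphere 0 1) (\<lambda>z. tdenom e z m)"
    unfolding tdenom_def using pq p0 q0 np
    by (intro continuous_intros G_continuous_comp) (auto simp: norm_mult norm_divide norm_power)
  show ?thesis unfolding telescoper_def by (intro continuous_intros P D assms) auto
qed

text \<open>Integration and summation over m send the telescoper and its reflection to the same sum,
  which is zero; what remains of the symmetrized identity is the relation between the two shifted
  integrals.\<close>

lemma beta_integral_shift:
  assumes adm: "admissible x1" "admissible x2" "admissible x3" "admissible x4" "admissible x5" "admissible x6"
    and prod: "fst x1 * fst x2 * fst x3 * fst x4 * fst x5 * fst x6 = p"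
    and sum: "snd x1 + snd x2 + snd x3 + snd x4 + snd x5 + snd x6 + 3 * e = - 1"
  shows "Th (fst x1 * fst x3) (snd x1 + snd x3 + e) * Th (fst x1 * fst x4) (snd x1 + snd x4 + e)
      * Th (fst x1 * fst x5) (snd x1 + snd x5 + e) * Th (fst x1 * fst x6) (snd x1 + snd x6 + e)
      * beta_integral e x1 (qshift x2) x3 x4 x5 x6
    = Th (fst x2 * fst x3) (snd x2 + snd x3 + e) * Th (fst x2 * fst x4) (snd x2 + snd x4 + e)
      * Th (fst x2 * fst x5) (snd x2 + snd x5 + e) * Th (fst x2 * fst x6) (snd x2 + snd x6 + e)
      * beta_integral e (qshift x1) x2 x3 x4 x5 x6"
proof -
  let ?g = "telescoper e x1 x2 x3 x4 x5 x6"
  let ?F1 = "beta_integrand e x1 (qshift x2) x3 x4 x5 x6"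
  let ?F2 = "beta_integrand e (qshift x1) x2 x3 x4 x5 x6"
  define K where "K = fst x1 * Th (fst x2 / fst x1) (snd x2 - snd x1)"
  define B1 where "B1 = Th (fst x1 * fst x3) (snd x1 + snd x3 + e) * Th (fst x1 * fst x4) (snd x1 + snd x4 + e)
      * Th (fst x1 * fst x5) (snd x1 + snd x5 + e) * Th (fst x1 * fst x6) (snd x1 + snd x6 + e)"
  define B2 where "B2 = Th (fst x2 * fst x3) (snd x2 + snd x3 + e) * Th (fst x2 * fst x4) (snd x2 + snd x4 + e)
      * Th (fst x2 * fst x5) (snd x2 + snd x5 + e) * Th (fst x2 * fst x6) (snd x2 + snd x6 + e)"
  define b where "b = (\<lambda>m. circ_mean 1 (\<lambda>z. ?g z m))"
  have cg: "continuous_on (sphere 0 1) (\<lambda>z. ?g z m)" for m by (rule telescoper_continuous[OF adm])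
  have cg': "continuous_on (sphere 0 1) (\<lambda>z. ?g (1 / z) m)" for m
    by (rule continuous_on_compose2[OF cg]) (auto intro!: continuous_intros simp: norm_divide)
  have c1: "continuous_on (sphere 0 1) (\<lambda>z. ?F1 z m)" and c2: "continuous_on (sphere 0 1) (\<lambda>z. ?F2 z m)" for m
    by (intro beta_integrand_continuous adm admissible_qshift)+
  have each: "K * (b m + b (- e - m)) = B1 * circ_mean 1 (\<lambda>z. ?F1 z m) - B2 * circ_mean 1 (\<lambda>z. ?F2 z m)" for m
  proof -
    have "b (- e - m) = circ_mean 1 (\<lambda>z. ?g (1 / z) (- m - e))"
      using circ_mean_divide[where F = "\<lambda>z. ?g z (- e - m)" and a = 1 and c = 1]
      by (simp add: b_def minus_diff_commute)
    hence "K * (b m + b (- e - m)) = circ_mean 1 (\<lambda>z. K * (?g z m + ?g (1 / z) (- m - e)))"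
      unfolding b_def circ_mean_cmult by (simp add: circ_mean_add[OF cg cg'])
    also have "\<dots> = circ_mean 1 (\<lambda>z. B1 * ?F1 z m - B2 * ?F2 z m)"
    proof (rule circ_mean_cong)
      fix z :: complex assume "norm z = norm (1 :: complex)"
      hence "norm z = 1" by simp
      from telescoper_symmetrized[OF adm prod sum this, of m]
      show "K * (?g z m + ?g (1 / z) (- m - e)) = B1 * ?F1 z m - B2 * ?F2 z m"
        unfolding K_def B1_def B2_def .
    qed
    also have "\<dots> = B1 * circ_mean 1 (\<lambda>z. ?F1 z m) - B2 * circ_mean 1 (\<lambda>z. ?F2 z m)"
      by (subst circ_mean_diff) (intro continuous_intros c1 c2 | simp add: circ_mean_cmult)+
    finally show ?thesis .
  qed
  have per: "b (m + int r) = b m" for m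
    unfolding b_def by (rule circ_mean_cong) (simp add: telescoper_periodic[OF adm prod sum])
  have "(\<Sum>m = 0..int r - 1. b (- e - m)) = (\<Sum>m = 0..int r - 1. b m)"
    by (rule sum_periodic_reflect[where a = b, OF r per])
  hence "(\<Sum>m = 0..int r - 1. K * (b m + b (- e - m))) = 0"
    using telescoper_sum_zero[OF adm prod sum] unfolding b_def by (simp add: sum_distrib_left[symmetric] sum.distrib)
  hence "B1 * beta_integral e x1 (qshift x2) x3 x4 x5 x6 - B2 * beta_integral e (qshift x1) x2 x3 x4 x5 x6 = 0"
    unfolding each beta_integral_def by (simp add: sum_subtractf sum_distrib_left)
  thus ?thesis unfolding B1_def B2_def by simp
qed

end

text \<open>The two relations identify points (n, t) with compact quotient, so the modulus attains a
  maximum. The maximum principle makes one of the functions constant, and shifts carry the constant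
  to all n. The bound \<alpha> < |q| makes room in the annulus for a full period |q| \<rho> <= |t|
  <= \<rho>.\<close>

lemma twisted_periodic_constant:
  fixes h :: "int \<Rightarrow> complex \<Rightarrow> complex" and q :: complex
  assumes r: "r > 0" and q: "q \<noteq> 0" "norm q < 1" and \<alpha>: "0 \<le> \<alpha>" "\<alpha> < norm q"
  defines "\<Omega> \<equiv> {t. \<alpha> < norm t \<and> norm t < 1}"
  assumes hol: "\<And>n. h n holomorphic_on \<Omega>"
    and per: "\<And>n t. t \<in> \<Omega> \<Longrightarrow> h (n + int r) t = h n t"
    and shift: "\<And>n t. t \<in> \<Omega> \<Longrightarrow> q * t \<in> \<Omega> \<Longrightarrow> h (n + 1) (q * t) = h n t"
    and t: "t \<in> \<Omega>" "t' \<in> \<Omega>"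
  shows "h n t = h n' t'"
proof -
  \<comment> \<open>Any value below 1 that exceeds |q| and \<alpha> / |q| would do: K then lies in
    \<Omega>, and points of \<Omega> beyond radius \<rho> enter K after one shift.\<close>
  define \<rho> where "\<rho> = (max (norm q) (\<alpha> / norm q) + 1) / 2"
  have qp: "norm q > 0" using q by simp
  have "\<alpha> / norm q < 1" using \<alpha> qp by simp
  hence \<rho>: "\<rho> < 1" "norm q < \<rho>" "\<alpha> / norm q < \<rho>"
    using q unfolding \<rho>_def by (auto simp: max_def field_simps)
  have \<rho>0: "0 < \<rho>" using \<rho> qp by linarith
  have \<alpha>\<rho>: "\<alpha> < norm q * \<rho>" using \<rho>(3) qp by (simp add: field_simps)
  have q\<rho>: "norm q * \<rho> < \<rho>" using \<rho>0 q by simp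
  define K where "K = cball 0 \<rho> - ball (0::complex) (norm q * \<rho>)"
  have K: "compact K" unfolding K_def by (intro compact_diff) auto
  have K_iff: "t \<in> K \<longleftrightarrow> norm q * \<rho> \<le> norm t \<and> norm t \<le> \<rho>" for t by (auto simp: K_def)
  have Kne: "K \<noteq> {}"
  proof -
    have "of_real \<rho> \<in> K" using \<rho>0 q\<rho> by (simp add: K_iff)
    thus ?thesis by blast
  qed
  have K\<Omega>: "K \<subseteq> \<Omega>" using \<rho> \<alpha>\<rho> by (auto simp: K_iff \<Omega>_def)
  have op: "open \<Omega>" unfolding \<Omega>_def by (intro open_Collect_conj open_Collect_less continuous_intros)
  have conn: "connected \<Omega>"
    using connected_annulus(1)[of \<alpha> "0::complex" 1] by (simp add: \<Omega>_def)
  have per': "h (n + k * int r) t = h n t" if "t \<in> \<Omega>" for n k t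
    by (rule periodic_int[of "\<lambda>n. h n t"]) (rule per[OF that])
  have "\<exists>t\<in>K. \<forall>u\<in>K. norm (h n u) \<le> norm (h n t)" for n
    using K\<Omega> by (intro continuous_attains_sup K Kne continuous_on_norm)
      (meson hol holomorphic_on_imp_continuous_on continuous_on_subset)
  then obtain \<tau> where \<tau>: "\<And>n. \<tau> n \<in> K" "\<And>n u. u \<in> K \<Longrightarrow> norm (h n u) \<le> norm (h n (\<tau> n))" by metis
  define M where "M = Max ((\<lambda>n. norm (h n (\<tau> n))) ` {0..<int r})"
  have "M \<in> (\<lambda>n. norm (h n (\<tau> n))) ` {0..<int r}" unfolding M_def using r by (intro Max_in) auto
  then obtain n0 where n0: "n0 \<in> {0..<int r}" "M = norm (h n0 (\<tau> n0))" by blast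
  have leM: "norm (h n u) \<le> M" if u: "u \<in> K" for n u
  proof -
    have "h n u = h (n mod int r + (n div int r) * int r) u" by simp
    also have "\<dots> = h (n mod int r) u" using u K\<Omega> by (intro per') auto
    finally have "norm (h n u) \<le> norm (h (n mod int r) (\<tau> (n mod int r)))" using \<tau>(2)[OF u] by metis
    also have "\<dots> \<le> M" unfolding M_def using r by (intro Max_ge) auto
    finally show ?thesis .
  qed
  \<comment> \<open>An open neighbourhood of K from which at most one shift, in either direction,
    leads into K; so the maximum over K bounds all of U.\<close>
  define U where "U = {t. norm q * (norm q * \<rho>) < norm t} \<inter> \<Omega>"
  have Uop: "open U" unfolding U_def by (intro open_Int op open_Collect_less continuous_intros)
  have leU: "norm (h n u) \<le> M" if u: "u \<in> U" for n u
  proof -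
    have u\<Omega>: "u \<in> \<Omega>" using u by (auto simp: U_def)
    consider "u \<in> K" | "\<rho> < norm u" | "norm u < norm q * \<rho>" by (force simp: K_iff)
    thus ?thesis
    proof cases
      case 2
      have "norm (q * u) < norm q * 1" unfolding norm_mult using u\<Omega> qp by (intro mult_strict_left_mono) (auto simp: \<Omega>_def)
      moreover have "norm q * \<rho> < norm (q * u)" unfolding norm_mult using 2 qp by simp
      ultimately have "q * u \<in> K" using \<rho> by (simp add: K_iff)
      moreover from this have "h (n + 1) (q * u) = h n u" using K\<Omega> u\<Omega> by (intro shift) auto
      ultimately show ?thesis using leM by metis
    next
      case 3
      define v where "v = u / q"
      have v: "u = q * v" using q by (simp add: v_def)
      have "norm v \<le> \<rho>" "norm q * \<rho> \<le> norm v"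
        using 3 u qp unfolding v_def U_def by (auto simp: norm_divide field_simps)
      hence vK: "v \<in> K" by (simp add: K_iff)
      have "h (n - 1 + 1) (q * v) = h (n - 1) v" using vK K\<Omega> u\<Omega> v by (intro shift) auto
      thus ?thesis using leM[OF vK, of "n - 1"] v by simp
    qed (use leM in auto)
  qed
  have "norm q * (norm q * \<rho>) < norm q * \<rho>" using q qp \<rho>0 by simp
  hence "\<tau> n0 \<in> U" using \<tau>(1)[of n0] K\<Omega> by (auto simp: U_def K_iff)
  hence "h n0 constant_on \<Omega>"
    using leU n0(2) by (intro maximum_modulus_principle[OF hol op conn Uop]) (auto simp: U_def)
  then obtain c where c: "\<And>t. t \<in> \<Omega> \<Longrightarrow> h n0 t = c" by (auto simp: constant_on_def)
  have all: "\<forall>t\<in>\<Omega>. h (n0 + int k) t = c" for k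
  proof (induction k)
    case 0
    thus ?case using c by simp
  next
    case (Suc k)
    \<comment> \<open>For |t| < |q| the shift relation at t / q gives the value c directly; the
      identity theorem extends it to \<Omega>.\<close>
    define V where "V = {t. norm t < norm q} \<inter> \<Omega>"
    have Vop: "open V" unfolding V_def by (intro open_Int op open_Collect_less continuous_intros)
    have Vne: "V \<noteq> {}"
    proof -
      have n: "norm (complex_of_real ((\<alpha> + norm q) / 2)) = (\<alpha> + norm q) / 2"
        unfolding norm_of_real using \<alpha> by simp
      have "complex_of_real ((\<alpha> + norm q) / 2) \<in> V"
        unfolding V_def \<Omega>_def Int_iff mem_Collect_eq n using \<alpha> q by simp
      thus ?thesis by blast
    qed
    have Vc: "h (n0 + int (Suc k)) v = c" if v: "v \<in> V" for v
    proof -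
      have "norm (v / q) < 1" using v qp by (simp add: V_def norm_divide)
      moreover have "\<alpha> < norm (v / q)"
      proof -
        have "v \<in> \<Omega>" using v unfolding V_def by blast
        hence "\<alpha> < norm v" unfolding \<Omega>_def by blast
        moreover have "norm v * norm q \<le> norm v * 1"
          by (rule mult_left_mono[OF less_imp_le[OF q(2)] norm_ge_zero])
        hence "norm v \<le> norm v / norm q" unfolding pos_le_divide_eq[OF qp] by (simp only: mult_1_right)
        ultimately show ?thesis unfolding norm_divide by (rule less_le_trans)
      qed
      ultimately have vq: "v / q \<in> \<Omega>" by (simp add: \<Omega>_def)
      have qv: "q * (v / q) = v" using q by simp
      have "v \<in> \<Omega>" using v unfolding V_def by blast
      with shift[OF vq, of "n0 + int k"] have "h (n0 + int k + 1) v = h (n0 + int k) (v / q)"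
        unfolding qv by blast
      also have "\<dots> = c" using Suc vq by blast
      finally have "h (n0 + int k + 1) v = c" .
      moreover have "n0 + int (Suc k) = n0 + int k + 1" by simp
      ultimately show ?thesis by (simp only:)
    qed
    have V\<Omega>: "V \<subseteq> \<Omega>" unfolding V_def by blast
    have "h (n0 + int (Suc k)) t = c" if "t \<in> \<Omega>" for t
      using analytic_continuation_open[OF Vop op Vne conn V\<Omega> hol holomorphic_on_const Vc that] .
    thus ?case by blast
  qed
  have "h n t = c" if "t \<in> \<Omega>" for n t
  proof -
    define k where "k = nat ((n - n0) mod int r)"
    have k: "n = n0 + int k + ((n - n0) div int r) * int r" unfolding k_def using r by simp
    have "h n t = h (n0 + int k) t" by (subst k) (rule per'[OF that])
    thus ?thesis using all that by simp
  qed
  thus ?thesis using t by simp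
qed

section \<open>Invariance of the ratio of integral and product\<close>

context rarefied
begin

lemma lam_exponent_diff:
  "lam_exponent (a1 + n + e) (s1 + s) - lam_exponent (a2 + n + e) (s2 + s) =
    (of_nat r - 1) * ((s1 + \<i> * of_real pi - (lp + lq) / 2) * (a1 + e + of_nat r / 2 + n)
      - (s2 + \<i> * of_real pi - (lp + lq) / 2) * (a2 + e + of_nat r / 2 + n)
      + s * (a1 - a2) + (lp - lq) / 2 * (a1 - a2) * (a1 + a2 + of_nat r + 2 * e + 2 * n))"
  unfolding lam_exponent_def right_diff_distrib[symmetric]
  by (rule arg_cong2[where f = "(*)", OF refl]) (simp add: field_simps power2_eq_square)

lemma lam_exponent_diff_pair:
  "(lam_exponent (a1 + e + m) (s1 + \<zeta>) + lam_exponent (a1 - m) (s1 - \<zeta>))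
    - (lam_exponent (a2 + e + m) (s2 + \<zeta>) + lam_exponent (a2 - m) (s2 - \<zeta>)) =
    (of_nat r - 1) * ((s1 + \<i> * of_real pi - (lp + lq) / 2) * (2 * a1 + e + of_nat r)
      - (s2 + \<i> * of_real pi - (lp + lq) / 2) * (2 * a2 + e + of_nat r)
      + (lp - lq) * (a1 - a2) * (a1 + a2 + of_nat r + e))"
  unfolding lam_exponent_def right_diff_distrib[symmetric] distrib_left[symmetric]
  by (rule arg_cong2[where f = "(*)", OF refl]) (simp add: field_simps power2_eq_square)

lemma sum_four_diffs:
  fixes c :: complex
  shows "c * (X * (A + n3) - Y * (B + n3) + s3 * D + F * (E + 2 * n3)) + c * (X * (A + n4) - Y * (B + n4) + s4 * D + F * (E + 2 * n4))
   + c * (X * (A + n5) - Y * (B + n5) + s5 * D + F * (E + 2 * n5)) + c * (X * (A + n6) - Y * (B + n6) + s6 * D + F * (E + 2 * n6))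
   = c * (X * (4 * A + (n3 + n4 + n5 + n6)) - Y * (4 * B + (n3 + n4 + n5 + n6)) + (s3 + s4 + s5 + s6) * D + F * (4 * E + 2 * (n3 + n4 + n5 + n6)))"
  by (simp add: algebra_simps)

lemma gcross_commute: "gcross e x y = gcross e y x"
  by (simp add: gcross_def mult.commute add.commute)

text \<open>The fifteen pair factors, grouped so that those affected by a q-shift of x1 or of x2
  stand together.\<close>

definition beta_product where
  "beta_product e x1 x2 x3 x4 x5 x6 =
     gcross e x1 x2 * (gcross e x1 x3 * gcross e x1 x4 * gcross e x1 x5 * gcross e x1 x6)
     * (gcross e x2 x3 * gcross e x2 x4 * gcross e x2 x5 * gcross e x2 x6)
     * (gcross e x3 x4 * gcross e x3 x5 * gcross e x3 x6 * gcross e x4 x5 * gcross e x4 x6 * gcross e x5 x6)"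

definition balanced where
  "balanced e x1 x2 x3 x4 x5 x6 \<longleftrightarrow>
     admissible x1 \<and> admissible x2 \<and> admissible x3 \<and> admissible x4 \<and> admissible x5 \<and> admissible x6 \<and>
     fst x1 * fst x2 * fst x3 * fst x4 * fst x5 * fst x6 = p * q \<and>
     snd x1 + snd x2 + snd x3 + snd x4 + snd x5 + snd x6 + 3 * e = 0"

lemma norm_prod4_less_1:
  assumes "admissible a" "admissible b" "admissible c" "admissible d"
  shows "norm (fst a * fst b * fst c * fst d) < 1"
proof -
  have *: "norm (u * v) < 1" if "norm u < 1" "norm v < 1" for u v :: complex
    using that mult_strict_mono'[of "norm u" 1 "norm v" 1] by (simp add: norm_mult)
  show ?thesis using assms by (auto simp: admissible_def intro!: *)
qed

text \<open>As all six first components multiply to pq, the other four push |pq| strictly below the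
  modulus of the argument, which therefore lies where reflection excludes zeros.\<close>

lemma gcross_nonzero:
  assumes "admissible a" "admissible b" "admissible c" "admissible d" "admissible x" "admissible y"
    and "fst x * fst y * (fst a * fst b * fst c * fst d) = p * q"
  shows "gcross e x y \<noteq> 0"
proof -
  have nz: "fst x * fst y \<noteq> 0" using assms by (auto simp: admissible_def)
  have "norm (p * q) = norm (fst x * fst y) * norm (fst a * fst b * fst c * fst d)"
    unfolding assms(7)[symmetric] by (simp add: norm_mult)
  also have "\<dots> < norm (fst x * fst y) * 1"
    using norm_prod4_less_1[OF assms(1-4)] nz by (intro mult_strict_left_mono) auto
  finally have 1: "norm (p * q) < norm (fst x * fst y)" by simp
  have "norm (fst x * fst y) < 1"
    using assms(5,6) mult_strict_mono'[of "norm (fst x)" 1 "norm (fst y)" 1] by (simp add: norm_mult admissible_def)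
  with 1 show ?thesis unfolding gcross_def by (intro G_nonzero)
qed

lemma beta_product_nonzero:
  assumes "balanced e x1 x2 x3 x4 x5 x6"
  shows "beta_product e x1 x2 x3 x4 x5 x6 \<noteq> 0"
proof -
  note a = assms[unfolded balanced_def]
  have p: "fst x1 * fst x2 * fst x3 * fst x4 * fst x5 * fst x6 = p * q" using a by simp
  have "gcross e x1 x2 \<noteq> 0" by (rule gcross_nonzero[of x3 x4 x5 x6]) (use a p in \<open>simp_all add: mult_ac\<close>)
  moreover have "gcross e x1 x3 \<noteq> 0" by (rule gcross_nonzero[of x2 x4 x5 x6]) (use a p in \<open>simp_all add: mult_ac\<close>)
  moreover have "gcross e x1 x4 \<noteq> 0" by (rule gcross_nonzero[of x3 x2 x5 x6]) (use a p in \<open>simp_all add: mult_ac\<close>)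
  moreover have "gcross e x1 x5 \<noteq> 0" by (rule gcross_nonzero[of x3 x4 x2 x6]) (use a p in \<open>simp_all add: mult_ac\<close>)
  moreover have "gcross e x1 x6 \<noteq> 0" by (rule gcross_nonzero[of x3 x4 x5 x2]) (use a p in \<open>simp_all add: mult_ac\<close>)
  moreover have "gcross e x2 x3 \<noteq> 0" by (rule gcross_nonzero[of x1 x4 x5 x6]) (use a p in \<open>simp_all add: mult_ac\<close>)
  moreover have "gcross e x2 x4 \<noteq> 0" by (rule gcross_nonzero[of x3 x1 x5 x6]) (use a p in \<open>simp_all add: mult_ac\<close>)
  moreover have "gcross e x2 x5 \<noteq> 0" by (rule gcross_nonzero[of x3 x4 x1 x6]) (use a p in \<open>simp_all add: mult_ac\<close>)
  moreover have "gcross e x2 x6 \<noteq> 0" by (rule gcross_nonzero[of x3 x4 x5 x1]) (use a p in \<open>simp_all add: mult_ac\<close>)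
  moreover have "gcross e x3 x4 \<noteq> 0" by (rule gcross_nonzero[of x1 x2 x5 x6]) (use a p in \<open>simp_all add: mult_ac\<close>)
  moreover have "gcross e x3 x5 \<noteq> 0" by (rule gcross_nonzero[of x1 x2 x4 x6]) (use a p in \<open>simp_all add: mult_ac\<close>)
  moreover have "gcross e x3 x6 \<noteq> 0" by (rule gcross_nonzero[of x1 x2 x5 x4]) (use a p in \<open>simp_all add: mult_ac\<close>)
  moreover have "gcross e x4 x5 \<noteq> 0" by (rule gcross_nonzero[of x1 x2 x3 x6]) (use a p in \<open>simp_all add: mult_ac\<close>)
  moreover have "gcross e x4 x6 \<noteq> 0" by (rule gcross_nonzero[of x1 x2 x5 x3]) (use a p in \<open>simp_all add: mult_ac\<close>)
  moreover have "gcross e x5 x6 \<noteq> 0" by (rule gcross_nonzero[of x1 x2 x3 x4]) (use a p in \<open>simp_all add: mult_ac\<close>)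
  ultimately show ?thesis by (simp add: beta_product_def)
qed

definition beta_ratio where
  "beta_ratio e x1 x2 x3 x4 x5 x6 = beta_integral e x1 x2 x3 x4 x5 x6 / beta_product e x1 x2 x3 x4 x5 x6"

lemma gcross_qshift:
  assumes "admissible x" "admissible y"
  shows "gcross e (qshift x) y = Th (fst x * fst y) (snd x + snd y + e) * gcross e x y"
proof -
  have "norm (fst x * fst y) < 1" "fst x * fst y \<noteq> 0"
    using assms mult_strict_mono'[of "norm (fst x)" 1 "norm (fst y)" 1] by (auto simp: norm_mult admissible_def)
  from G_shift[OF this(2,1), of "snd x + snd y + e"] show ?thesis
    by (simp add: gcross_def qshift_def algebra_simps)
qed

text \<open>By \<open>gcross_qshift\<close> the theta multipliers in
  \<open>beta_integral_shift\<close> are exactly those of the two products, so the ratio loses them.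
  They can be cancelled because both products are nonzero.\<close>

lemma beta_ratio_shift:
  assumes bal: "balanced e x1 (qshift x2) x3 x4 x5 x6" and x2: "admissible x2"
  shows "beta_ratio e (qshift x1) x2 x3 x4 x5 x6 = beta_ratio e x1 (qshift x2) x3 x4 x5 x6"
proof -
  have adm: "admissible x1" "admissible x2" "admissible x3" "admissible x4" "admissible x5" "admissible x6"
    using bal x2 by (auto simp: balanced_def)
  have "q * (fst x1 * fst x2 * fst x3 * fst x4 * fst x5 * fst x6) = q * p"
    using bal by (simp add: balanced_def qshift_def mult_ac)
  hence prod: "fst x1 * fst x2 * fst x3 * fst x4 * fst x5 * fst x6 = p" using q0 by simp
  have sum: "snd x1 + snd x2 + snd x3 + snd x4 + snd x5 + snd x6 + 3 * e = - 1"
    using bal by (simp add: balanced_def qshift_def)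
  have bal': "balanced e (qshift x1) x2 x3 x4 x5 x6"
    using adm admissible_qshift prod sum unfolding balanced_def by (auto simp: qshift_def mult_ac)
  have cc: "gcross e (qshift x1) x2 = gcross e x1 (qshift x2)"
    by (simp add: gcross_def qshift_def algebra_simps)
  define B1 where "B1 = Th (fst x1 * fst x3) (snd x1 + snd x3 + e) * Th (fst x1 * fst x4) (snd x1 + snd x4 + e)
      * Th (fst x1 * fst x5) (snd x1 + snd x5 + e) * Th (fst x1 * fst x6) (snd x1 + snd x6 + e)"
  define B2 where "B2 = Th (fst x2 * fst x3) (snd x2 + snd x3 + e) * Th (fst x2 * fst x4) (snd x2 + snd x4 + e)
      * Th (fst x2 * fst x5) (snd x2 + snd x5 + e) * Th (fst x2 * fst x6) (snd x2 + snd x6 + e)"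
  define C where "C = gcross e x1 (qshift x2) * (gcross e x1 x3 * gcross e x1 x4 * gcross e x1 x5 * gcross e x1 x6)
     * (gcross e x2 x3 * gcross e x2 x4 * gcross e x2 x5 * gcross e x2 x6)
     * (gcross e x3 x4 * gcross e x3 x5 * gcross e x3 x6 * gcross e x4 x5 * gcross e x4 x6 * gcross e x5 x6)"
  have P1: "beta_product e x1 (qshift x2) x3 x4 x5 x6 = B2 * C"
    unfolding beta_product_def C_def B2_def gcross_qshift[OF adm(2,3)] gcross_qshift[OF adm(2,4)]
      gcross_qshift[OF adm(2,5)] gcross_qshift[OF adm(2,6)] by (simp only: mult_ac)
  have P2: "beta_product e (qshift x1) x2 x3 x4 x5 x6 = B1 * C"
    unfolding beta_product_def C_def B1_def cc gcross_qshift[OF adm(1,3)] gcross_qshift[OF adm(1,4)]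
      gcross_qshift[OF adm(1,5)] gcross_qshift[OF adm(1,6)] by (simp only: mult_ac)
  have "B1 * beta_integral e x1 (qshift x2) x3 x4 x5 x6 = B2 * beta_integral e (qshift x1) x2 x3 x4 x5 x6"
    unfolding B1_def B2_def by (rule beta_integral_shift[OF adm prod sum])
  moreover have "B1 * C \<noteq> 0" "B2 * C \<noteq> 0"
    using beta_product_nonzero[OF bal] beta_product_nonzero[OF bal'] unfolding P1 P2 by auto
  ultimately show ?thesis unfolding beta_ratio_def P1 P2 by (simp add: divide_simps) (simp add: mult_ac)
qed

text \<open>Integrand and product take the same factor exp W, independent of z and m. The
  contributions of x3 to x6 to W depend only on their sums, which the balancing conditions express
  through x1 and x2.\<close>

lemma beta_ratio_periodic:
  assumes bal: "balanced e x1 x2 x3 x4 x5 x6"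
  shows "beta_ratio e (fst x1, snd x1 + int r) (fst x2, snd x2 - int r) x3 x4 x5 x6 = beta_ratio e x1 x2 x3 x4 x5 x6"
proof -
  let ?y1 = "(fst x1, snd x1 + int r)" and ?y2 = "(fst x2, snd x2 - int r)"
  have adm: "admissible x1" "admissible x2" "admissible x3" "admissible x4" "admissible x5" "admissible x6"
    using bal by (auto simp: balanced_def)
  have sum: "snd x1 + snd x2 + snd x3 + snd x4 + snd x5 + snd x6 + 3 * e = 0" using bal by (simp add: balanced_def)
  define s1 s2 s3 s4 s5 where "s1 = Ln (fst x1)" "s2 = Ln (fst x2)" "s3 = Ln (fst x3)" "s4 = Ln (fst x4)" "s5 = Ln (fst x5)"
  define s6 where "s6 = lp + lq - s1 - s2 - s3 - s4 - s5"
  have nz: "fst x1 \<noteq> 0" "fst x2 \<noteq> 0" "fst x3 \<noteq> 0" "fst x4 \<noteq> 0" "fst x5 \<noteq> 0" "fst x6 \<noteq> 0"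
    using adm by (auto simp: admissible_def)
  have t': "fst x1 = exp s1" "fst x2 = exp s2" "fst x3 = exp s3" "fst x4 = exp s4" "fst x5 = exp s5"
    using nz by (simp_all add: s1_s2_s3_s4_s5_def)
  have "fst x1 * fst x2 * fst x3 * fst x4 * fst x5 * fst x6 = p * q" using bal by (simp add: balanced_def)
  hence "fst x6 = exp s6"
    using nz unfolding s6_def exp_diff exp_add t'[symmetric] by (simp add: p_exp q_exp field_simps)
  note t = t' this
  define W where "W = lam_exponent (of_int (snd x1 + snd x3 + e)) (s1 + s3) + lam_exponent (of_int (snd x1 + snd x4 + e)) (s1 + s4)
     + lam_exponent (of_int (snd x1 + snd x5 + e)) (s1 + s5) + lam_exponent (of_int (snd x1 + snd x6 + e)) (s1 + s6)
     - lam_exponent (of_int (snd x2 - int r + snd x3 + e)) (s2 + s3) - lam_exponent (of_int (snd x2 - int r + snd x4 + e)) (s2 + s4)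
     - lam_exponent (of_int (snd x2 - int r + snd x5 + e)) (s2 + s5) - lam_exponent (of_int (snd x2 - int r + snd x6 + e)) (s2 + s6)"
  have lt: "norm (exp (s + s')) < 1" if "admissible x" "admissible y" "fst x = exp s" "fst y = exp s'" for x y s s'
    using that mult_strict_mono'[of "norm (fst x)" 1 "norm (fst y)" 1] by (simp add: norm_mult admissible_def exp_add)
  have up: "gcross e ?y1 y = exp (lam_exponent (of_int (snd x1 + snd y + e)) (s1 + s)) * gcross e x1 y"
    if "admissible y" "fst y = exp s" for y s
    unfolding gcross_def fst_conv snd_conv using lt[OF adm(1) that(1) t(1) that(2)] that t
    by (intro G_quasi_ex) (auto simp: exp_add)
  have down: "gcross e ?y2 y = exp (- lam_exponent (of_int (snd x2 - int r + snd y + e)) (s2 + s)) * gcross e x2 y"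
    if "admissible y" "fst y = exp s" for y s
  proof -
    have "gcross e ?y2 y = exp (- lam_exponent (of_int (snd x2 + snd y + e) - of_nat r) (s2 + s)) * gcross e x2 y"
      unfolding gcross_def fst_conv snd_conv using lt[OF adm(2) that(1) t(2) that(2)] that t
      by (intro G_quasi_ex') (auto simp: exp_add)
    moreover have "of_int (snd x2 + snd y + e) - of_nat r = (of_int (snd x2 - int r + snd y + e) :: complex)" by simp
    ultimately show ?thesis by (simp only:)
  qed
  have c12: "gcross e ?y1 ?y2 = gcross e x1 x2" by (simp add: gcross_def)
  have P: "beta_product e ?y1 ?y2 x3 x4 x5 x6 = exp W * beta_product e x1 x2 x3 x4 x5 x6"
  proof -
    have "exp W = exp (lam_exponent (of_int (snd x1 + snd x3 + e)) (s1 + s3)) * exp (lam_exponent (of_int (snd x1 + snd x4 + e)) (s1 + s4))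
     * exp (lam_exponent (of_int (snd x1 + snd x5 + e)) (s1 + s5)) * exp (lam_exponent (of_int (snd x1 + snd x6 + e)) (s1 + s6))
     * exp (- lam_exponent (of_int (snd x2 - int r + snd x3 + e)) (s2 + s3)) * exp (- lam_exponent (of_int (snd x2 - int r + snd x4 + e)) (s2 + s4))
     * exp (- lam_exponent (of_int (snd x2 - int r + snd x5 + e)) (s2 + s5)) * exp (- lam_exponent (of_int (snd x2 - int r + snd x6 + e)) (s2 + s6))"
      unfolding exp_add[symmetric] by (rule arg_cong[where f = exp]) (simp add: W_def)
    thus ?thesis
      unfolding beta_product_def c12 up[OF adm(3) t(3)] up[OF adm(4) t(4)] up[OF adm(5) t(5)] up[OF adm(6) t(6)]
        down[OF adm(3) t(3)] down[OF adm(4) t(4)] down[OF adm(5) t(5)] down[OF adm(6) t(6)]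
      by (simp only: mult_ac)
  qed
  have F: "beta_integrand e ?y1 ?y2 x3 x4 x5 x6 z m = exp W * beta_integrand e x1 x2 x3 x4 x5 x6 z m" if z: "norm z = 1" for z m
  proof -
    have z0: "z \<noteq> 0" using z by auto
    define \<zeta> where "\<zeta> = Ln z"
    have \<zeta>: "z = exp \<zeta>" using z0 by (simp add: \<zeta>_def)
    have lz: "norm (fst x * z) < 1" "norm (fst x / z) < 1" "fst x * z = exp (s + \<zeta>)" "fst x / z = exp (s - \<zeta>)"
      if "admissible x" "fst x = exp s" for x s
      using that z by (auto simp: admissible_def norm_mult norm_divide \<zeta> exp_add exp_diff)
    have g1: "gpair e ?y1 z m = exp (lam_exponent (of_int (snd x1 + e + m)) (s1 + \<zeta>) + lam_exponent (of_int (snd x1 - m)) (s1 - \<zeta>)) * gpair e x1 z m"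
    proof -
      have "G (fst x1 * z) (snd x1 + int r + e + m) = exp (lam_exponent (of_int (snd x1 + e + m)) (s1 + \<zeta>)) * G (fst x1 * z) (snd x1 + e + m)"
        using lz[OF adm(1) t(1)] by (intro G_quasi_ex) simp_all
      moreover have "G (fst x1 / z) (snd x1 + int r - m) = exp (lam_exponent (of_int (snd x1 - m)) (s1 - \<zeta>)) * G (fst x1 / z) (snd x1 - m)"
        using lz[OF adm(1) t(1)] by (intro G_quasi_ex) simp_all
      ultimately show ?thesis by (simp add: gpair_def exp_add)
    qed
    have g2: "gpair e ?y2 z m = exp (- lam_exponent (of_int (snd x2 + e + m) - of_nat r) (s2 + \<zeta>) - lam_exponent (of_int (snd x2 - m) - of_nat r) (s2 - \<zeta>)) * gpair e x2 z m"
    proof -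
      have "G (fst x2 * z) (snd x2 - int r + e + m) = exp (- lam_exponent (of_int (snd x2 + e + m) - of_nat r) (s2 + \<zeta>)) * G (fst x2 * z) (snd x2 + e + m)"
        using lz[OF adm(2) t(2)] by (intro G_quasi_ex') simp_all
      moreover have "G (fst x2 / z) (snd x2 - int r - m) = exp (- lam_exponent (of_int (snd x2 - m) - of_nat r) (s2 - \<zeta>)) * G (fst x2 / z) (snd x2 - m)"
        using lz[OF adm(2) t(2)] by (intro G_quasi_ex') simp_all
      ultimately show ?thesis by (simp add: gpair_def exp_diff exp_minus field_simps)
    qed
    define I where "I = \<i> * complex_of_real pi"
    define R where "R = (of_nat r :: complex)"
    define N1 N2 N3 N4 N5 N6 E M :: complex where "N1 = of_int (snd x1)" "N2 = of_int (snd x2)" "N3 = of_int (snd x3)" "N4 = of_int (snd x4)"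
      "N5 = of_int (snd x5)" "N6 = of_int (snd x6)" "E = of_int e" "M = of_int m"
    note N = N1_N2_N3_N4_N5_N6_E_M_def
    have "snd x6 = - 3 * e - snd x1 - snd x2 - snd x3 - snd x4 - snd x5" using sum by simp
    hence sums: "N3 + N4 + N5 + N6 = - 3 * E - N1 - N2" "s3 + s4 + s5 + s6 = lp + lq - s1 - s2"
      by (simp_all add: N s6_def)
    have W: "W = (R - 1) * ((s1 + I - (lp + lq) / 2) * (4 * (N1 + E + R / 2) + (- 3 * E - N1 - N2))
      - (s2 + I - (lp + lq) / 2) * (4 * (N2 - R + E + R / 2) + (- 3 * E - N1 - N2))
      + (lp + lq - s1 - s2) * (N1 - (N2 - R)) + (lp - lq) / 2 * (N1 - (N2 - R)) * (4 * (N1 + (N2 - R) + R + 2 * E) + 2 * (- 3 * E - N1 - N2)))"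
    proof -
      have "W = (lam_exponent (N1 + N3 + E) (s1 + s3) - lam_exponent (N2 - R + N3 + E) (s2 + s3))
        + (lam_exponent (N1 + N4 + E) (s1 + s4) - lam_exponent (N2 - R + N4 + E) (s2 + s4))
        + (lam_exponent (N1 + N5 + E) (s1 + s5) - lam_exponent (N2 - R + N5 + E) (s2 + s5))
        + (lam_exponent (N1 + N6 + E) (s1 + s6) - lam_exponent (N2 - R + N6 + E) (s2 + s6))"
        by (simp add: W_def N R_def)
      thus ?thesis
        unfolding lam_exponent_diff R_def[symmetric] I_def[symmetric] sum_four_diffs sums by (simp only: mult.assoc)
    qed
    have key: "exp ((lam_exponent (of_int (snd x1 + e + m)) (s1 + \<zeta>) + lam_exponent (of_int (snd x1 - m)) (s1 - \<zeta>))
        + (- lam_exponent (of_int (snd x2 + e + m) - of_nat r) (s2 + \<zeta>) - lam_exponent (of_int (snd x2 - m) - of_nat r) (s2 - \<zeta>))) = exp W"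
    \<comment> \<open>The exponent of the integrand and W differ by 2 pi i (r - 1)(n2 - n1 - r),
      where n1 and n2 are the labels of x1 and x2.\<close>
    proof (rule exp_eqI_int[of _ _ "(int r - 1) * (snd x2 - snd x1 - int r)"])
      show "(lam_exponent (of_int (snd x1 + e + m)) (s1 + \<zeta>) + lam_exponent (of_int (snd x1 - m)) (s1 - \<zeta>))
        + (- lam_exponent (of_int (snd x2 + e + m) - of_nat r) (s2 + \<zeta>) - lam_exponent (of_int (snd x2 - m) - of_nat r) (s2 - \<zeta>))
        = W + 2 * of_int ((int r - 1) * (snd x2 - snd x1 - int r)) * (\<i> * of_real pi)"
        (is "?L = ?R")
      proof -
        have "?L = (lam_exponent (N1 + E + M) (s1 + \<zeta>) + lam_exponent (N1 - M) (s1 - \<zeta>))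
          - (lam_exponent ((N2 - R) + E + M) (s2 + \<zeta>) + lam_exponent ((N2 - R) - M) (s2 - \<zeta>))"
          by (simp add: N R_def algebra_simps)
        also have "\<dots> = (R - 1) * ((s1 + I - (lp + lq) / 2) * (2 * N1 + E + R)
          - (s2 + I - (lp + lq) / 2) * (2 * (N2 - R) + E + R)
          + (lp - lq) * (N1 - (N2 - R)) * (N1 + (N2 - R) + R + E))"
          unfolding lam_exponent_diff_pair R_def[symmetric] I_def[symmetric] ..
        also have "\<dots> = W + (R - 1) * (2 * (N2 - N1 - R) * I)"
          unfolding W distrib_left[symmetric]
          by (rule arg_cong2[where f = "(*)", OF refl]) (simp add: field_simps)
        also have "\<dots> = ?R" by (simp add: N R_def I_def)
        finally show ?thesis .
      qed
    qed
    show ?thesis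
      unfolding beta_integrand_def g1 g2 key[symmetric] exp_add[of "_ + _" "_ - _"] by (simp only: mult_ac)
  qed
  have "beta_integral e ?y1 ?y2 x3 x4 x5 x6 = exp W * beta_integral e x1 x2 x3 x4 x5 x6"
    unfolding beta_integral_def sum_distrib_left circ_mean_cmult[symmetric]
    by (intro sum.cong refl circ_mean_cong F) simp
  thus ?thesis unfolding beta_ratio_def P by simp
qed


lemma beta_integrand_holomorphic_param:
  assumes U: "open U"
    and f: "\<And>i. i \<in> {1..6::nat} \<Longrightarrow> f i holomorphic_on U" "\<And>i w. i \<in> {1..6} \<Longrightarrow> w \<in> U \<Longrightarrow> f i w \<noteq> 0 \<and> norm (f i w) < 1"
  shows "(\<lambda>w. beta_integral e (f 1 w, n1) (f 2 w, n2) (f 3 w, n3) (f 4 w, n4) (f 5 w, n5) (f 6 w, n6)) holomorphic_on U"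
proof -
  have hol: "(\<lambda>w. gpair e (f i w, n) z m) holomorphic_on U" if "i \<in> {1..6}" "norm z = 1" for i n m z
    unfolding gpair_def fst_conv snd_conv using f[OF that(1)] that(2)
    by (intro holomorphic_intros G_holomorphic_comp) (auto simp: norm_mult norm_divide)
  have fc: "continuous_on (U \<times> sphere 0 1) (\<lambda>wz. f i (fst wz))" if "i \<in> {1..6}" for i
    by (rule continuous_on_compose2[OF holomorphic_on_imp_continuous_on[OF f(1)[OF that]]]) (auto intro!: continuous_intros)
  have cont: "continuous_on (U \<times> sphere 0 1) (\<lambda>wz. gpair e (f i (fst wz), n) (snd wz) m)" if "i \<in> {1..6}" for i n m
    unfolding gpair_def fst_conv snd_conv using f(2)[OF that]
    by (intro continuous_intros G_continuous_comp fc that) (auto simp: norm_mult norm_divide)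
  have contd: "continuous_on (U \<times> sphere 0 1) (\<lambda>wz. gdenom e (snd wz) m)" for m
    by (rule continuous_on_compose2[OF gdenom_continuous]) (auto intro!: continuous_intros)
  show ?thesis
    unfolding beta_integral_def
  proof (intro holomorphic_on_sum circ_mean_holomorphic U)
    fix m
    show "continuous_on (U \<times> sphere 0 1) (\<lambda>(w, z). beta_integrand e (f 1 w, n1) (f 2 w, n2) (f 3 w, n3) (f 4 w, n4) (f 5 w, n5) (f 6 w, n6) z m)"
      unfolding beta_integrand_def split_beta by (intro continuous_on_mult cont contd) auto
    fix z :: complex assume "norm z = 1"
    thus "(\<lambda>w. beta_integrand e (f 1 w, n1) (f 2 w, n2) (f 3 w, n3) (f 4 w, n4) (f 5 w, n5) (f 6 w, n6) z m) holomorphic_on U"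
      unfolding beta_integrand_def by (intro holomorphic_on_mult hol holomorphic_on_const) auto
  qed
qed

lemma beta_product_holomorphic_param:
  assumes f: "\<And>i. i \<in> {1..6::nat} \<Longrightarrow> f i holomorphic_on U" "\<And>i w. i \<in> {1..6} \<Longrightarrow> w \<in> U \<Longrightarrow> f i w \<noteq> 0 \<and> norm (f i w) < 1"
  shows "(\<lambda>w. beta_product e (f 1 w, n1) (f 2 w, n2) (f 3 w, n3) (f 4 w, n4) (f 5 w, n5) (f 6 w, n6)) holomorphic_on U"
proof -
  have hol: "(\<lambda>w. gcross e (f i w, n) (f j w, n')) holomorphic_on U" if "i \<in> {1..6}" "j \<in> {1..6}" for i j n n'
    unfolding gcross_def fst_conv snd_conv
  proof (intro holomorphic_on_mult G_holomorphic_comp f that)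
    fix w assume "w \<in> U"
    thus "f i w * f j w \<noteq> 0 \<and> norm (f i w * f j w) < 1"
      using f(2)[OF that(1), of w] f(2)[OF that(2), of w] mult_strict_mono'[of "norm (f i w)" 1 "norm (f j w)" 1]
      by (simp add: norm_mult)
  qed
  show ?thesis unfolding beta_product_def by (intro holomorphic_on_mult hol) auto
qed

text \<open>With x3 to x6 fixed, t1 t2 and n1 + n2 are determined, so the ratio is a function of t1
  and n1 alone. Shift and periodicity put it under \<open>twisted_periodic_constant\<close> on |t1
  t2| < |t| < 1, whence the condition |t1 t2| < |q|.\<close>

lemma beta_ratio_move:
  assumes x: "balanced e x1 x2 x3 x4 x5 x6" and y: "balanced e y1 y2 x3 x4 x5 x6"
    and small: "norm (fst x1 * fst x2) < norm q"
  shows "beta_ratio e x1 x2 x3 x4 x5 x6 = beta_ratio e y1 y2 x3 x4 x5 x6"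
proof -
  define A where "A = fst x1 * fst x2"
  define N where "N = snd x1 + snd x2"
  have adm: "admissible x1" "admissible x2" "admissible x3" "admissible x4" "admissible x5" "admissible x6"
    "admissible y1" "admissible y2"
    using x y by (auto simp: balanced_def)
  have A0: "A \<noteq> 0" using adm by (simp add: A_def admissible_def)
  have nz: "fst x3 * fst x4 * fst x5 * fst x6 \<noteq> 0" using adm by (simp add: admissible_def)
  have pA: "A * (fst x3 * fst x4 * fst x5 * fst x6) = p * q" using x by (simp add: balanced_def A_def mult_ac)
  have "fst y1 * fst y2 * (fst x3 * fst x4 * fst x5 * fst x6) = p * q" using y by (simp add: balanced_def mult_ac)
  hence Ay: "fst y1 * fst y2 = A" using pA nz by (metis mult_right_cancel)
  have sN: "N + snd x3 + snd x4 + snd x5 + snd x6 + 3 * e = 0" using x by (simp add: balanced_def N_def)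
  have Ny: "snd y1 + snd y2 = N" using y sN by (simp add: balanced_def)
  define \<Omega> where "\<Omega> = {t :: complex. norm A < norm t \<and> norm t < 1}"
  have op: "open \<Omega>" unfolding \<Omega>_def by (intro open_Collect_conj open_Collect_less continuous_intros)
  have \<Omega>: "t \<noteq> 0" "norm t < 1" "A / t \<noteq> 0" "norm (A / t) < 1" if "t \<in> \<Omega>" for t
  proof -
    show "norm t < 1" using that by (simp add: \<Omega>_def)
    have "norm A < norm t" using that by (simp add: \<Omega>_def)
    thus t0: "t \<noteq> 0" by auto
    show "A / t \<noteq> 0" using t0 A0 by simp
    show "norm (A / t) < 1" using \<open>norm A < norm t\<close> t0 by (simp add: norm_divide)
  qed
  have bal: "balanced e (t, n) (A / t, N - n) x3 x4 x5 x6" if "t \<in> \<Omega>" for t n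
    unfolding balanced_def using \<Omega>[OF that] adm pA sN by (simp add: admissible_def mult.assoc)
  define h where "h = (\<lambda>n t. beta_ratio e (t, n) (A / t, N - n) x3 x4 x5 x6)"
  define f where "f = (\<lambda>(i::nat) t. if i = 1 then t else if i = 2 then A / t else if i = 3 then fst x3 else if i = 4 then fst x4 else if i = 5 then fst x5 else fst x6)"
  have f_hol: "f i holomorphic_on \<Omega>" for i
    unfolding f_def using \<Omega> by (cases "i = 1"; cases "i = 2") (auto intro!: holomorphic_intros)
  have f_nz: "f i w \<noteq> 0 \<and> norm (f i w) < 1" if "w \<in> \<Omega>" for i w
    unfolding f_def using \<Omega>[OF that] adm by (simp add: admissible_def)
  have hol: "h n holomorphic_on \<Omega>" for n
  proof -
    have "(\<lambda>w. beta_integral e (w, n) (A / w, N - n) x3 x4 x5 x6) holomorphic_on \<Omega>"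
      using beta_integrand_holomorphic_param[where f = f and e = e and ?n1.0 = n and ?n2.0 = "N - n" and ?n3.0 = "snd x3"
          and ?n4.0 = "snd x4" and ?n5.0 = "snd x5" and ?n6.0 = "snd x6", OF op f_hol f_nz]
      by (simp add: f_def)
    moreover have "(\<lambda>w. beta_product e (w, n) (A / w, N - n) x3 x4 x5 x6) holomorphic_on \<Omega>"
      using beta_product_holomorphic_param[where f = f and e = e and ?n1.0 = n and ?n2.0 = "N - n" and ?n3.0 = "snd x3"
          and ?n4.0 = "snd x4" and ?n5.0 = "snd x5" and ?n6.0 = "snd x6", OF f_hol f_nz]
      by (simp add: f_def)
    ultimately show ?thesis
      unfolding h_def beta_ratio_def using beta_product_nonzero[OF bal] by (intro holomorphic_on_divide)
  qed
  have per: "h (n + int r) t = h n t" if "t \<in> \<Omega>" for n t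
    using beta_ratio_periodic[OF bal[OF that, of n]] by (simp add: h_def algebra_simps)
  have shift: "h (n + 1) (q * t) = h n t" if "t \<in> \<Omega>" "q * t \<in> \<Omega>" for n t
  proof -
    let ?x2 = "(A / (q * t), N - (n + 1))"
    have e1: "qshift ?x2 = (A / t, N - n)" "qshift (t, n) = (q * t, n + 1)" using q0 by (simp_all add: qshift_def)
    have "balanced e (t, n) (qshift ?x2) x3 x4 x5 x6" unfolding e1 by (rule bal[OF that(1)])
    moreover have "admissible ?x2" using \<Omega>[OF that(2)] by (simp add: admissible_def)
    ultimately have "beta_ratio e (qshift (t, n)) ?x2 x3 x4 x5 x6 = beta_ratio e (t, n) (qshift ?x2) x3 x4 x5 x6"
      by (rule beta_ratio_shift)
    thus ?thesis unfolding e1 h_def .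
  qed
  have mem: "fst x1 \<in> \<Omega>" "fst y1 \<in> \<Omega>"
  proof -
    have less: "norm (u * v) < norm u" if "u \<noteq> 0" "norm v < 1" for u v :: complex
      using mult_strict_left_mono[of "norm v" 1 "norm u"] that by (simp add: norm_mult)
    have "norm A < norm (fst x1)" unfolding A_def using adm by (intro less) (auto simp: admissible_def)
    moreover have "norm A < norm (fst y1)" unfolding Ay[symmetric] using adm by (intro less) (auto simp: admissible_def)
    ultimately show "fst x1 \<in> \<Omega>" "fst y1 \<in> \<Omega>" using adm by (auto simp: \<Omega>_def admissible_def)
  qed
  have "h (snd x1) (fst x1) = h (snd y1) (fst y1)"
    using twisted_periodic_constant[OF r q0 nq, of "norm A" h "fst x1" "fst y1" "snd x1" "snd y1"]
      hol per shift mem small unfolding \<Omega>_def A_def by simp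
  moreover have "(fst x1, snd x1) = x1" "(A / fst x1, N - snd x1) = x2" "(fst y1, snd y1) = y1" "(A / fst y1, N - snd y1) = y2"
  proof -
    show "(fst x1, snd x1) = x1" "(fst y1, snd y1) = y1" by simp_all
    have "A / fst x1 = fst x2" unfolding A_def using adm by (simp add: admissible_def)
    thus "(A / fst x1, N - snd x1) = x2" by (simp add: N_def prod_eq_iff)
    have "A / fst y1 = fst y2" unfolding Ay[symmetric] using adm by (simp add: admissible_def)
    moreover have "N - snd y1 = snd y2" using Ny by simp
    ultimately show "(A / fst y1, N - snd y1) = y2" by (simp add: prod_eq_iff)
  qed
  ultimately show ?thesis by (simp add: h_def)
qed

lemma beta_ratio_swap23: "beta_ratio e x1 x2 x3 x4 x5 x6 = beta_ratio e x1 x3 x2 x4 x5 x6"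
proof -
  have "beta_integrand e x1 x2 x3 x4 x5 x6 = beta_integrand e x1 x3 x2 x4 x5 x6"
    by (intro ext) (simp only: beta_integrand_def mult_ac)
  moreover have "beta_product e x1 x2 x3 x4 x5 x6 = beta_product e x1 x3 x2 x4 x5 x6"
    unfolding beta_product_def gcross_commute[of e x3 x2] by (simp only: mult_ac)
  ultimately show ?thesis by (simp add: beta_ratio_def beta_integral_def)
qed

lemma balanced_swap23: "balanced e x1 x2 x3 x4 x5 x6 \<Longrightarrow> balanced e x1 x3 x2 x4 x5 x6"
  by (auto simp: balanced_def mult_ac)

section \<open>Evaluation of the beta integral\<close>

lemma G_tendsto:
  assumes "(f \<longlongrightarrow> l) F" "l \<noteq> 0" "norm l < 1"
  shows "((\<lambda>x. G (f x) k) \<longlongrightarrow> G l k) F"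
proof -
  have op: "open (ball 0 1 - {0::complex})" by auto
  have "isCont (\<lambda>z. G z k) l"
    by (rule continuous_on_eq_continuous_at[THEN iffD1, rule_format, OF op holomorphic_on_imp_continuous_on[OF G_holomorphic]])
       (use assms in auto)
  from isCont_tendsto_compose[OF this assms(1)] show ?thesis .
qed

lemma Hh_continuous_comp:
  assumes "continuous_on A g" "\<And>z. z \<in> A \<Longrightarrow> g z \<noteq> 0 \<and> norm (g z) \<le> 1"
  shows "continuous_on A (\<lambda>z. Hh m (g z))"
  by (rule continuous_on_compose2[OF Hh_continuous assms(1)]) (use assms(2) in \<open>auto simp: punct_def\<close>)

lemma G_Hh: "u \<noteq> 0 \<Longrightarrow> norm u < 1 \<Longrightarrow> (1 - u) * G u k = Hh k u"
  using G_eq[of u k] by (cases "u = 1") (auto simp: punct_def)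

text \<open>\<open>Hh 0 1\<close> is the constant 1 / ((p^r;p^r) (q^r;q^r)); it stays abstract
  because the transformation formula involves it only as a common nonzero factor. The bound |t1| <
  |q| makes |t1 t2| and |t1 t2 t3| smaller than |q|, on which the two moves rest.\<close>

theorem beta_evaluation:
  assumes x: "balanced e x1 x2 x3 x4 x5 x6" and small: "norm (fst x1) < norm q"
  shows "beta_integral e x1 x2 x3 x4 x5 x6 = 2 * Hh 0 1 * beta_product e x1 x2 x3 x4 x5 x6"
proof -
  have adm: "admissible x1" "admissible x2" "admissible x3" "admissible x4" "admissible x5" "admissible x6"
    using x by (auto simp: balanced_def)
  have nz: "fst x1 \<noteq> 0" "fst x2 \<noteq> 0" "fst x3 \<noteq> 0" "fst x4 \<noteq> 0" "fst x5 \<noteq> 0" "fst x6 \<noteq> 0"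
    and lt1: "norm (fst x1) < 1" "norm (fst x2) < 1" "norm (fst x3) < 1" "norm (fst x4) < 1" "norm (fst x5) < 1" "norm (fst x6) < 1"
    using adm by (auto simp: admissible_def)
  define A where "A = fst x1 * fst x2 * fst x3"
  define N where "N = snd x1 + snd x2 + snd x3 + e"
  have A0: "A \<noteq> 0" using nz by (simp add: A_def)
  have pA: "A * (fst x4 * fst x5 * fst x6) = p * q" using x by (simp add: balanced_def A_def mult_ac)
  have sN: "N + snd x4 + snd x5 + snd x6 + 2 * e = 0" using x by (simp add: balanced_def N_def)
  have lt12: "norm (fst x1 * fst x2) < norm q"
    using small lt1 mult_strict_mono'[of "norm (fst x1)" "norm q" "norm (fst x2)" 1] by (simp add: norm_mult)
  have ltA: "norm A < norm q"
    using lt12 lt1 mult_strict_mono'[of "norm (fst x1 * fst x2)" "norm q" "norm (fst x3)" 1] by (simp add: norm_mult A_def)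
  \<comment> \<open>Every \<rho> < 1 with \<rho>^2 > M meets the size conditions of both moves; the
    lower bound \<open>a\<close> for \<rho> lies halfway between sqrt M and 1.\<close>
  define M where "M = max (norm (fst x1 * fst x2)) (norm A / norm q)"
  have qp: "0 < norm q" using q0 by simp
  have M: "0 \<le> M" "M < 1" using lt12 nq ltA qp by (simp_all add: M_def le_max_iff_disj)
  define b :: real where "b = sqrt M"
  define a :: real where "a = (1 + b) / 2"
  have sM: "0 \<le> sqrt M" "sqrt M < 1" using M by simp_all
  have "0 < a \<and> a < 1 \<and> b < a" using sM[folded b_def] unfolding a_def by (auto simp: field_simps)
  hence a: "0 < a" "a < 1" "sqrt M < a" by (simp_all add: b_def)
  have asq: "M < \<rho> ^ 2" if "a \<le> \<rho>" for \<rho>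
  proof -
    have "sqrt M < \<rho>" using a that by linarith
    hence "sqrt M ^ 2 < \<rho> ^ 2" using M by (intro power_strict_mono) auto
    thus ?thesis using M by simp
  qed
  \<comment> \<open>With the labels 0 and -e, the gamma factors that become singular at z = i carry
    the labels m and -m. Poles occur only if r divides m, so only m = 0 contributes there; y1
    absorbs what the balancing conditions leave.\<close>
  define y1 where "y1 = (\<lambda>\<rho>::real. (A / of_real \<rho> ^ 2, N))"
  define y2 where "y2 = (\<lambda>\<rho>::real. (of_real \<rho> * \<i>, 0::int))"
  define y3 where "y3 = (\<lambda>\<rho>::real. (- of_real \<rho> * \<i>, - e))"
  have y1lt: "norm (A / of_real \<rho> ^ 2) < 1" if "a \<le> \<rho>" for \<rho>
  proof -
    have \<rho>0: "0 < \<rho>" using a that by linarith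
    have "norm A \<le> norm A / norm q" using nq qp by (simp add: field_simps mult_left_le)
    also have "\<dots> \<le> M" by (simp add: M_def)
    also have "\<dots> < \<rho> ^ 2" by (rule asq[OF that])
    finally show ?thesis using \<rho>0 by (simp add: norm_divide norm_power)
  qed
  define K where "K = beta_ratio e x1 x2 x3 x4 x5 x6"
  have ratio: "beta_ratio e (y1 \<rho>) (y2 \<rho>) (y3 \<rho>) x4 x5 x6 = K" and bal: "balanced e (y1 \<rho>) (y2 \<rho>) (y3 \<rho>) x4 x5 x6"
    if \<rho>: "a \<le> \<rho>" "\<rho> < 1" for \<rho>
  proof -
    have \<rho>0: "0 < \<rho>" using a \<rho> by linarith
    have \<rho>2: "\<rho> ^ 2 \<le> \<rho>" using \<rho> \<rho>0 by (simp add: power2_eq_square)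
    \<comment> \<open>The first move turns (x1, x2) into w and i \<rho>. The second one acts on w
      and x3, after an exchange of the second and third parameters.\<close>
    define w where "w = (fst x1 * fst x2 / (of_real \<rho> * \<i>), snd x1 + snd x2)"
    have "norm (fst x1 * fst x2) \<le> M" by (simp add: M_def)
    also have "\<dots> < \<rho>" using asq[OF \<rho>(1)] \<rho>2 by linarith
    finally have wadm: "admissible w"
      using nz \<rho>0 by (simp add: w_def admissible_def norm_divide norm_mult)
    have b1: "balanced e w (y2 \<rho>) x3 x4 x5 x6"
      using adm wadm \<rho> \<rho>0 x unfolding balanced_def by (simp add: y2_def w_def admissible_def norm_mult)
    have r1: "K = beta_ratio e w (y2 \<rho>) x3 x4 x5 x6"
      unfolding K_def by (rule beta_ratio_move[OF x b1 lt12])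
    have "norm (fst w * fst x3) = norm A / \<rho>" using \<rho>0 by (simp add: w_def A_def norm_divide norm_mult)
    also have "\<dots> < norm q"
    proof -
      have "norm A / norm q \<le> M" by (simp add: M_def)
      hence "norm A / norm q < \<rho>" using asq[OF \<rho>(1)] \<rho>2 by linarith
      thus ?thesis using qp \<rho>0 by (simp add: field_simps)
    qed
    finally have sm: "norm (fst w * fst x3) < norm q" .
    have "admissible (y1 \<rho>)" "admissible (y2 \<rho>)" "admissible (y3 \<rho>)"
      using y1lt[OF \<rho>(1)] A0 \<rho> \<rho>0 by (auto simp: y1_def y2_def y3_def admissible_def norm_mult)
    moreover have "A / of_real \<rho> ^ 2 * (of_real \<rho> * \<i>) * (- of_real \<rho> * \<i>) * fst x4 * fst x5 * fst x6 = p * q"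
      using \<rho>0 pA by (simp add: field_simps power2_eq_square)
    ultimately show b2: "balanced e (y1 \<rho>) (y2 \<rho>) (y3 \<rho>) x4 x5 x6"
      using adm sN unfolding balanced_def y1_def y2_def y3_def by simp
    have "beta_ratio e w x3 (y2 \<rho>) x4 x5 x6 = beta_ratio e (y1 \<rho>) (y3 \<rho>) (y2 \<rho>) x4 x5 x6"
      by (rule beta_ratio_move[OF balanced_swap23[OF b1] balanced_swap23[OF b2] sm])
    thus "beta_ratio e (y1 \<rho>) (y2 \<rho>) (y3 \<rho>) x4 x5 x6 = K"
      unfolding r1 beta_ratio_swap23[of e w "y2 \<rho>"] beta_ratio_swap23[of e "y1 \<rho>" "y2 \<rho>"] by simp
  qed
  define F where "F = (\<lambda>\<rho> z. \<Sum>m = 0..int r - 1. beta_integrand e (y1 \<rho>) (y2 \<rho>) (y3 \<rho>) x4 x5 x6 z m)"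
  \<comment> \<open>The four gamma factors whose arguments have modulus \<rho> are replaced by
    \<open>Hh\<close>. This multiplies the integrand by the denominator of the Poisson kernel and
    makes it continuous up to \<rho> = 1.\<close>
  define g0 where "g0 = (\<lambda>\<rho> z m. Hh (e + m) (of_real \<rho> * \<i> * z) * Hh (- m) (of_real \<rho> * \<i> / z) * Hh m (- of_real \<rho> * \<i> * z) * Hh (- e - m) (- of_real \<rho> * \<i> / z)
     * (gpair e (y1 \<rho>) z m * gpair e x4 z m * gpair e x5 z m * gpair e x6 z m * gdenom e z m))"
  define g where "g = (\<lambda>\<rho> z. \<Sum>m = 0..int r - 1. g0 \<rho> z m)"
  have intF: "beta_integral e (y1 \<rho>) (y2 \<rho>) (y3 \<rho>) x4 x5 x6 = circ_mean 1 (F \<rho>)" if \<rho>: "a \<le> \<rho>" "\<rho> < 1" for \<rho>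
    unfolding beta_integral_def F_def
    using bal[OF \<rho>] by (intro circ_mean_sum[symmetric] beta_integrand_continuous) (auto simp: balanced_def)
  have gF: "g \<rho> z = (1 + of_real \<rho> ^ 2 * z ^ 2) * (1 + of_real \<rho> ^ 2 / z ^ 2) * F \<rho> z" if \<rho>: "a < \<rho>" "\<rho> < 1" and z: "norm z = 1" for \<rho> z
  proof -
    have \<rho>0: "0 < \<rho>" using a \<rho> by linarith
    have z0: "z \<noteq> 0" using z by auto
    have H: "Hh k u = (1 - u) * G u k" if "u \<noteq> 0" "norm u < 1" for u k using G_Hh[OF that] by simp
    have n: "norm (of_real \<rho> * \<i> * z) < 1" "norm (of_real \<rho> * \<i> / z) < 1" "norm (- of_real \<rho> * \<i> * z) < 1" "norm (- of_real \<rho> * \<i> / z) < 1"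
      using \<rho> \<rho>0 z by (simp_all add: norm_mult norm_divide)
    have nn: "of_real \<rho> * \<i> * z \<noteq> 0" "of_real \<rho> * \<i> / z \<noteq> 0" "- of_real \<rho> * \<i> * z \<noteq> 0" "- of_real \<rho> * \<i> / z \<noteq> 0"
      using \<rho>0 z0 by auto
    have f1: "(1 - of_real \<rho> * \<i> * z) * (1 - - of_real \<rho> * \<i> * z) = 1 + of_real \<rho> ^ 2 * z ^ 2"
      and f2: "(1 - of_real \<rho> * \<i> / z) * (1 - - of_real \<rho> * \<i> / z) = 1 + of_real \<rho> ^ 2 / z ^ 2"
      using z0 by (simp_all add: field_simps power2_eq_square)
    have "g0 \<rho> z m = (1 + of_real \<rho> ^ 2 * z ^ 2) * (1 + of_real \<rho> ^ 2 / z ^ 2) * beta_integrand e (y1 \<rho>) (y2 \<rho>) (y3 \<rho>) x4 x5 x6 z m" for m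
    proof -
      have p2: "gpair e (y2 \<rho>) z m = G (of_real \<rho> * \<i> * z) (e + m) * G (of_real \<rho> * \<i> / z) (- m)"
        and p3: "gpair e (y3 \<rho>) z m = G (- of_real \<rho> * \<i> * z) m * G (- of_real \<rho> * \<i> / z) (- e - m)"
        by (simp_all add: gpair_def y2_def y3_def)
      show ?thesis
        unfolding g0_def H[OF nn(1) n(1)] H[OF nn(2) n(2)] H[OF nn(3) n(3)] H[OF nn(4) n(4)] beta_integrand_def p2 p3 f1[symmetric] f2[symmetric]
        by (simp only: mult_ac)
    qed
    thus ?thesis unfolding g_def F_def sum_distrib_left by (intro sum.cong) auto
  qed
  have gcont: "continuous_on ({a..1} \<times> sphere 0 1) (\<lambda>(\<rho>, z). g \<rho> z)"
  proof -
    have c1: "continuous_on ({a..1} \<times> sphere 0 1) (\<lambda>w. gpair e (y1 (fst w)) (snd w) m)" for m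
      unfolding gpair_def y1_def fst_conv snd_conv
      using y1lt A0 a by (intro continuous_intros G_continuous_comp) (auto simp: norm_mult norm_divide)
    have c2: "continuous_on ({a..1} \<times> sphere 0 1) (\<lambda>w. gpair e x (snd w) m)" if "admissible x" for x m
      by (rule continuous_on_compose2[OF gpair_continuous[OF that]]) (auto intro!: continuous_intros)
    have c3: "continuous_on ({a..1} \<times> sphere 0 1) (\<lambda>w. gdenom e (snd w) m)" for m
      by (rule continuous_on_compose2[OF gdenom_continuous]) (auto intro!: continuous_intros)
    show ?thesis
      unfolding g_def g0_def split_beta using a
      by (intro continuous_on_sum continuous_on_mult c1 c2 c3 adm Hh_continuous_comp)
         (auto intro!: continuous_intros simp: norm_mult norm_divide)
  qed
  have lim1: "((\<lambda>\<rho>. of_real (1 - \<rho> ^ 4) * circ_mean 1 (F \<rho>)) \<longlongrightarrow> (g 1 \<i> + g 1 (-\<i>)) / 2) (at_left 1)"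
    by (rule poisson_kernel_limit[OF gcont a(1,2) gF])
  have ev: "\<forall>\<^sub>F \<rho> in at_left 1. a < \<rho> \<and> \<rho> < 1"
    using a by (intro eventually_at_leftI[of a]) auto
  \<comment> \<open>The symmetry z -> 1/z, m -> -m - e exchanges i and -i, and periodicity in m
    restores the range of summation. The equality holds for \<rho> < 1 and passes to the
    limit.\<close>
  have gsym: "g 1 (-\<i>) = g 1 \<i>"
  proof -
    have lim: "((\<lambda>\<rho>. g \<rho> w) \<longlongrightarrow> g 1 w) (at_left 1)" if w: "norm w = 1" for w
    proof -
      have "continuous_on {a..1} (\<lambda>\<rho>. case (\<rho>, w) of (\<rho>, z) \<Rightarrow> g \<rho> z)"
        by (rule continuous_on_compose2[OF gcont]) (use w in \<open>auto intro!: continuous_intros\<close>)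
      hence "continuous_on {a..1} (\<lambda>\<rho>. g \<rho> w)" by simp
      hence "((\<lambda>\<rho>. g \<rho> w) \<longlongrightarrow> g 1 w) (at 1 within {a..1})" using a by (auto simp: continuous_on_def)
      thus ?thesis using at_within_Icc_at_left[OF a(2)] by simp
    qed
    have "\<forall>\<^sub>F \<rho> in at_left 1. g \<rho> (-\<i>) = g \<rho> \<i>"
      using ev
    proof eventually_elim
      case (elim \<rho>)
      hence \<rho>: "a \<le> \<rho>" "\<rho> < 1" by auto
      note b = bal[OF \<rho>, unfolded balanced_def]
      define c where "c = (\<lambda>m. beta_integrand e (y1 \<rho>) (y2 \<rho>) (y3 \<rho>) x4 x5 x6 \<i> m)"
      have per: "c (m + int r) = c m" for m
        unfolding c_def by (rule beta_integrand_periodic) (use b in auto)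
      have "beta_integrand e (y1 \<rho>) (y2 \<rho>) (y3 \<rho>) x4 x5 x6 (-\<i>) m = c (- e - m)" for m
      proof -
        have "beta_integrand e (y1 \<rho>) (y2 \<rho>) (y3 \<rho>) x4 x5 x6 (1 / \<i>) (- (- e - m) - e) = c (- e - m)"
          unfolding c_def by (rule beta_integrand_reflect)
        moreover have "1 / \<i> = - \<i>" "- (- e - m) - e = m" by simp_all
        ultimately show ?thesis by (simp only:)
      qed
      hence "F \<rho> (-\<i>) = (\<Sum>m = 0..int r - 1. c (- e - m))" unfolding F_def by simp
      also have "\<dots> = (\<Sum>m = 0..int r - 1. c m)" by (rule sum_periodic_reflect[where a = c, OF r per])
      finally have "F \<rho> (-\<i>) = F \<rho> \<i>" by (simp add: F_def c_def)
      thus ?case using elim gF[of \<rho> "\<i>"] gF[of \<rho> "-\<i>"] by simp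
    qed
    from Lim_transform_eventually[OF lim this] have "((\<lambda>\<rho>. g \<rho> \<i>) \<longlongrightarrow> g 1 (-\<i>)) (at_left 1)" by simp
    from tendsto_unique[OF _ this lim] show ?thesis by simp
  qed
  define c where "c = Hh 0 1"
  have c0: "c \<noteq> 0" unfolding c_def using Hh_1_eq_0_iff[of 0] by simp
  define S where "S = gpair e (A, N) \<i> 0 * gpair e x4 \<i> 0 * gpair e x5 \<i> 0 * gpair e x6 \<i> 0"
  have g1: "g 1 \<i> = 4 * c ^ 2 * S"
  proof -
    have z: "g0 1 \<i> m = 0" if "m \<in> {0..int r - 1} - {0}" for m
    proof -
      have "\<not> int r dvd m" using that zdvd_imp_le[of "int r" m] by auto
      hence "Hh m 1 = 0" using Hh_1_eq_0_iff by simp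
      thus ?thesis by (simp add: g0_def)
    qed
    have "g 1 \<i> = g0 1 \<i> 0"
      unfolding g_def by (subst sum.remove[of _ 0]) (use r z in auto)
    also have "\<dots> = (Hh e (-1) * Hh (- e) (-1) * gdenom e \<i> 0) * c ^ 2 * S"
      by (simp add: g0_def c_def S_def y1_def power2_eq_square mult_ac)
    \<comment> \<open>Two factors 2 come from Hh k (-1) = 2 G (-1) k; the rest is 1, since
      reflection pairs G at -1 with the factors of \<open>gdenom\<close> at -pq.\<close>
    also have "Hh e (-1) * Hh (- e) (-1) * gdenom e \<i> 0 = 4"
    proof -
      have p1: "-1 \<in> punct" by (simp add: punct_def)
      have H: "Hh k (-1) = 2 * G (-1) k" for k using G_eq[OF p1, of k] by (simp add: mult.commute[of _ 2])
      have G: "G (-1) k * G (- (p * q)) (- k) = 1" for k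
        using G_reflect[of "-1" k] pq by simp
      have "Hh e (-1) * Hh (- e) (-1) * gdenom e \<i> 0 = 4 * (G (-1) e * G (- (p * q)) (- e)) * (G (-1) (- e) * G (- (p * q)) (- (- e)))"
        unfolding H by (simp add: gdenom_def)
      thus ?thesis unfolding G by simp
    qed
    finally show ?thesis by simp
  qed
  \<comment> \<open>The product without the factor of y2 and y3, which is singular in the limit: its
    argument is \<rho>^2. It is regularized by the factor 1 - \<rho>^2 of 1 - \<rho>^4.\<close>
  define Y where "Y = (\<lambda>\<rho>. gcross e (y1 \<rho>) (y2 \<rho>) * (gcross e (y1 \<rho>) (y3 \<rho>) * gcross e (y1 \<rho>) x4 * gcross e (y1 \<rho>) x5 * gcross e (y1 \<rho>) x6)
     * (gcross e (y2 \<rho>) x4 * gcross e (y2 \<rho>) x5 * gcross e (y2 \<rho>) x6)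
     * (gcross e (y3 \<rho>) x4 * gcross e (y3 \<rho>) x5 * gcross e (y3 \<rho>) x6 * gcross e x4 x5 * gcross e x4 x6 * gcross e x5 x6))"
  have ltA1: "norm A < 1" using ltA nq by linarith
  have lim2: "((\<lambda>\<rho>. (1 + of_real \<rho> ^ 2) * Hh 0 (of_real \<rho> ^ 2) * Y \<rho>) \<longlongrightarrow> 2 * c * S) (at_left 1)"
  proof -
    have r1: "((\<lambda>\<rho>::real. of_real \<rho> :: complex) \<longlongrightarrow> of_real 1) (at_left 1)" by (intro tendsto_intros)
    have t1: "((\<lambda>\<rho>. fst (y1 \<rho>)) \<longlongrightarrow> A) (at_left 1)" and t2: "((\<lambda>\<rho>. fst (y2 \<rho>)) \<longlongrightarrow> \<i>) (at_left 1)"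
      and t3: "((\<lambda>\<rho>. fst (y3 \<rho>)) \<longlongrightarrow> - \<i>) (at_left 1)"
      unfolding y1_def y2_def y3_def fst_conv using r1 by (auto intro!: tendsto_eq_intros)
    have snds: "snd (y1 \<rho>) = N" "snd (y2 \<rho>) = 0" "snd (y3 \<rho>) = - e" for \<rho> by (simp_all add: y1_def y2_def y3_def)
    have m1: "norm (A * u) < 1" "A * u \<noteq> 0" if "norm u \<le> 1" "u \<noteq> 0" for u
    proof -
      have "norm (A * u) \<le> norm A * 1" unfolding norm_mult using that by (intro mult_left_mono) auto
      thus "norm (A * u) < 1" "A * u \<noteq> 0" using ltA1 A0 that by auto
    qed
    have lY: "(Y \<longlongrightarrow> G (A * \<i>) (N + 0 + e) * (G (A * - \<i>) (N + - e + e) * G (A * fst x4) (N + snd x4 + e) * G (A * fst x5) (N + snd x5 + e) * G (A * fst x6) (N + snd x6 + e))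
      * (G (\<i> * fst x4) (0 + snd x4 + e) * G (\<i> * fst x5) (0 + snd x5 + e) * G (\<i> * fst x6) (0 + snd x6 + e))
      * (G (- \<i> * fst x4) (- e + snd x4 + e) * G (- \<i> * fst x5) (- e + snd x5 + e) * G (- \<i> * fst x6) (- e + snd x6 + e) * gcross e x4 x5 * gcross e x4 x6 * gcross e x5 x6)) (at_left 1)"
      unfolding Y_def gcross_def[of e "y1 _"] gcross_def[of e "y2 _"] gcross_def[of e "y3 _"] snds
      by (intro tendsto_mult G_tendsto t1 t2 t3 tendsto_const m1) (use lt1 nz in \<open>auto simp: norm_mult less_imp_le\<close>)
    \<comment> \<open>A times the first components of x4, x5, x6 is pq, so the factor of A with one
      of these parameters is reciprocal to the factor of the other two. What survives is S, the
      product that also appears in the limit of the integral.\<close>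
    have refl: "G (A * fst u) (N + snd u + e) * gcross e v w = 1"
      if u: "admissible u" "admissible v" "admissible w" and eq: "A * fst u * (fst v * fst w) = p * q" "N + snd u + snd v + snd w + 2 * e = 0" for u v w
    proof -
      have nz': "A * fst u \<noteq> 0" using A0 u by (simp add: admissible_def)
      have lt: "norm (A * fst u) < 1" using m1[of "fst u"] u by (simp add: admissible_def)
      have lvw: "norm (fst v * fst w) < 1" using u mult_strict_mono'[of "norm (fst v)" 1 "norm (fst w)" 1] by (simp add: norm_mult admissible_def)
      have e1: "p * q / (A * fst u) = fst v * fst w" using eq(1) nz' by (simp add: field_simps)
      have e2: "- (N + snd u + e) = snd v + snd w + e" using eq(2) by simp
      have big: "norm (p * q) < norm (A * fst u)"
      proof -
        have "norm (p * q) = norm (A * fst u) * norm (fst v * fst w)" unfolding eq(1)[symmetric] by (simp add: norm_mult)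
        also have "\<dots> < norm (A * fst u) * 1" using nz' lvw by (intro mult_strict_left_mono) auto
        finally show ?thesis by simp
      qed
      have "A * fst u \<noteq> 1" using lt by auto
      from G_reflect[OF big less_imp_le[OF lt] this, of "N + snd u + e"] show ?thesis
        unfolding e1 e2 gcross_def .
    qed
    have R4: "G (A * fst x4) (N + snd x4 + e) * gcross e x5 x6 = 1"
      and R5: "G (A * fst x5) (N + snd x5 + e) * gcross e x4 x6 = 1"
      and R6: "G (A * fst x6) (N + snd x6 + e) * gcross e x4 x5 = 1"
      using pA sN adm by (intro refl; simp add: mult_ac)+
    have rearr: "a1 * (a2 * b4 * b5 * b6) * (c4 * c5 * c6) * (d4 * d5 * d6 * e45 * e46 * e56)
      = (a1 * a2) * (c4 * d4) * (c5 * d5) * (c6 * d6) * (b4 * e56) * (b5 * e46) * (b6 * e45)"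
      for a1 a2 b4 b5 b6 c4 c5 c6 d4 d5 d6 e45 e46 e56 :: complex by (simp only: mult_ac)
    have gp: "gpair e u \<i> 0 = G (\<i> * fst u) (0 + snd u + e) * G (- \<i> * fst u) (- e + snd u + e)" for u
      by (simp add: gpair_def mult_ac)
    have gpA: "gpair e (A, N) \<i> 0 = G (A * \<i>) (N + 0 + e) * G (A * - \<i>) (N + - e + e)"
      by (simp add: gpair_def mult.commute[of "\<i>" A])
    have lY': "(Y \<longlongrightarrow> S) (at_left 1)"
      using lY unfolding rearr R4 R5 R6 gp[symmetric] gpA[symmetric] S_def by simp
    have lH: "((\<lambda>\<rho>. Hh 0 (of_real \<rho> ^ 2)) \<longlongrightarrow> c) (at_left 1)"
    proof -
      have "1 \<in> punct" by (simp add: punct_def)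
      hence "isCont (Hh 0) 1" using Hh_analytic analytic_at_imp_isCont by blast
      moreover have "((\<lambda>\<rho>::real. of_real \<rho> ^ 2) \<longlongrightarrow> (1::complex)) (at_left 1)"
        using r1 by (auto intro!: tendsto_eq_intros)
      ultimately show ?thesis unfolding c_def by (rule isCont_tendsto_compose)
    qed
    show ?thesis
      using r1 by (auto intro!: tendsto_eq_intros lH lY')
  qed
  have "\<forall>\<^sub>F \<rho> in at_left 1. K * ((1 + of_real \<rho> ^ 2) * Hh 0 (of_real \<rho> ^ 2) * Y \<rho>) = of_real (1 - \<rho> ^ 4) * circ_mean 1 (F \<rho>)"
    using ev
  proof eventually_elim
    case (elim \<rho>)
    hence \<rho>: "a \<le> \<rho>" "\<rho> < 1" "0 < \<rho>" using a by auto
    have "\<rho> ^ 2 < 1" using \<rho> by (simp add: power_less_one_iff)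
    hence "Hh 0 (of_real \<rho> ^ 2) = (1 - of_real \<rho> ^ 2) * G (of_real \<rho> ^ 2) 0"
      using \<rho> by (intro G_Hh[symmetric]) (auto simp: norm_power)
    moreover have "G (of_real \<rho> ^ 2) 0 = gcross e (y2 \<rho>) (y3 \<rho>)"
    proof -
      have "of_real \<rho> * \<i> * (- of_real \<rho> * \<i>) = (of_real \<rho> ^ 2 :: complex)"
        by (simp add: complex_eq_iff power2_eq_square)
      thus ?thesis unfolding gcross_def y2_def y3_def fst_conv snd_conv by simp
    qed
    moreover have "of_real (1 - \<rho> ^ 4) = (1 + of_real \<rho> ^ 2) * (1 - of_real \<rho> ^ 2 :: complex)"
      by (simp add: algebra_simps flip: power_add)
    moreover have "circ_mean 1 (F \<rho>) = K * beta_product e (y1 \<rho>) (y2 \<rho>) (y3 \<rho>) x4 x5 x6"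
      using ratio[OF \<rho>(1,2)] beta_product_nonzero[OF bal[OF \<rho>(1,2)]] intF[OF \<rho>(1,2)]
      by (simp add: beta_ratio_def field_simps)
    moreover have "beta_product e (y1 \<rho>) (y2 \<rho>) (y3 \<rho>) x4 x5 x6 = gcross e (y2 \<rho>) (y3 \<rho>) * Y \<rho>"
      unfolding beta_product_def Y_def by (simp only: mult_ac)
    ultimately show ?case by (simp only: mult_ac)
  qed
  from Lim_transform_eventually[OF tendsto_mult[OF tendsto_const lim2] this]
  have "((\<lambda>\<rho>. of_real (1 - \<rho> ^ 4) * circ_mean 1 (F \<rho>)) \<longlongrightarrow> K * (2 * c * S)) (at_left 1)" .
  from tendsto_unique[OF _ this lim1] have eq: "K * (2 * c * S) = 4 * c ^ 2 * S"
    by (simp add: gsym g1)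
  have S0: "S \<noteq> 0"
  proof -
    have gp: "gpair e u \<i> 0 \<noteq> 0" if "fst u \<noteq> 0" "norm (fst u) < 1" "norm (p * q) < norm (fst u)" for u
    proof -
      have n: "norm (fst u * \<i>) = norm (fst u)" "norm (fst u / \<i>) = norm (fst u)" by (simp_all add: norm_mult norm_divide)
      have "G (fst u * \<i>) j \<noteq> 0" for j by (rule G_nonzero) (simp_all only: n that)
      moreover have "G (fst u / \<i>) j \<noteq> 0" for j by (rule G_nonzero) (simp_all only: n that)
      ultimately show ?thesis unfolding gpair_def by (simp only: mult_eq_0_iff) blast
    qed
    have l3: "norm (a * b * c) < 1" if "norm a < 1" "norm b < 1" "norm c < 1" for a b c :: complex
    proof -
      have "norm (a * b) < 1" using that mult_strict_mono'[of "norm a" 1 "norm b" 1] by (simp add: norm_mult)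
      thus ?thesis using that mult_strict_mono'[of "norm (a * b)" 1 "norm c" 1] by (simp add: norm_mult)
    qed
    have big: "norm (p * q) < norm u" if "u \<noteq> 0" "norm v < 1" "u * v = p * q" for u v
    proof -
      have "norm (p * q) = norm u * norm v" unfolding that(3)[symmetric] by (simp add: norm_mult)
      also have "\<dots> < norm u * 1" using that by (intro mult_strict_left_mono) auto
      finally show ?thesis by simp
    qed
    have "norm (p * q) < norm A" using A0 l3[OF lt1(4,5,6)] pA by (rule big)
    moreover have "norm (p * q) < norm (fst x4)"
      by (rule big[OF nz(4) l3[OF ltA1 lt1(5,6)]]) (use pA in \<open>simp add: mult_ac\<close>)
    moreover have "norm (p * q) < norm (fst x5)"
      by (rule big[OF nz(5) l3[OF ltA1 lt1(4,6)]]) (use pA in \<open>simp add: mult_ac\<close>)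
    moreover have "norm (p * q) < norm (fst x6)"
      by (rule big[OF nz(6) l3[OF ltA1 lt1(4,5)]]) (use pA in \<open>simp add: mult_ac\<close>)
    ultimately show ?thesis
      unfolding S_def using nz lt1 ltA1 A0 by (auto dest: gp[of "(A, N)", simplified] gp)
  qed
  have "K = 2 * c" using eq S0 c0 by (simp add: power2_eq_square)
  thus ?thesis
    using beta_product_nonzero[OF x] unfolding K_def c_def beta_ratio_def by (simp add: field_simps)
qed

end

section \<open>The transformation formula\<close>

text \<open>Reflection of the denominator requires z^2 \<noteq> 1; the parameter values 0, 1/2 and 1
  where this fails are negligible.\<close>

lemma circ_mean_spike:
  assumes "\<And>z. norm z = 1 \<Longrightarrow> z ^ 2 \<noteq> 1 \<Longrightarrow> F z = H z"
  shows "circ_mean 1 F = circ_mean 1 H"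
  unfolding circ_mean_def mult_1
proof (rule integral_spike)
  show "negligible {0, 1 / 2, 1 :: real}" by simp
  fix x :: real assume x: "x \<in> {0..1} - {0, 1 / 2, 1}"
  have "unit_exp x ^ 2 \<noteq> 1"
  proof
    assume "unit_exp x ^ 2 = 1"
    hence "exp (2 * (2 * of_real pi * \<i> * of_real x)) = (1 :: complex)" unfolding exp_double unit_exp_def .
    then obtain n :: int where "Im (2 * (2 * of_real pi * \<i> * of_real x)) = of_int (2 * n) * pi"
      by (auto simp: exp_eq_1)
    hence "2 * x = of_int n" by simp
    moreover from this have "0 < n" "n < 2" using x by (auto simp: of_int_0_less_iff[symmetric, where 'a = real] simp del: of_int_0_less_iff)
    hence "n = 1" by simp
    ultimately show False using x by auto
  qed
  thus "H (unit_exp x) = F (unit_exp x)" using assms by simp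
qed

lemma atLeastAtMost_1_8: "{1..8::nat} = {1, 2, 3, 4, 5, 6, 7, 8}"
  by auto

lemma prod_1_8: "(\<Prod>a = 1..8::nat. F a) = F 1 * F 2 * F 3 * F 4 * F 5 * F 6 * F 7 * F 8"
  for F :: "nat \<Rightarrow> 'a :: comm_monoid_mult"
  unfolding atLeastAtMost_1_8 by (simp add: mult_ac)

context rarefied
begin

definition V_integrand where
  "V_integrand e t n z m = (\<Prod>a = 1..8::nat. gpair e (t a, n a) z m) * gdenom e z m"

definition V_integral where
  "V_integral e t n = (\<Sum>m = 0..int r - 1. circ_mean 1 (\<lambda>z. V_integrand e t n z m))"

text \<open>The mean carries 2 pi i against 4 pi i, hence the factor 1/2. It and the Pochhammer
  symbols depend only on p, q and r, so the transformation reduces to one of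
  \<open>V_integral\<close>.\<close>

lemma rarefied_V_eq:
  assumes t: "\<And>a. a \<in> {1..8} \<Longrightarrow> t a \<noteq> 0 \<and> norm (t a) < 1"
  shows "rarefied_V r e t n p q = qpoch_inf (p ^ r) (p ^ r) * qpoch_inf (q ^ r) (q ^ r) / 2 * V_integral e t n"
proof -
  have "contour_integral (circlepath 0 1) (\<lambda>z.
            (\<Prod>a = 1..8. rarefied_gamma r (t a * z) (n a + e + m) p q
                         * rarefied_gamma r (t a * inverse z) (n a - m) p q)
            / (rarefied_gamma r (z ^ 2) (2 * m + e) p q
               * rarefied_gamma r (inverse (z ^ 2)) (- 2 * m - e) p q)
            / z) = 2 * of_real pi * \<i> * circ_mean 1 (\<lambda>z. V_integrand e t n z m)" for m
    unfolding contour_integral_circ_mean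
  proof (rule arg_cong2[where f = "(*)", OF refl], rule circ_mean_spike)
    fix z :: complex assume z: "norm z = 1" "z ^ 2 \<noteq> 1"
    have z0: "z \<noteq> 0" using z by auto
    let ?j = "2 * m + e"
    have n2: "norm (p * q) < norm (z ^ 2)" "norm (z ^ 2) \<le> 1" "norm (p * q) < norm (inverse (z ^ 2))" "norm (inverse (z ^ 2)) \<le> 1"
      using z pq by (simp_all add: norm_power norm_inverse)
    have "inverse (z ^ 2) \<noteq> 1" using z by (metis inverse_1 inverse_inverse_eq)
    note R = G_reflect[OF n2(1,2) z(2), of ?j] G_reflect[OF n2(3,4) this, of "- ?j"]
    have "p * q / inverse (z ^ 2) = p * q * z ^ 2" by (simp add: field_simps)
    hence "G (z ^ 2) ?j * G (inverse (z ^ 2)) (- ?j) * gdenom e z m =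
       (G (z ^ 2) ?j * G (p * q / z ^ 2) (- ?j)) * (G (inverse (z ^ 2)) (- ?j) * G (p * q / inverse (z ^ 2)) (- (- ?j)))"
      unfolding gdenom_def minus_minus by (simp only: mult_ac)
    also have "\<dots> = 1" unfolding R by simp
    finally have gd: "G (z ^ 2) ?j * G (inverse (z ^ 2)) (- ?j) * gdenom e z m = 1" .
    have gd: "gdenom e z m = inverse (G (z ^ 2) ?j * G (inverse (z ^ 2)) (- ?j))"
      by (rule inverse_unique[OF gd, symmetric])
    have "- ?j = - 2 * m - e" by simp
    thus "(\<Prod>a = 1..8. rarefied_gamma r (t a * z) (n a + e + m) p q
                         * rarefied_gamma r (t a * inverse z) (n a - m) p q)
            / (rarefied_gamma r (z ^ 2) (2 * m + e) p q
               * rarefied_gamma r (inverse (z ^ 2)) (- 2 * m - e) p q) = V_integrand e t n z m"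
      unfolding V_integrand_def gpair_def fst_conv snd_conv G_def[symmetric] divide_inverse gd by (simp only:)
  qed
  thus ?thesis
    unfolding rarefied_V_def V_integral_def by (simp add: sum_distrib_left[symmetric] field_simps)
qed

lemma V_integral_holomorphic:
  assumes U: "open U"
    and f: "\<And>a. a \<in> {1..8::nat} \<Longrightarrow> f a holomorphic_on U" "\<And>a w. a \<in> {1..8} \<Longrightarrow> w \<in> U \<Longrightarrow> f a w \<noteq> 0 \<and> norm (f a w) < 1"
  shows "(\<lambda>w. V_integral e (\<lambda>a. f a w) n) holomorphic_on U"
proof -
  have hol: "(\<lambda>w. gpair e (f i w, n) z m) holomorphic_on U" if "i \<in> {1..8}" "norm z = 1" for i n m z
    unfolding gpair_def fst_conv snd_conv using f[OF that(1)] that(2)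
    by (intro holomorphic_intros G_holomorphic_comp) (auto simp: norm_mult norm_divide)
  have fc: "continuous_on (U \<times> sphere 0 1) (\<lambda>wz. f i (fst wz))" if "i \<in> {1..8}" for i
    by (rule continuous_on_compose2[OF holomorphic_on_imp_continuous_on[OF f(1)[OF that]]]) (auto intro!: continuous_intros)
  have cont: "continuous_on (U \<times> sphere 0 1) (\<lambda>wz. gpair e (f i (fst wz), n) (snd wz) m)" if "i \<in> {1..8}" for i n m
    unfolding gpair_def fst_conv snd_conv using f(2)[OF that]
    by (intro continuous_intros G_continuous_comp fc that) (auto simp: norm_mult norm_divide)
  have contd: "continuous_on (U \<times> sphere 0 1) (\<lambda>wz. gdenom e (snd wz) m)" for m
    by (rule continuous_on_compose2[OF gdenom_continuous]) (auto intro!: continuous_intros)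
  show ?thesis
    unfolding V_integral_def
  proof (intro holomorphic_on_sum circ_mean_holomorphic U)
    fix m
    show "continuous_on (U \<times> sphere 0 1) (\<lambda>(w, z). V_integrand e (\<lambda>a. f a w) n z m)"
      unfolding V_integrand_def split_beta by (intro continuous_on_mult continuous_on_prod cont contd) auto
    fix z :: complex assume "norm z = 1"
    thus "(\<lambda>w. V_integrand e (\<lambda>a. f a w) n z m) holomorphic_on U"
      unfolding V_integrand_def by (intro holomorphic_on_mult holomorphic_on_prod hol holomorphic_on_const) auto
  qed
qed

definition cross4 where
  "cross4 e x1 x2 x3 x4 = gcross e x1 x2 * gcross e x1 x3 * gcross e x1 x4 * gcross e x2 x3 * gcross e x2 x4 * gcross e x3 x4"

text \<open>When the last two parameters are a multiple f of a variable and of its inverse, the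
  grouped factors become the gamma pairs of the remaining eight-parameter integral.\<close>

lemma beta_product_cross4:
  "beta_product e x1 x2 x3 x4 y z = cross4 e x1 x2 x3 x4 * gcross e y z *
     ((gcross e x1 y * gcross e x1 z) * (gcross e x2 y * gcross e x2 z) * (gcross e x3 y * gcross e x3 z) * (gcross e x4 y * gcross e x4 z))"
  unfolding beta_product_def cross4_def by (simp only: mult_ac)

text \<open>The kernel X of the double integral supplies, for fixed z, two parameters next to s5,
  ..., s8, and for fixed w two parameters next to t1, ..., t4. Evaluating either inner integral
  leaves an eight-parameter integral; reflection then turns cross factors of s5, ..., s8 into
  reciprocals of those of t5, ..., t8.\<close>

lemma V_transformation_aux:
  fixes t s :: "nat \<Rightarrow> complex" and n k :: "nat \<Rightarrow> int" and e d h :: int and f :: complex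
  assumes t: "\<And>a. a \<in> {1..8} \<Longrightarrow> t a \<noteq> 0 \<and> norm (t a) < 1"
    and s: "\<And>a. a \<in> {1..8} \<Longrightarrow> s a \<noteq> 0 \<and> norm (s a) < 1"
    and f: "f \<noteq> 0" "norm f < 1"
    and prodt: "t 1 * t 2 * t 3 * t 4 * f ^ 2 = p * q" and prods: "s 5 * s 6 * s 7 * s 8 * f ^ 2 = p * q"
    and st: "\<And>a. a \<in> {1..4} \<Longrightarrow> s a = f * t a" "\<And>a. a \<in> {5..8} \<Longrightarrow> t a = f * s a"
    and kn: "\<And>a. a \<in> {1..4} \<Longrightarrow> k a = n a - h" "\<And>a. a \<in> {5..8} \<Longrightarrow> k a = n a + h + e - d"
    and h: "2 * h = n 1 + n 2 + n 3 + n 4 + e + d"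
    and sum: "n 1 + n 2 + n 3 + n 4 + n 5 + n 6 + n 7 + n 8 + 4 * e = 0"
    and small: "norm (t 1) < norm q" "norm (s 5) < norm q"
  shows "V_integral e t n = V_integral d s k *
     (cross4 e (t 1, n 1) (t 2, n 2) (t 3, n 3) (t 4, n 4) * cross4 e (t 5, n 5) (t 6, n 6) (t 7, n 7) (t 8, n 8))"
proof -
  \<comment> \<open>The base label of the two extra parameters, forced by the balancing condition of
    either six-parameter integral.\<close>
  define K where "K = - h - e"
  define c where "c = 2 * Hh 0 1"
  have c0: "c \<noteq> 0" unfolding c_def using Hh_1_eq_0_iff[of 0] by simp
  \<comment> \<open>The cross factor of the two extra parameters: free of the integration variables,
    and the same in both evaluations.\<close>
  define g where "g = G (f ^ 2) (2 * K + e + d)"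
  have adt: "admissible (t a, n')" if "a \<in> {1..8}" for a n' using t[OF that] by (simp add: admissible_def)
  have ads: "admissible (s a, n')" if "a \<in> {1..8}" for a n' using s[OF that] by (simp add: admissible_def)
  have adf: "admissible (f * z, n')" "admissible (f / z, n')" if "norm z = 1" for z n'
    using f that by (auto simp: admissible_def norm_mult norm_divide)
  have balw: "balanced d (s 5, k 5) (s 6, k 6) (s 7, k 7) (s 8, k 8) (f * z, K + m + e) (f / z, K - m)" if z: "norm z = 1" for z m
  proof -
    have "z \<noteq> 0" using z by auto
    hence "s 5 * s 6 * s 7 * s 8 * (f * z) * (f / z) = p * q" using prods by (simp add: power2_eq_square mult_ac)
    thus ?thesis unfolding balanced_def using adf[OF z] h sum kn(2) by (simp add: ads K_def)
  qed
  have balz: "balanced e (t 1, n 1) (t 2, n 2) (t 3, n 3) (t 4, n 4) (f * z, K + d + m) (f / z, K - m)" if z: "norm z = 1" for z m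
  proof -
    have "z \<noteq> 0" using z by auto
    hence "t 1 * t 2 * t 3 * t 4 * (f * z) * (f / z) = p * q" using prodt by (simp add: power2_eq_square mult_ac)
    thus ?thesis unfolding balanced_def using adf[OF z] h sum by (simp add: adt K_def)
  qed
  define A where "A = (\<lambda>z m. gpair e (t 1, n 1) z m * gpair e (t 2, n 2) z m * gpair e (t 3, n 3) z m * gpair e (t 4, n 4) z m * gdenom e z m)"
  define B where "B = (\<lambda>w m. gpair d (s 5, k 5) w m * gpair d (s 6, k 6) w m * gpair d (s 7, k 7) w m * gpair d (s 8, k 8) w m * gdenom d w m)"
  define X where "X = (\<lambda>z w m m'. gpair d (f * z, K + m + e) w m' * gpair d (f / z, K - m) w m')"
  \<comment> \<open>Each of the four gamma factors combines a power z or 1/z with a power w or 1/w,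
    so the kernel can be read as pairs in either variable.\<close>
  have X': "X z w m m' = gpair e (f * w, K + d + m') z m * gpair e (f / w, K - m') z m" for z w m m'
  proof -
    have i: "K + m + e + d + m' = K + d + m' + e + m" "K + m + e - m' = K - m' + e + m" "K - m + d + m' = K + d + m' - m" "K - m - m' = K - m' - m"
      by simp_all
    have j: "f * z * w = f * w * z" "f * z / w = f / w * z" "f / z * w = f * w / z" "f / z / w = f / w / z"
      by (simp_all add: mult_ac)
    show ?thesis unfolding X_def gpair_def fst_conv snd_conv i j by (simp only: mult_ac)
  qed
  have intw: "(\<Sum>m' = 0..int r - 1. circ_mean 1 (\<lambda>w. A z m * B w m' * X z w m m'))
      = c * cross4 d (s 5, k 5) (s 6, k 6) (s 7, k 7) (s 8, k 8) * g * V_integrand e t n z m" if z: "norm z = 1" for z m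
  proof -
    have z0: "z \<noteq> 0" using z by auto
    have "(\<Sum>m' = 0..int r - 1. circ_mean 1 (\<lambda>w. A z m * B w m' * X z w m m'))
      = (\<Sum>m' = 0..int r - 1. circ_mean 1 (\<lambda>w. A z m * beta_integrand d (s 5, k 5) (s 6, k 6) (s 7, k 7) (s 8, k 8) (f * z, K + m + e) (f / z, K - m) w m'))"
      by (intro sum.cong refl arg_cong[where f = "circ_mean 1"] ext) (simp only: B_def X_def beta_integrand_def mult_ac)
    also have "\<dots> = A z m * beta_integral d (s 5, k 5) (s 6, k 6) (s 7, k 7) (s 8, k 8) (f * z, K + m + e) (f / z, K - m)"
      unfolding circ_mean_cmult beta_integral_def sum_distrib_left ..
    also have "beta_integral d (s 5, k 5) (s 6, k 6) (s 7, k 7) (s 8, k 8) (f * z, K + m + e) (f / z, K - m)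
       = c * beta_product d (s 5, k 5) (s 6, k 6) (s 7, k 7) (s 8, k 8) (f * z, K + m + e) (f / z, K - m)"
      unfolding c_def by (rule beta_evaluation[OF balw[OF z]]) (use small in simp)
    also have "beta_product d (s 5, k 5) (s 6, k 6) (s 7, k 7) (s 8, k 8) (f * z, K + m + e) (f / z, K - m) =
      cross4 d (s 5, k 5) (s 6, k 6) (s 7, k 7) (s 8, k 8) * g *
      (gpair e (t 5, n 5) z m * gpair e (t 6, n 6) z m * gpair e (t 7, n 7) z m * gpair e (t 8, n 8) z m)"
    proof -
      have "gcross d (f * z, K + m + e) (f / z, K - m) = g"
        using z0 by (simp add: gcross_def g_def power2_eq_square algebra_simps)
      moreover have "gcross d (s a, k a) (f * z, K + m + e) * gcross d (s a, k a) (f / z, K - m) = gpair e (t a, n a) z m"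
        if "a \<in> {5..8}" for a
      proof -
        have "k a + (K + m + e) + d = n a + e + m" "k a + (K - m) + d = n a - m"
          unfolding kn(2)[OF that] K_def by simp_all
        moreover have "s a * (f * z) = t a * z" "s a * (f / z) = t a / z"
          unfolding st(2)[OF that] by simp_all
        ultimately show ?thesis unfolding gcross_def gpair_def fst_conv snd_conv by (simp only:)
      qed
      ultimately show ?thesis unfolding beta_product_cross4 by simp
    qed
    also have "A z m * (c * (cross4 d (s 5, k 5) (s 6, k 6) (s 7, k 7) (s 8, k 8) * g *
      (gpair e (t 5, n 5) z m * gpair e (t 6, n 6) z m * gpair e (t 7, n 7) z m * gpair e (t 8, n 8) z m)))
      = c * cross4 d (s 5, k 5) (s 6, k 6) (s 7, k 7) (s 8, k 8) * g * V_integrand e t n z m"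
      unfolding V_integrand_def prod_1_8 A_def by (simp only: mult_ac)
    finally show ?thesis .
  qed
  have intz: "(\<Sum>m = 0..int r - 1. circ_mean 1 (\<lambda>z. A z m * B w m' * X z w m m'))
      = c * cross4 e (t 1, n 1) (t 2, n 2) (t 3, n 3) (t 4, n 4) * g * V_integrand d s k w m'" if w: "norm w = 1" for w m'
  proof -
    have w0: "w \<noteq> 0" using w by auto
    have "(\<Sum>m = 0..int r - 1. circ_mean 1 (\<lambda>z. A z m * B w m' * X z w m m'))
      = (\<Sum>m = 0..int r - 1. circ_mean 1 (\<lambda>z. B w m' * beta_integrand e (t 1, n 1) (t 2, n 2) (t 3, n 3) (t 4, n 4) (f * w, K + d + m') (f / w, K - m') z m))"
      by (intro sum.cong refl arg_cong[where f = "circ_mean 1"] ext) (simp only: A_def X' beta_integrand_def mult_ac)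
    also have "\<dots> = B w m' * beta_integral e (t 1, n 1) (t 2, n 2) (t 3, n 3) (t 4, n 4) (f * w, K + d + m') (f / w, K - m')"
      unfolding circ_mean_cmult beta_integral_def sum_distrib_left ..
    also have "beta_integral e (t 1, n 1) (t 2, n 2) (t 3, n 3) (t 4, n 4) (f * w, K + d + m') (f / w, K - m')
       = c * beta_product e (t 1, n 1) (t 2, n 2) (t 3, n 3) (t 4, n 4) (f * w, K + d + m') (f / w, K - m')"
      unfolding c_def by (rule beta_evaluation[OF balz[OF w]]) (use small in simp)
    also have "beta_product e (t 1, n 1) (t 2, n 2) (t 3, n 3) (t 4, n 4) (f * w, K + d + m') (f / w, K - m') =
      cross4 e (t 1, n 1) (t 2, n 2) (t 3, n 3) (t 4, n 4) * g *
      (gpair d (s 1, k 1) w m' * gpair d (s 2, k 2) w m' * gpair d (s 3, k 3) w m' * gpair d (s 4, k 4) w m')"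
    proof -
      have "gcross e (f * w, K + d + m') (f / w, K - m') = g"
        using w0 by (simp add: gcross_def g_def power2_eq_square algebra_simps)
      moreover have "gcross e (t a, n a) (f * w, K + d + m') * gcross e (t a, n a) (f / w, K - m') = gpair d (s a, k a) w m'"
        if "a \<in> {1..4}" for a
      proof -
        have "n a + (K + d + m') + e = k a + d + m'" "n a + (K - m') + e = k a - m'"
          unfolding kn(1)[OF that] K_def by simp_all
        moreover have "t a * (f * w) = s a * w" "t a * (f / w) = s a / w"
          unfolding st(1)[OF that] by simp_all
        ultimately show ?thesis unfolding gcross_def gpair_def fst_conv snd_conv by (simp only:)
      qed
      ultimately show ?thesis unfolding beta_product_cross4 by simp
    qed
    also have "B w m' * (c * (cross4 e (t 1, n 1) (t 2, n 2) (t 3, n 3) (t 4, n 4) * g *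
      (gpair d (s 1, k 1) w m' * gpair d (s 2, k 2) w m' * gpair d (s 3, k 3) w m' * gpair d (s 4, k 4) w m')))
      = c * cross4 e (t 1, n 1) (t 2, n 2) (t 3, n 3) (t 4, n 4) * g * V_integrand d s k w m'"
      unfolding V_integrand_def prod_1_8 B_def by (simp only: mult_ac)
    finally show ?thesis .
  qed
  have cont: "continuous_on (sphere 0 1 \<times> sphere 0 1) (\<lambda>(z, w). A z m * B w m' * X z w m m')" for m m'
  proof -
    have c1: "continuous_on (sphere 0 1 \<times> sphere 0 1) (\<lambda>v. A (fst v) m)"
      unfolding A_def
      by (rule continuous_on_compose2[of "sphere 0 1" _ _ fst])
         (auto intro!: continuous_intros gpair_continuous gdenom_continuous adt)
    have c2: "continuous_on (sphere 0 1 \<times> sphere 0 1) (\<lambda>v. B (snd v) m')"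
      unfolding B_def
      by (rule continuous_on_compose2[of "sphere 0 1" _ _ snd])
         (auto intro!: continuous_intros gpair_continuous gdenom_continuous ads)
    have c3: "continuous_on (sphere 0 1 \<times> sphere 0 1) (\<lambda>v. X (fst v) (snd v) m m')"
      unfolding X_def gpair_def fst_conv snd_conv using f
      by (intro continuous_intros G_continuous_comp) (auto simp: norm_mult norm_divide)
    show ?thesis unfolding split_beta by (intro continuous_on_mult c1 c2 c3)
  qed
  have contz: "continuous_on (sphere 0 1) (\<lambda>z. circ_mean 1 (\<lambda>w. A z m * B w m' * X z w m m'))" for m m'
  proof -
    have "continuous_on (sphere 0 1 \<times> cbox 0 1) (\<lambda>(z, x). A z m * B (unit_exp x) m' * X z (unit_exp x) m m')"
      unfolding split_beta by (rule continuous_on_compose_unit_exp[OF cont]) (auto intro!: continuous_intros)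
    from integral_continuous_on_param[OF this] show ?thesis by (simp add: circ_mean_def)
  qed
  have contw: "continuous_on (sphere 0 1) (\<lambda>w. circ_mean 1 (\<lambda>z. A z m * B w m' * X z w m m'))" for m m'
  proof -
    have c': "continuous_on (sphere 0 1 \<times> sphere 0 1) (\<lambda>(w, z). A z m * B w m' * X z w m m')"
    proof -
      have "continuous_on (sphere 0 1 \<times> sphere 0 1) (\<lambda>v. case (snd v, fst v) of (z, w) \<Rightarrow> A z m * B w m' * X z w m m')"
        by (rule continuous_on_compose2[OF cont]) (auto intro!: continuous_intros)
      thus ?thesis by (simp add: split_beta)
    qed
    have "continuous_on (sphere 0 1 \<times> cbox 0 1) (\<lambda>(w, x). A (unit_exp x) m * B w m' * X (unit_exp x) w m m')"
      unfolding split_beta by (rule continuous_on_compose_unit_exp[OF c']) (auto intro!: continuous_intros)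
    from integral_continuous_on_param[OF this] show ?thesis by (simp add: circ_mean_def)
  qed
  define D where "D = (\<Sum>m = 0..int r - 1. \<Sum>m' = 0..int r - 1. circ_mean 1 (\<lambda>z. circ_mean 1 (\<lambda>w. A z m * B w m' * X z w m m')))"
  have "D = (\<Sum>m = 0..int r - 1. circ_mean 1 (\<lambda>z. \<Sum>m' = 0..int r - 1. circ_mean 1 (\<lambda>w. A z m * B w m' * X z w m m')))"
    unfolding D_def by (intro sum.cong refl circ_mean_sum[symmetric] contz) auto
  also have "\<dots> = (\<Sum>m = 0..int r - 1. circ_mean 1 (\<lambda>z. c * cross4 d (s 5, k 5) (s 6, k 6) (s 7, k 7) (s 8, k 8) * g * V_integrand e t n z m))"
    by (intro sum.cong refl circ_mean_cong intw) simp
  also have "\<dots> = c * cross4 d (s 5, k 5) (s 6, k 6) (s 7, k 7) (s 8, k 8) * g * V_integral e t n"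
    unfolding circ_mean_cmult V_integral_def sum_distrib_left ..
  finally have D1: "D = c * cross4 d (s 5, k 5) (s 6, k 6) (s 7, k 7) (s 8, k 8) * g * V_integral e t n" .
  have "D = (\<Sum>m' = 0..int r - 1. \<Sum>m = 0..int r - 1. circ_mean 1 (\<lambda>w. circ_mean 1 (\<lambda>z. A z m * B w m' * X z w m m')))"
    unfolding D_def by (subst sum.swap) (intro sum.cong refl circ_mean_swap cont)
  also have "\<dots> = (\<Sum>m' = 0..int r - 1. circ_mean 1 (\<lambda>w. \<Sum>m = 0..int r - 1. circ_mean 1 (\<lambda>z. A z m * B w m' * X z w m m')))"
    by (intro sum.cong refl circ_mean_sum[symmetric] contw) auto
  also have "\<dots> = (\<Sum>m' = 0..int r - 1. circ_mean 1 (\<lambda>w. c * cross4 e (t 1, n 1) (t 2, n 2) (t 3, n 3) (t 4, n 4) * g * V_integrand d s k w m'))"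
    by (intro sum.cong refl circ_mean_cong intz) simp
  also have "\<dots> = c * cross4 e (t 1, n 1) (t 2, n 2) (t 3, n 3) (t 4, n 4) * g * V_integral d s k"
    unfolding circ_mean_cmult V_integral_def sum_distrib_left ..
  finally have D2: "D = c * cross4 e (t 1, n 1) (t 2, n 2) (t 3, n 3) (t 4, n 4) * g * V_integral d s k" .
  have g0: "g \<noteq> 0"
  proof -
    have "gcross d (f * 1, K + 0 + e) (f / 1, K - 0) = g"
      by (simp add: gcross_def g_def power2_eq_square algebra_simps)
    thus ?thesis using beta_product_nonzero[OF balw[of 1 0]] unfolding beta_product_cross4 by auto
  qed
  \<comment> \<open>Complementary pairs among the indices 5 to 8: s_a s_b times t_a' t_b' is pq, so
    reflection applies.\<close>
  have inv: "gcross d (s a, k a) (s b, k b) * gcross e (t a', n a') (t b', n b') = 1"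
    if "a \<in> {5..8}" "b \<in> {5..8}" "a' \<in> {5..8}" "b' \<in> {5..8}" "s a * s b * (s a' * s b') = s 5 * s 6 * s 7 * s 8"
      "n a + n b + n a' + n b' = n 5 + n 6 + n 7 + n 8" for a b a' b'
  proof -
    have nz: "s a * s b \<noteq> 0" "t a' * t b' \<noteq> 0" using s t that by auto
    have m1: "norm (u * v) < 1" if "norm u < 1" "norm v < 1" for u v :: complex
      using that mult_strict_mono'[of "norm u" 1 "norm v" 1] by (simp add: norm_mult)
    have lt: "norm (s a * s b) < 1" "norm (t a' * t b') < 1" using s t that by (auto intro!: m1)
    have "t a' * t b' = f ^ 2 * (s a' * s b')"
      using st(2)[OF that(3)] st(2)[OF that(4)] by (simp add: power2_eq_square)
    hence "s a * s b * (t a' * t b') = s a * s b * (s a' * s b') * f ^ 2" by (simp only: mult_ac)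
    hence eq: "s a * s b * (t a' * t b') = p * q" unfolding that(5) prods .
    have e1: "p * q / (s a * s b) = t a' * t b'" using eq nz by (simp add: field_simps)
    have e2: "- (k a + k b + d) = n a' + n b' + e"
      using kn(2)[OF that(1)] kn(2)[OF that(2)] that(6) h sum by simp
    have "norm (p * q) = norm (s a * s b) * norm (t a' * t b')" unfolding eq[symmetric] by (simp add: norm_mult)
    also have "\<dots> < norm (s a * s b) * 1" using lt nz by (intro mult_strict_left_mono) auto
    finally have big: "norm (p * q) < norm (s a * s b)" by simp
    have "s a * s b \<noteq> 1" using lt by auto
    from G_reflect[OF big less_imp_le[OF lt(1)] this, of "k a + k b + d"] show ?thesis
      unfolding e1 e2 gcross_def fst_conv snd_conv .
  qed
  have rearr: "(a1 * a2 * a3 * a4 * a5 * a6) * (b1 * b2 * b3 * b4 * b5 * b6) = (a1 * b6) * (a2 * b5) * (a3 * b4) * (a4 * b3) * (a5 * b2) * (a6 * b1)"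
    for a1 a2 a3 a4 a5 a6 b1 b2 b3 b4 b5 b6 :: complex by (simp only: mult_ac)
  have Q: "cross4 d (s 5, k 5) (s 6, k 6) (s 7, k 7) (s 8, k 8) * cross4 e (t 5, n 5) (t 6, n 6) (t 7, n 7) (t 8, n 8) = 1"
  proof -
    have "gcross d (s 5, k 5) (s 6, k 6) * gcross e (t 7, n 7) (t 8, n 8) = 1"
      "gcross d (s 5, k 5) (s 7, k 7) * gcross e (t 6, n 6) (t 8, n 8) = 1"
      "gcross d (s 5, k 5) (s 8, k 8) * gcross e (t 6, n 6) (t 7, n 7) = 1"
      "gcross d (s 6, k 6) (s 7, k 7) * gcross e (t 5, n 5) (t 8, n 8) = 1"
      "gcross d (s 6, k 6) (s 8, k 8) * gcross e (t 5, n 5) (t 7, n 7) = 1"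
      "gcross d (s 7, k 7) (s 8, k 8) * gcross e (t 5, n 5) (t 6, n 6) = 1"
      by (rule inv; simp)+
    thus ?thesis unfolding cross4_def rearr by (simp only: mult_1)
  qed
  have "c * g * (cross4 d (s 5, k 5) (s 6, k 6) (s 7, k 7) (s 8, k 8) * V_integral e t n)
      = c * g * (cross4 e (t 1, n 1) (t 2, n 2) (t 3, n 3) (t 4, n 4) * V_integral d s k)"
    using D1 D2 by (simp only: mult_ac)
  hence main: "cross4 d (s 5, k 5) (s 6, k 6) (s 7, k 7) (s 8, k 8) * V_integral e t n
      = cross4 e (t 1, n 1) (t 2, n 2) (t 3, n 3) (t 4, n 4) * V_integral d s k"
    using c0 g0 by simp
  have "V_integral e t n = cross4 e (t 5, n 5) (t 6, n 6) (t 7, n 7) (t 8, n 8) * (cross4 d (s 5, k 5) (s 6, k 6) (s 7, k 7) (s 8, k 8) * V_integral e t n)"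
    unfolding mult.assoc[symmetric] mult.commute[of "cross4 e (t 5, n 5) (t 6, n 6) (t 7, n 7) (t 8, n 8)"] Q by simp
  thus ?thesis unfolding main by (simp only: mult_ac)
qed

end

section \<open>Analytic continuation in the parameters\<close>

definition exp_scale :: "complex \<Rightarrow> real \<Rightarrow> complex \<Rightarrow> complex" where
  "exp_scale x c w = x * exp (of_real c * w)"

lemma exp_scale_0 [simp]: "exp_scale x c 0 = x"
  by (simp add: exp_scale_def)

lemma exp_scale_nonzero [simp]: "exp_scale x c w = 0 \<longleftrightarrow> x = 0"
  by (simp add: exp_scale_def)

lemma norm_exp_scale: "norm (exp_scale x c w) = norm x * exp (c * Re w)"
  by (simp add: exp_scale_def norm_mult)

lemma norm_exp_scale_1: "x \<noteq> 0 \<Longrightarrow> norm (exp_scale x (L - ln (norm x)) 1) = exp L"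
  by (simp add: norm_exp_scale exp_diff)

lemma exp_scale_mult: "exp_scale x c w * exp_scale y d w = exp_scale (x * y) (c + d) w"
  by (simp add: exp_scale_def exp_add algebra_simps)

lemma exp_scale_holomorphic: "exp_scale x c holomorphic_on A"
  unfolding exp_scale_def by (intro holomorphic_intros)

lemma open_norm_exp_scale: "open {w. norm (exp_scale x c w) < B}"
  unfolding exp_scale_def by (intro open_Collect_less continuous_intros)

text \<open>As c is real, the modulus depends on Re w only; the condition describes a half-plane
  unless c = 0.\<close>

lemma convex_norm_exp_scale:
  assumes "x \<noteq> 0" "B > 0"
  shows "convex {w. norm (exp_scale x c w) < B}"
proof -
  have "norm (exp_scale x c w) < B \<longleftrightarrow> inner (of_real c) w < ln (B / norm x)" for w
  proof -
    have "norm (exp_scale x c w) < B \<longleftrightarrow> exp (c * Re w) < B / norm x"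
      using assms by (simp add: norm_exp_scale pos_less_divide_eq mult.commute)
    also have "\<dots> \<longleftrightarrow> c * Re w < ln (B / norm x)"
      using assms by (subst ln_less_cancel_iff[symmetric]) auto
    finally show ?thesis by (simp add: inner_complex_def)
  qed
  thus ?thesis using convex_halfspace_lt[of "of_real c :: complex" "ln (B / norm x)"] by simp
qed

context rarefied
begin

lemma gcross_holomorphic:
  assumes "f holomorphic_on U" "g holomorphic_on U"
    and "\<And>w. w \<in> U \<Longrightarrow> f w \<noteq> 0 \<and> norm (f w) < 1" "\<And>w. w \<in> U \<Longrightarrow> g w \<noteq> 0 \<and> norm (g w) < 1"
  shows "(\<lambda>w. gcross e (f w, i) (g w, j)) holomorphic_on U"
  unfolding gcross_def fst_conv snd_conv
proof (intro G_holomorphic_comp holomorphic_intros assms(1,2))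
  fix w assume "w \<in> U"
  thus "f w * g w \<noteq> 0 \<and> norm (f w * g w) < 1"
    using assms(3,4)[of w] mult_strict_mono'[of "norm (f w)" 1 "norm (g w)" 1] by (simp add: norm_mult)
qed

lemma V_transformation:
  fixes t s :: "nat \<Rightarrow> complex" and n k :: "nat \<Rightarrow> int" and e d h :: int and f :: complex
  assumes t: "\<And>a. a \<in> {1..8} \<Longrightarrow> t a \<noteq> 0 \<and> norm (t a) < 1"
    and s: "\<And>a. a \<in> {1..8} \<Longrightarrow> s a \<noteq> 0 \<and> norm (s a) < 1"
    and f: "f \<noteq> 0"
    and prodt: "t 1 * t 2 * t 3 * t 4 * f ^ 2 = p * q" and prods: "s 5 * s 6 * s 7 * s 8 * f ^ 2 = p * q"
    and st: "\<And>a. a \<in> {1..4} \<Longrightarrow> s a = f * t a" "\<And>a. a \<in> {5..8} \<Longrightarrow> t a = f * s a"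
    and kn: "\<And>a. a \<in> {1..4} \<Longrightarrow> k a = n a - h" "\<And>a. a \<in> {5..8} \<Longrightarrow> k a = n a + h + e - d"
    and h: "2 * h = n 1 + n 2 + n 3 + n 4 + e + d"
    and sum: "n 1 + n 2 + n 3 + n 4 + n 5 + n 6 + n 7 + n 8 + 4 * e = 0"
  shows "V_integral e t n = V_integral d s k *
     (cross4 e (t 1, n 1) (t 2, n 2) (t 3, n 3) (t 4, n 4) * cross4 e (t 5, n 5) (t 6, n 6) (t 7, n 7) (t 8, n 8))"
proof -
  \<comment> \<open>The moduli at w = 1 split log |pq| = -M - 5 \<eta> into -M - 3 \<eta> for t1,
    ..., t4 and -2 \<eta> for the square of f, and likewise for s5, ..., s8. As M exceeds -ln |q|,
    t1 and s5 become smaller than q in modulus.\<close>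
  define \<eta> where "\<eta> = - ln (norm p) / 6"
  define M where "M = - ln (norm q) + \<eta>"
  define L where "L = (\<lambda>a :: nat. if a = 1 then - M else if a \<le> 4 then - \<eta> else if a = 5 then - M - \<eta> else - 2 * \<eta>)"
  define c where "c = (\<lambda>a. L a - ln (norm (t a)))"
  define \<phi> where "\<phi> = - \<eta> - ln (norm f)"
  define c' where "c' = (\<lambda>a :: nat. if a \<le> 4 then c a + \<phi> else c a - \<phi>)"
  define T where "T = (\<lambda>a. exp_scale (t a) (c a))"
  define S where "S = (\<lambda>a. exp_scale (s a) (c' a))"
  define F where "F = exp_scale f \<phi>"
  have \<eta>: "\<eta> > 0" using np p0 by (simp add: \<eta>_def)
  have lq: "ln (norm q) < 0" using nq q0 by simp
  have lnpq: "ln (norm p) + ln (norm q) = - M - 5 * \<eta>" by (simp add: M_def \<eta>_def)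
  have lnt: "ln (norm (s a)) = ln (norm f) + ln (norm (t a))" if "a \<in> {1..4}" for a
    using t[of a] f that by (simp add: st norm_mult ln_mult)
  have lns: "ln (norm (t a)) = ln (norm f) + ln (norm (s a))" if "a \<in> {5..8}" for a
    using s[of a] f that by (simp add: st norm_mult ln_mult)
  have c'_eq: "c' a = (if a \<le> 4 then L a - \<eta> else L a + \<eta>) - ln (norm (s a))" if "a \<in> {1..8}" for a
    using that lnt[of a] lns[of a] by (cases "a \<le> 4") (auto simp: c'_def c_def \<phi>_def)
  \<comment> \<open>Vanishing sums of the exponents keep both product conditions valid for every
    w.\<close>
  have sumt: "c 1 + c 2 + c 3 + c 4 + 2 * \<phi> = 0"
  proof -
    have "ln (norm (t 1 * t 2 * t 3 * t 4 * f ^ 2)) = ln (norm (p * q))" unfolding prodt ..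
    hence "ln (norm (t 1)) + ln (norm (t 2)) + ln (norm (t 3)) + ln (norm (t 4)) + 2 * ln (norm f) = - M - 5 * \<eta>"
      using t f p0 q0 lnpq by (simp add: norm_mult norm_power ln_mult ln_realpow)
    thus ?thesis by (simp add: c_def \<phi>_def L_def)
  qed
  have sums: "c' 5 + c' 6 + c' 7 + c' 8 + 2 * \<phi> = 0"
  proof -
    have "ln (norm (s 5 * s 6 * s 7 * s 8 * f ^ 2)) = ln (norm (p * q))" unfolding prods ..
    hence "ln (norm (s 5)) + ln (norm (s 6)) + ln (norm (s 7)) + ln (norm (s 8)) + 2 * ln (norm f) = - M - 5 * \<eta>"
      using s f p0 q0 lnpq by (simp add: norm_mult norm_power ln_mult ln_realpow)
    thus ?thesis by (simp add: c'_eq \<phi>_def L_def)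
  qed
  \<comment> \<open>On U both sides are holomorphic; it contains 0, where the parameters are the
    given ones, and 1. The open subset U' around 1 adds the size conditions of
    \<open>V_transformation_aux\<close>.\<close>
  define U where "U = (\<Inter>a\<in>{1..8}. {w. norm (T a w) < 1} \<inter> {w. norm (S a w) < 1})"
  define U' where "U' = U \<inter> {w. norm (F w) < 1} \<inter> {w. norm (T 1 w) < norm q} \<inter> {w. norm (S 5 w) < norm q}"
  have openU: "open U"
    unfolding U_def T_def S_def by (intro open_INT ballI open_Int open_norm_exp_scale) auto
  have openU': "open U'"
    unfolding U'_def F_def T_def S_def by (intro open_Int open_norm_exp_scale openU)
  have convU: "convex U"
    unfolding U_def T_def S_def using t s by (intro convex_INT convex_Int convex_norm_exp_scale) auto
  have T1: "norm (T a 1) = exp (L a)" if "a \<in> {1..8}" for a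
    unfolding T_def c_def using t[OF that] by (intro norm_exp_scale_1) simp
  have S1: "norm (S a 1) = exp (if a \<le> 4 then L a - \<eta> else L a + \<eta>)" if "a \<in> {1..8}" for a
    unfolding S_def c'_eq[OF that] using s[OF that] by (intro norm_exp_scale_1) simp
  have in1: "1 \<in> U'"
  proof -
    have "norm (F 1) = exp (- \<eta>)" unfolding F_def \<phi>_def by (rule norm_exp_scale_1) (rule f)
    moreover have "exp (- M) < norm q" "exp (- M - \<eta> + \<eta>) < norm q"
      using \<eta> q0 by (simp_all add: M_def exp_diff exp_add exp_minus divide_simps)
    moreover have L: "L a < 0" "L a < - \<eta> \<or> a \<le> 4" if "a \<in> {1..8}" for a
      using that \<eta> lq by (auto simp: L_def M_def)
    moreover have "norm (T a 1) < 1 \<and> norm (S a 1) < 1" if a: "a \<in> {1..8}" for a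
      unfolding T1[OF a] S1[OF a] exp_less_one_iff using L[OF a] \<eta> by (cases "a \<le> 4") auto
    moreover have "norm (T 1 1) = exp (- M)" "norm (S 5 1) = exp (- M - \<eta> + \<eta>)"
      by (simp_all add: T1 S1) (simp_all add: L_def)
    ultimately show ?thesis using \<eta> unfolding U'_def U_def by auto
  qed
  have in0: "0 \<in> U" using t s by (simp add: U_def T_def S_def)
  have holT: "T a holomorphic_on U" and holS: "S a holomorphic_on U" for a
    unfolding T_def S_def by (rule exp_scale_holomorphic)+
  have TU: "T a w \<noteq> 0 \<and> norm (T a w) < 1" if "a \<in> {1..8}" "w \<in> U" for a w
    using that t by (auto simp: U_def T_def)
  have SU: "S a w \<noteq> 0 \<and> norm (S a w) < 1" if "a \<in> {1..8}" "w \<in> U" for a w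
    using that s by (auto simp: U_def S_def)
  have hc: "(\<lambda>w. cross4 e (T a1 w, i1) (T a2 w, i2) (T a3 w, i3) (T a4 w, i4)) holomorphic_on U"
    if "a1 \<in> {1..8}" "a2 \<in> {1..8}" "a3 \<in> {1..8}" "a4 \<in> {1..8}" for a1 a2 a3 a4 i1 i2 i3 i4
    unfolding cross4_def using that by (intro holomorphic_on_mult gcross_holomorphic holT TU)
  have "V_integral e (\<lambda>a. T a 0) n = V_integral d (\<lambda>a. S a 0) k *
     (cross4 e (T 1 0, n 1) (T 2 0, n 2) (T 3 0, n 3) (T 4 0, n 4) * cross4 e (T 5 0, n 5) (T 6 0, n 6) (T 7 0, n 7) (T 8 0, n 8))"
  proof (rule analytic_continuation_open[OF openU' openU _ _ _ _ _ _ in0])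
    show "U' \<noteq> {}" using in1 by auto
    show "connected U" using convU by (rule convex_connected)
    show "U' \<subseteq> U" by (auto simp: U'_def)
    show "(\<lambda>w. V_integral e (\<lambda>a. T a w) n) holomorphic_on U"
      by (intro V_integral_holomorphic openU holT TU)
    show "(\<lambda>w. V_integral d (\<lambda>a. S a w) k *
     (cross4 e (T 1 w, n 1) (T 2 w, n 2) (T 3 w, n 3) (T 4 w, n 4) * cross4 e (T 5 w, n 5) (T 6 w, n 6) (T 7 w, n 7) (T 8 w, n 8))) holomorphic_on U"
      by (intro holomorphic_on_mult V_integral_holomorphic openU holS SU hc) auto
    fix w assume w: "w \<in> U'"
    hence wU: "w \<in> U" by (simp add: U'_def)
    show "V_integral e (\<lambda>a. T a w) n = V_integral d (\<lambda>a. S a w) k *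
     (cross4 e (T 1 w, n 1) (T 2 w, n 2) (T 3 w, n 3) (T 4 w, n 4) * cross4 e (T 5 w, n 5) (T 6 w, n 6) (T 7 w, n 7) (T 8 w, n 8))"
    proof (rule V_transformation_aux[OF TU[OF _ wU] SU[OF _ wU] _ _ _ _ _ _ kn h sum, where f = "F w"])
      show "F w \<noteq> 0" using f by (simp add: F_def)
      show "norm (F w) < 1" "norm (T 1 w) < norm q" "norm (S 5 w) < norm q" using w by (simp_all add: U'_def)
      have "c 1 + c 2 + c 3 + c 4 + (\<phi> + \<phi>) = 0" "c' 5 + c' 6 + c' 7 + c' 8 + (\<phi> + \<phi>) = 0"
        using sumt sums by simp_all
      thus "T 1 w * T 2 w * T 3 w * T 4 w * (F w)\<^sup>2 = p * q" "S 5 w * S 6 w * S 7 w * S 8 w * (F w)\<^sup>2 = p * q"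
        unfolding T_def S_def F_def power2_eq_square exp_scale_mult
        using prodt prods by (simp_all only:) (simp_all add: exp_scale_def power2_eq_square)
      show "S a w = F w * T a w" if "a \<in> {1..4}" for a
        unfolding S_def F_def T_def exp_scale_mult using that by (simp add: st c'_def add.commute)
      show "T a w = F w * S a w" if "a \<in> {5..8}" for a
        unfolding S_def F_def T_def exp_scale_mult using that by (simp add: st c'_def)
    qed
  qed
  thus ?thesis by (simp add: T_def S_def)
qed

end

theorem mainTheorem6:
  fixes r :: nat
    and p q f :: complex
    and \<epsilon> \<delta> :: int
    and t s :: "nat \<Rightarrow> complex"
    and n k :: "nat \<Rightarrow> int"
  assumes "r > 0"
    and "p \<noteq> 0" and "q \<noteq> 0" and "norm p < 1" and "norm q < 1"
    and "\<epsilon> \<in> {0, 1}"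
    and "\<And>a. a \<in> {1..8} \<Longrightarrow> t a \<noteq> 0"
    and "(\<Prod>a = 1..8. t a) = (p * q) ^ 2"
    and "(\<Sum>a = 1..8. n a) + 4 * \<epsilon> = 0"
    and "\<delta> \<in> {0, 1}"
    and "even ((\<Sum>b = 1..4. n b) + \<epsilon> + \<delta>)"
    and "f ^ 2 = p * q / (t 1 * t 2 * t 3 * t 4)"
    and "\<And>a. a \<in> {1..4} \<Longrightarrow> s a = f * t a"
    and "\<And>a. a \<in> {5..8} \<Longrightarrow> s a = inverse f * t a"
    and "\<And>a. a \<in> {1..4} \<Longrightarrow> k a = n a - ((\<Sum>b = 1..4. n b) + \<epsilon> + \<delta>) div 2"
    and "\<And>a. a \<in> {5..8} \<Longrightarrow> k a = n a - ((\<Sum>b = 5..8. n b) + \<epsilon> + \<delta>) div 2"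
    and "\<And>a. a \<in> {1..8} \<Longrightarrow> norm (t a) < 1"
    and "\<And>a. a \<in> {1..8} \<Longrightarrow> norm (s a) < 1"
  shows "rarefied_V r \<epsilon> t n p q =
           rarefied_V r \<delta> s k p q
           * (\<Prod>b \<in> {1..4}. \<Prod>c \<in> {b<..4}.
                rarefied_gamma r (t b * t c) (n b + n c + \<epsilon>) p q
                * rarefied_gamma r (t (b + 4) * t (c + 4)) (n (b + 4) + n (c + 4) + \<epsilon>) p q)"
proof -
  interpret rarefied r p q "Ln p" "Ln q"
    using assms(1-5) by unfold_locales auto
  have i4: "{1..4::nat} = {1, 2, 3, 4}" "{5..8::nat} = {5, 6, 7, 8}" by auto
  have i: "{1<..4::nat} = {2, 3, 4}" "{2<..4::nat} = {3, 4}" "{3<..4::nat} = {4}" "{4<..4::nat} = {}" by auto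
  define h where "h = ((\<Sum>b = 1..4. n b) + \<epsilon> + \<delta>) div 2"
  have h: "2 * h = n 1 + n 2 + n 3 + n 4 + \<epsilon> + \<delta>"
    using assms(11) unfolding h_def i4 by simp
  have sum: "n 1 + n 2 + n 3 + n 4 + n 5 + n 6 + n 7 + n 8 + 4 * \<epsilon> = 0"
    using assms(9) unfolding atLeastAtMost_1_8 by simp
  \<comment> \<open>The condition on all eight labels ties the second half sum to the first, so h
    describes both shifts of labels.\<close>
  have "(\<Sum>b = 5..8. n b) + \<epsilon> + \<delta> = 2 * (\<delta> - \<epsilon> - h)"
    using h sum unfolding i4 by simp
  hence h': "((\<Sum>b = 5..8. n b) + \<epsilon> + \<delta>) div 2 = \<delta> - \<epsilon> - h" by simp
  have t: "t a \<noteq> 0 \<and> norm (t a) < 1" if "a \<in> {1..8}" for a using assms(7,17) that by blast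
  have t4: "t 1 * t 2 * t 3 * t 4 \<noteq> 0" using t by simp
  have f0: "f \<noteq> 0" using assms(2,3,12) t4 by auto
  have s: "s a \<noteq> 0 \<and> norm (s a) < 1" if "a \<in> {1..8}" for a
    using assms(18)[OF that] assms(13,14)[of a] t[OF that] f0 that by (cases "a \<le> 4") auto
  have prodt: "t 1 * t 2 * t 3 * t 4 * f ^ 2 = p * q" using assms(12) t4 by simp
  have ts: "t a = f * s a" if "a \<in> {5..8}" for a using assms(14)[OF that] f0 by simp
  \<comment> \<open>The counterpart of \<open>prodt\<close> for the second half of the parameters,
    which follows from the product of all eight t after cancelling pq.\<close>
  have prods: "s 5 * s 6 * s 7 * s 8 * f ^ 2 = p * q"
  proof -
    have "(p * q) * (s 5 * s 6 * s 7 * s 8 * f ^ 2) = t 1 * t 2 * t 3 * t 4 * (f ^ 2 * f ^ 2) * (s 5 * s 6 * s 7 * s 8)"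
      unfolding prodt[symmetric] by (simp only: mult_ac)
    also have "\<dots> = t 1 * t 2 * t 3 * t 4 * (f * s 5) * (f * s 6) * (f * s 7) * (f * s 8)"
      by (simp only: power2_eq_square mult_ac)
    also have "\<dots> = (p * q) * (p * q)"
      using assms(8) ts[of 5] ts[of 6] ts[of 7] ts[of 8] unfolding prod_1_8 by (simp add: power2_eq_square)
    finally show ?thesis using assms(2,3) by simp
  qed
  have "V_integral \<epsilon> t n = V_integral \<delta> s k *
     (cross4 \<epsilon> (t 1, n 1) (t 2, n 2) (t 3, n 3) (t 4, n 4) * cross4 \<epsilon> (t 5, n 5) (t 6, n 6) (t 7, n 7) (t 8, n 8))"
    by (rule V_transformation[OF t s f0 prodt prods assms(13) ts _ _ h sum])
       (simp_all add: assms(15,16) h' h_def)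
  moreover have "rarefied_V r \<epsilon> t n p q = qpoch_inf (p ^ r) (p ^ r) * qpoch_inf (q ^ r) (q ^ r) / 2 * V_integral \<epsilon> t n"
    by (intro rarefied_V_eq t)
  moreover have "rarefied_V r \<delta> s k p q = qpoch_inf (p ^ r) (p ^ r) * qpoch_inf (q ^ r) (q ^ r) / 2 * V_integral \<delta> s k"
    by (intro rarefied_V_eq s)
  moreover have "(\<Prod>b \<in> {1..4}. \<Prod>c \<in> {b<..4}.
                rarefied_gamma r (t b * t c) (n b + n c + \<epsilon>) p q
                * rarefied_gamma r (t (b + 4) * t (c + 4)) (n (b + 4) + n (c + 4) + \<epsilon>) p q)
      = cross4 \<epsilon> (t 1, n 1) (t 2, n 2) (t 3, n 3) (t 4, n 4) * cross4 \<epsilon> (t 5, n 5) (t 6, n 6) (t 7, n 7) (t 8, n 8)"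
    unfolding i4 cross4_def gcross_def G_def fst_conv snd_conv
    by (simp add: i i[unfolded One_nat_def] mult_ac add_ac)
  ultimately show ?thesis by (simp only: mult.assoc)
qed

end
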